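(* Let $(C_\bullet,\partial^C_\bullet)$ be a chain complex in which each $C_n$ is the free abelian group on a finite set $K_n$, with $K_n\neq\emptyset$ for only finitely many $n$, and let $(G_\bullet,\partial^G_\bullet)$ be a chain complex of finite abelian groups. Let $\mathcal H_0\subset\mathcal H$ be the ground state subspace of the Hamiltonian $H$ described in the context. Then $$\dim\mathcal H_0=|H^0(C,G)|=\prod_n |H^n(C,H_n(G))|,$$ where $H_n(G)$ is the $n$-th homology group of $G_\bullet$ and $H^n(C,H_n(G))$ is the $n$-th cohomology group of $C_\bullet$ with coefficients in $H_n(G)$ (i.e. of the cochain complex $\mathrm{Hom}(C_\bullet,H_n(G))$ with $d(\phi)=\phi\circ\partial^C$).
   Context: For $p\in\mathbb Z$ let $\mathrm{hom}(C,G)^p=\prod_n\mathrm{Hom}(C_n,G_{n-p})$ (a finite abelian group under componentwise addition) with coboundary $\delta^p:\mathrm{hom}(C,G)^p\to\mathrm{hom}(C,G)^{p+1}$, $(\delta^pf)_n=f_{n-1}\partial^C_n-(-1)^p\partial^G_{n-p}f_n$; then $\delta^{p+1}\delta^p=0$ and $H^p(C,G):=\ker\delta^p/\mathrm{im}\,\delta^{p-1}$. Let $\mathrm{hom}(C,G)_p=\mathrm{Hom}(\mathrm{hom}(C,G)^p,U(1))$ be the character group, written additively (the sum of characters is their pointwise product); write $\chi_m(f)=m(f)$, and let $\delta_{p+1}:\mathrm{hom}(C,G)_{p+1}\to\mathrm{hom}(C,G)_p$, $\delta_{p+1}m=m\circ\delta^p$. The Hilbert space is $\mathcal H=\bigotimes_n\bigotimes_{x\in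 K_n}\mathbb C[G_n]$, with orthonormal basis $|f\rangle=\bigotimes_n\bigotimes_{x\in K_n}|f_n(x)\rangle$, $f\in\mathrm{hom}(C,G)^0$. For $t\in\mathrm{hom}(C,G)^0$, $m\in\mathrm{hom}(C,G)_0$ let $P_t|f\rangle=|f+t\rangle$, $Q_m|f\rangle=\chi_m(f)|f\rangle$. For $t\in\mathrm{hom}(C,G)^{-1}$ let $A_t=P_{\delta^{-1}t}$; for $m\in\mathrm{hom}(C,G)_1$ let $B_m=Q_{\delta_1m}$. For $x\in K_n$ and $g\in G_{n-p}$, $gx^*\in\mathrm{hom}(C,G)^p$ is the element whose $n$-th component sends $x\mapsto g$ and every other element of $K_n$ to $0$, all other components being $0$; for $r\in\mathrm{Hom}(G_{n-p},U(1))$, $rx_*\in\mathrm{hom}(C,G)_p$ is $rx_*(f)=r(f_n(x))$. For $x\in K_n$, $r\in\mathrm{Hom}(G_{n+1},U(1))$, $g\in G_{n-1}$ define $A_x^r=\frac1{|G_{n+1}|}\sum_{h\in G_{n+1}}r(h)A_{hx^*}$ and $B_x^g=\frac1{|G_{n-1}|}\sum_{r\in\mathrm{Hom}(G_{n-1},U(1))}r(g)B_{rx_*}$. The Hamiltonian is $H=-\sum_n\sum_{x\in K_n}A_x^0-\sum_n\sum_{y\in K_n}B_y^0$ (superscript $0$ = trivial character, resp. zero element), and the ground state subspace is $\mathcal H_0=\{\Psi\in\mathcal H: A_x^0\Psi=B_x^0\Psi=\Psi\text{ for all }n\text{ and all }x\in K_n\}$. *)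

theory Defs
  imports "HOL-Algebra.Algebra" "HOL-Library.Function_Algebras"
begin

(* Conventions.
   C_n = free abelian group on K n (K :: int => 'k set); the boundary
   d^C_n : C_n -> C_{n-1} is given by its integer matrix:
   d^C_n x = sum_{y in K(n-1)} dC n x y * y   (x in K n).
   G_n is an abelian group (HOL-Algebra, multiplicative notation, so the
   group "0" is \<one> and "+" is \<otimes>), d^G_n = dG n : G_n -> G_{n-1}.
   Hom(C_n, A) is identified with the extensional functions K n -> carrier A. *)

definition homset :: "(int \<Rightarrow> 'k set) \<Rightarrow> (int \<Rightarrow> 'g monoid) \<Rightarrow> int \<Rightarrow> (int \<Rightarrow> 'k \<Rightarrow> 'g) set" where
  "homset K G p = {f. \<forall>n. f n \<in> K n \<rightarrow>\<^sub>E carrier (G (n - p))}"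

definition hadd :: "(int \<Rightarrow> 'k set) \<Rightarrow> (int \<Rightarrow> 'g monoid) \<Rightarrow> int \<Rightarrow> (int \<Rightarrow> 'k \<Rightarrow> 'g) \<Rightarrow> (int \<Rightarrow> 'k \<Rightarrow> 'g) \<Rightarrow> (int \<Rightarrow> 'k \<Rightarrow> 'g)" where
  "hadd K G p f g = (\<lambda>n. \<lambda>x\<in>K n. f n x \<otimes>\<^bsub>G (n - p)\<^esub> g n x)"

definition hzero :: "(int \<Rightarrow> 'k set) \<Rightarrow> (int \<Rightarrow> 'g monoid) \<Rightarrow> int \<Rightarrow> (int \<Rightarrow> 'k \<Rightarrow> 'g)" where
  "hzero K G p = (\<lambda>n. \<lambda>x\<in>K n. \<one>\<^bsub>G (n - p)\<^esub>)"

definition hneg :: "(int \<Rightarrow> 'k set) \<Rightarrow> (int \<Rightarrow> 'g monoid) \<Rightarrow> int \<Rightarrow> (int \<Rightarrow> 'k \<Rightarrow> 'g) \<Rightarrow> (int \<Rightarrow> 'k \<Rightarrow> 'g)" where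
  "hneg K G p f = (\<lambda>n. \<lambda>x\<in>K n. inv\<^bsub>G (n - p)\<^esub> (f n x))"

definition homgrp :: "(int \<Rightarrow> 'k set) \<Rightarrow> (int \<Rightarrow> 'g monoid) \<Rightarrow> int \<Rightarrow> (int \<Rightarrow> 'k \<Rightarrow> 'g) monoid" where
  "homgrp K G p = \<lparr>carrier = homset K G p, monoid.mult = hadd K G p, monoid.one = hzero K G p\<rparr>"

(* coboundary delta^p : hom^p -> hom^(p+1),
   (delta^p f)_n = f_{n-1} o d^C_n - (-1)^p d^G_{n-p} o f_n *)
definition cobdry :: "(int \<Rightarrow> 'k set) \<Rightarrow> (int \<Rightarrow> 'k \<Rightarrow> 'k \<Rightarrow> int) \<Rightarrow> (int \<Rightarrow> 'g monoid) \<Rightarrow> (int \<Rightarrow> 'g \<Rightarrow> 'g)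
    \<Rightarrow> int \<Rightarrow> (int \<Rightarrow> 'k \<Rightarrow> 'g) \<Rightarrow> (int \<Rightarrow> 'k \<Rightarrow> 'g)" where
  "cobdry K dC G dG p f = (\<lambda>n. \<lambda>x\<in>K n.
      finprod (G (n - p - 1)) (\<lambda>y. f (n - 1) y [^]\<^bsub>G (n - p - 1)\<^esub> (dC n x y)) (K (n - 1))
      \<otimes>\<^bsub>G (n - p - 1)\<^esub>
      (dG (n - p) (f n x)) [^]\<^bsub>G (n - p - 1)\<^esub> (if even p then -1 else (1::int)))"

definition H0_hom :: "(int \<Rightarrow> 'k set) \<Rightarrow> (int \<Rightarrow> 'k \<Rightarrow> 'k \<Rightarrow> int) \<Rightarrow> (int \<Rightarrow> 'g monoid) \<Rightarrow> (int \<Rightarrow> 'g \<Rightarrow> 'g)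
    \<Rightarrow> (int \<Rightarrow> 'k \<Rightarrow> 'g) set monoid" where
  "H0_hom K dC G dG =
     ((homgrp K G 0)\<lparr>carrier := {f \<in> homset K G 0. cobdry K dC G dG 0 f = hzero K G 1}\<rparr>)
       Mod (cobdry K dC G dG (-1) ` homset K G (-1))"

definition cochgrp :: "(int \<Rightarrow> 'k set) \<Rightarrow> ('a, 'b) monoid_scheme \<Rightarrow> int \<Rightarrow> ('k \<Rightarrow> 'a) monoid" where
  "cochgrp K A n = \<lparr>carrier = K n \<rightarrow>\<^sub>E carrier A,
                    monoid.mult = (\<lambda>\<phi> \<psi>. \<lambda>x\<in>K n. \<phi> x \<otimes>\<^bsub>A\<^esub> \<psi> x),
                    monoid.one = (\<lambda>x\<in>K n. \<one>\<^bsub>A\<^esub>)\<rparr>"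

definition cobdryA :: "(int \<Rightarrow> 'k set) \<Rightarrow> (int \<Rightarrow> 'k \<Rightarrow> 'k \<Rightarrow> int) \<Rightarrow> ('a, 'b) monoid_scheme \<Rightarrow> int
    \<Rightarrow> ('k \<Rightarrow> 'a) \<Rightarrow> ('k \<Rightarrow> 'a)" where
  "cobdryA K dC A n \<phi> = (\<lambda>x\<in>K (n + 1). finprod A (\<lambda>y. \<phi> y [^]\<^bsub>A\<^esub> (dC (n + 1) x y)) (K n))"

definition cohom :: "(int \<Rightarrow> 'k set) \<Rightarrow> (int \<Rightarrow> 'k \<Rightarrow> 'k \<Rightarrow> int) \<Rightarrow> ('a, 'b) monoid_scheme \<Rightarrow> int
    \<Rightarrow> ('k \<Rightarrow> 'a) set monoid" where
  "cohom K dC A n =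
     ((cochgrp K A n)\<lparr>carrier := {\<phi> \<in> K n \<rightarrow>\<^sub>E carrier A. cobdryA K dC A n \<phi> = (\<lambda>x\<in>K (n + 1). \<one>\<^bsub>A\<^esub>)}\<rparr>)
       Mod (cobdryA K dC A (n - 1) ` (K (n - 1) \<rightarrow>\<^sub>E carrier A))"

definition homology :: "(int \<Rightarrow> 'g monoid) \<Rightarrow> (int \<Rightarrow> 'g \<Rightarrow> 'g) \<Rightarrow> int \<Rightarrow> 'g set monoid" where
  "homology G dG n = ((G n)\<lparr>carrier := kernel (G n) (G (n - 1)) (dG n)\<rparr>) Mod (dG (n + 1) ` carrier (G (n + 1)))"

definition chars :: "('a, 'b) monoid_scheme \<Rightarrow> ('a \<Rightarrow> complex) set" where
  "chars A = {r \<in> carrier A \<rightarrow>\<^sub>E {z. cmod z = 1}.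
                \<forall>a\<in>carrier A. \<forall>b\<in>carrier A. r (a \<otimes>\<^bsub>A\<^esub> b) = r a * r b}"

(* Hilbert space: complex functions on the basis hom(C,G)^0 (|f> = indicator of f) *)
definition hilbert :: "(int \<Rightarrow> 'k set) \<Rightarrow> (int \<Rightarrow> 'g monoid) \<Rightarrow> ((int \<Rightarrow> 'k \<Rightarrow> 'g) \<Rightarrow> complex) set" where
  "hilbert K G = {\<Psi>. \<forall>f. f \<notin> homset K G 0 \<longrightarrow> \<Psi> f = 0}"

(* P_t |f> = |f + t> ; Q_m |f> = chi_m(f) |f> *)
definition Pop :: "(int \<Rightarrow> 'k set) \<Rightarrow> (int \<Rightarrow> 'g monoid) \<Rightarrow> (int \<Rightarrow> 'k \<Rightarrow> 'g)
    \<Rightarrow> ((int \<Rightarrow> 'k \<Rightarrow> 'g) \<Rightarrow> complex) \<Rightarrow> ((int \<Rightarrow> 'k \<Rightarrow> 'g) \<Rightarrow> complex)" where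
  "Pop K G t \<Psi> = (\<lambda>f. if f \<in> homset K G 0 then \<Psi> (hadd K G 0 f (hneg K G 0 t)) else 0)"

definition Qop :: "(int \<Rightarrow> 'k set) \<Rightarrow> (int \<Rightarrow> 'g monoid) \<Rightarrow> ((int \<Rightarrow> 'k \<Rightarrow> 'g) \<Rightarrow> complex)
    \<Rightarrow> ((int \<Rightarrow> 'k \<Rightarrow> 'g) \<Rightarrow> complex) \<Rightarrow> ((int \<Rightarrow> 'k \<Rightarrow> 'g) \<Rightarrow> complex)" where
  "Qop K G m \<Psi> = (\<lambda>f. if f \<in> homset K G 0 then m f * \<Psi> f else 0)"

(* A_t = P_{delta^{-1} t} (t in hom^{-1}); B_m = Q_{delta_1 m} = Q_{m o delta^0} (m a character of hom^1) *)
definition Aop where "Aop K dC G dG t = Pop K G (cobdry K dC G dG (-1) t)"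
definition Bop where "Bop K dC G dG m = Qop K G (\<lambda>f. m (cobdry K dC G dG 0 f))"

definition dualbasis :: "(int \<Rightarrow> 'k set) \<Rightarrow> (int \<Rightarrow> 'g monoid) \<Rightarrow> int \<Rightarrow> int \<Rightarrow> 'k \<Rightarrow> 'g \<Rightarrow> (int \<Rightarrow> 'k \<Rightarrow> 'g)" where
  "dualbasis K G p n x g = (\<lambda>m. \<lambda>y\<in>K m. if m = n \<and> y = x then g else \<one>\<^bsub>G (m - p)\<^esub>)"

definition Avert where
  "Avert K dC G dG n x r \<Psi> = (\<lambda>f. (1 / of_nat (card (carrier (G (n + 1))))) *
      (\<Sum>h\<in>carrier (G (n + 1)). r h * Aop K dC G dG (dualbasis K G (-1) n x h) \<Psi> f))"

definition Bvert where
  "Bvert K dC G dG n x g \<Psi> = (\<lambda>f. (1 / of_nat (card (carrier (G (n - 1))))) *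
      (\<Sum>r\<in>chars (G (n - 1)). r g * Bop K dC G dG (\<lambda>\<phi>. r (\<phi> n x)) \<Psi> f))"

definition ground where
  "ground K dC G dG = {\<Psi> \<in> hilbert K G. \<forall>n. \<forall>x\<in>K n.
      Avert K dC G dG n x (\<lambda>_. 1) \<Psi> = \<Psi> \<and> Bvert K dC G dG n x \<one>\<^bsub>G (n - 1)\<^esub> \<Psi> = \<Psi>}"

end

theory Submission
  imports Defs
begin

text \<open>
  A state is fixed by all \<open>A\<^sub>x\<close> iff it is invariant under translation by the image of \<open>\<delta>\<close> in degree \<open>-1\<close>,
  because the elements \<open>gx\<^sup>*\<close> generate the cochains of degree \<open>-1\<close>; by orthogonality of characters it is
  fixed by all \<open>B\<^sub>x\<close> iff it is supported on cocycles. So the indicator functions of the cohomology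
  classes form a basis of the ground states.

  For the product formula write \<open>Z\<^sub>n\<close> for the cycles of \<open>G\<^sub>n\<close>. Since divisible groups are injective,
  the extension of the boundaries in \<open>G\<^bsub>n-1\<^esub>\<close> by \<open>Z\<^sub>n\<close> given by \<open>G\<^sub>n\<close> embeds into an extension \<open>E\<^sub>n\<close> of all
  of \<open>Z\<^bsub>n-1\<^esub>\<close> by \<open>Z\<^sub>n\<close>. With the differential \<open>E\<^sub>n \<rightarrow> Z\<^bsub>n-1\<^esub> \<rightarrow> E\<^bsub>n-1\<^esub>\<close> the complex \<open>E\<close> is exact, it contains \<open>G\<close>,
  and the quotient \<open>E\<^sub>n / G\<^sub>n\<close> is \<open>H\<^bsub>n-1\<^esub>(G)\<close> with zero differential. As \<open>C\<close> is free and bounded below,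
  \<open>hom(C, E)\<close> is exact too, and the connecting homomorphism identifies \<open>H\<^sup>0(C, G)\<close> with the product of
  the groups \<open>H\<^sup>n(C, H\<^sub>n(G))\<close>.
\<close>

subsection \<open>Extending homomorphisms into divisible groups\<close>

text \<open>The obstacle is that \<open>G\<close> and its homology, taken with zero differential,
  need not be joined by a quasi-isomorphism in either direction: for multiplication by 2 on Z/4
  neither direction has one. A third complex is therefore unavoidable. Its existence expresses that
  Ext^2 vanishes over the integers, that is, that Ext^1(Z_{n-1}, Z_n) maps onto Ext^1(B_{n-1}, Z_n),
  where Z and B are the cycles and boundaries of \<open>G\<close>; here this takes the form that a
  quotient of a divisible group is again divisible. Finiteness of the groups \<open>G n\<close> lets
  homomorphisms be extended one element at a time. The connecting homomorphism is treated as a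
  relation between cocycles \<open>f\<close> and cochains \<open>e\<close> bounding them in E. It is
  total on both sides and matches coboundaries with coboundaries, so cosets can be counted without a
  map between quotient groups. The cochain \<open>e\<close> has degree -1 and sends
  \<open>K n\<close> to E_{n+1}, whose quotient by \<open>G (n + 1)\<close> is H_n(G); this is why
  degree \<open>n\<close> of C meets H_n(G) in the product.\<close>

definition divisible :: "('a, 'b) monoid_scheme \<Rightarrow> bool" where
  "divisible D \<longleftrightarrow> (\<forall>m>0::nat. \<forall>d\<in>carrier D. \<exists>e\<in>carrier D. e [^]\<^bsub>D\<^esub> m = d)"

text \<open>The only relations between \<open>H\<close> and \<open>a\<close> are the powers of
  \<open>a\<close> that lie in \<open>H\<close>; once \<open>d\<close> respects these, x a^k -> h(x)
  d^k does not depend on the presentation of the element (\<open>uniq\<close>). The value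
  \<open>d\<close> is prescribed, since separating characters need control over it.\<close>

lemma hom_adjoin_element:
  assumes A: "comm_group A" and D: "comm_group D"
    and H: "subgroup H A" and h: "h \<in> hom (A\<lparr>carrier := H\<rparr>) D"
    and a: "a \<in> carrier A" and d: "d \<in> carrier D"
    and hd: "\<And>k::int. a [^]\<^bsub>A\<^esub> k \<in> H \<Longrightarrow> h (a [^]\<^bsub>A\<^esub> k) = d [^]\<^bsub>D\<^esub> k"
  shows "\<exists>H' h'. subgroup H' A \<and> insert a H \<subseteq> H' \<and> h' \<in> hom (A\<lparr>carrier := H'\<rparr>) D \<and> (\<forall>x\<in>H. h' x = h x) \<and> h' a = d"
proof -
  interpret A: comm_group A by (rule A)
  interpret D: comm_group D by (rule D)
  interpret H: subgroup H A by (rule H)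
  have gH: "group (A\<lparr>carrier := H\<rparr>)" by (rule H.subgroup_is_group) (rule A.group_axioms)
  interpret h: group_hom "A\<lparr>carrier := H\<rparr>" D h
    using gH h by (simp add: group_hom_def group_hom_axioms_def D.group_axioms)
  have hc: "h x \<in> carrier D" if "x \<in> H" for x using h.hom_closed that by simp
  have hm: "h (x \<otimes>\<^bsub>A\<^esub> y) = h x \<otimes>\<^bsub>D\<^esub> h y" if "x \<in> H" "y \<in> H" for x y
    using h.hom_mult that by simp
  have uniq: "h x \<otimes>\<^bsub>D\<^esub> d [^]\<^bsub>D\<^esub> k = h y \<otimes>\<^bsub>D\<^esub> d [^]\<^bsub>D\<^esub> l"
    if xy: "x \<in> H" "y \<in> H" and eq: "x \<otimes>\<^bsub>A\<^esub> a [^]\<^bsub>A\<^esub> k = y \<otimes>\<^bsub>A\<^esub> a [^]\<^bsub>A\<^esub> l" for x y and k l :: int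
  proof -
    have c: "x \<in> carrier A" "y \<in> carrier A" "a [^]\<^bsub>A\<^esub> k \<in> carrier A" "a [^]\<^bsub>A\<^esub> l \<in> carrier A"
      using xy a by auto
    have y: "x \<otimes>\<^bsub>A\<^esub> a [^]\<^bsub>A\<^esub> (k - l) = y"
    proof -
      have "x \<otimes>\<^bsub>A\<^esub> a [^]\<^bsub>A\<^esub> (k - l) = (x \<otimes>\<^bsub>A\<^esub> a [^]\<^bsub>A\<^esub> k) \<otimes>\<^bsub>A\<^esub> inv\<^bsub>A\<^esub> (a [^]\<^bsub>A\<^esub> l)"
        using c a by (simp add: A.int_pow_diff A.m_assoc)
      also have "\<dots> = y" unfolding eq using c by (simp add: A.m_assoc)
      finally show ?thesis .
    qed
    have kl: "a [^]\<^bsub>A\<^esub> (k - l) \<in> H"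
    proof -
      have "a [^]\<^bsub>A\<^esub> (k - l) = inv\<^bsub>A\<^esub> x \<otimes>\<^bsub>A\<^esub> y" using y c a
        by (metis A.int_pow_closed A.inv_solve_left)
      then show ?thesis using xy by simp
    qed
    have "h y = h x \<otimes>\<^bsub>D\<^esub> d [^]\<^bsub>D\<^esub> (k - l)" using hm[OF xy(1) kl] hd[OF kl] y by simp
    then have "h y \<otimes>\<^bsub>D\<^esub> d [^]\<^bsub>D\<^esub> l = h x \<otimes>\<^bsub>D\<^esub> (d [^]\<^bsub>D\<^esub> (k - l) \<otimes>\<^bsub>D\<^esub> d [^]\<^bsub>D\<^esub> l)"
      using hc xy d by (simp add: D.m_assoc)
    also have "d [^]\<^bsub>D\<^esub> (k - l) \<otimes>\<^bsub>D\<^esub> d [^]\<^bsub>D\<^esub> l = d [^]\<^bsub>D\<^esub> k"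
      using D.int_pow_mult[OF d, of "k - l" l] by simp
    finally show ?thesis by simp
  qed
  define H' where "H' = {x \<otimes>\<^bsub>A\<^esub> a [^]\<^bsub>A\<^esub> k | x k. x \<in> H \<and> k \<in> (UNIV :: int set)}"
  define h' where "h' u = (SOME v. \<exists>x\<in>H. \<exists>k::int. u = x \<otimes>\<^bsub>A\<^esub> a [^]\<^bsub>A\<^esub> k \<and> v = h x \<otimes>\<^bsub>D\<^esub> d [^]\<^bsub>D\<^esub> k)" for u
  have h'_eq: "h' (x \<otimes>\<^bsub>A\<^esub> a [^]\<^bsub>A\<^esub> k) = h x \<otimes>\<^bsub>D\<^esub> d [^]\<^bsub>D\<^esub> k" if "x \<in> H" for x and k :: int
    unfolding h'_def
  proof (rule some_equality)
    show "\<exists>y\<in>H. \<exists>l::int. x \<otimes>\<^bsub>A\<^esub> a [^]\<^bsub>A\<^esub> k = y \<otimes>\<^bsub>A\<^esub> a [^]\<^bsub>A\<^esub> l \<and> h x \<otimes>\<^bsub>D\<^esub> d [^]\<^bsub>D\<^esub> k = h y \<otimes>\<^bsub>D\<^esub> d [^]\<^bsub>D\<^esub> l"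
      by (rule bexI[OF _ that], rule exI[of _ k]) simp
  next
    fix v assume "\<exists>y\<in>H. \<exists>l::int. x \<otimes>\<^bsub>A\<^esub> a [^]\<^bsub>A\<^esub> k = y \<otimes>\<^bsub>A\<^esub> a [^]\<^bsub>A\<^esub> l \<and> v = h y \<otimes>\<^bsub>D\<^esub> d [^]\<^bsub>D\<^esub> l"
    then obtain y l where y: "y \<in> H" "x \<otimes>\<^bsub>A\<^esub> a [^]\<^bsub>A\<^esub> k = y \<otimes>\<^bsub>A\<^esub> a [^]\<^bsub>A\<^esub> l" and v: "v = h y \<otimes>\<^bsub>D\<^esub> d [^]\<^bsub>D\<^esub> (l::int)"
      by (elim bexE exE conjE)
    show "v = h x \<otimes>\<^bsub>D\<^esub> d [^]\<^bsub>D\<^esub> k" unfolding v by (rule uniq[OF that y, symmetric])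
  qed
  have prod: "(x \<otimes>\<^bsub>A\<^esub> a [^]\<^bsub>A\<^esub> k) \<otimes>\<^bsub>A\<^esub> (y \<otimes>\<^bsub>A\<^esub> a [^]\<^bsub>A\<^esub> l) = (x \<otimes>\<^bsub>A\<^esub> y) \<otimes>\<^bsub>A\<^esub> a [^]\<^bsub>A\<^esub> (k + l)"
    if "x \<in> H" "y \<in> H" for x y and k l :: int
    using that a by (simp add: A.int_pow_mult A.m_ac)
  have HH': "x \<in> H'" if "x \<in> H" for x
    unfolding H'_def by (rule CollectI, rule exI[of _ x], rule exI[of _ 0]) (use that in simp)
  have aH': "a \<in> H'"
    unfolding H'_def by (rule CollectI, rule exI[of _ "\<one>\<^bsub>A\<^esub>"], rule exI[of _ 1]) (use a in simp)
  have sub: "subgroup H' A"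
  proof
    show "H' \<subseteq> carrier A" unfolding H'_def using a by auto
    show "\<one>\<^bsub>A\<^esub> \<in> H'" by (rule HH') simp
    show "x \<otimes>\<^bsub>A\<^esub> y \<in> H'" if x: "x \<in> H'" and y: "y \<in> H'" for x y
    proof -
      obtain u k where u: "x = u \<otimes>\<^bsub>A\<^esub> a [^]\<^bsub>A\<^esub> (k::int)" "u \<in> H" using x unfolding H'_def by auto
      obtain v l where v: "y = v \<otimes>\<^bsub>A\<^esub> a [^]\<^bsub>A\<^esub> (l::int)" "v \<in> H" using y unfolding H'_def by auto
      show ?thesis unfolding H'_def u(1) v(1) prod[OF u(2) v(2)]
        using H.m_closed[OF u(2) v(2)] by (intro CollectI exI conjI refl) auto
    qed
    show "inv\<^bsub>A\<^esub> x \<in> H'" if xH': "x \<in> H'" for x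
    proof -
      obtain y k where y: "x = y \<otimes>\<^bsub>A\<^esub> a [^]\<^bsub>A\<^esub> (k::int)" "y \<in> H" using xH' unfolding H'_def by auto
      then have "inv\<^bsub>A\<^esub> x = inv\<^bsub>A\<^esub> y \<otimes>\<^bsub>A\<^esub> a [^]\<^bsub>A\<^esub> (-k)"
        using a by (simp add: A.inv_mult A.int_pow_neg)
      then show ?thesis unfolding H'_def using H.m_inv_closed[OF y(2)] by (intro CollectI exI conjI) auto
    qed
  qed
  have "h' \<in> hom (A\<lparr>carrier := H'\<rparr>) D"
  proof (rule homI)
    fix x assume "x \<in> carrier (A\<lparr>carrier := H'\<rparr>)"
    then show "h' x \<in> carrier D" unfolding H'_def by (auto simp: h'_eq hc d)
  next
    fix x y assume "x \<in> carrier (A\<lparr>carrier := H'\<rparr>)" "y \<in> carrier (A\<lparr>carrier := H'\<rparr>)"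
    then obtain u k v l where x: "x = u \<otimes>\<^bsub>A\<^esub> a [^]\<^bsub>A\<^esub> (k::int)" "u \<in> H" and y: "y = v \<otimes>\<^bsub>A\<^esub> a [^]\<^bsub>A\<^esub> (l::int)" "v \<in> H"
      unfolding H'_def by auto
    have "h' (x \<otimes>\<^bsub>A\<^esub> y) = h' x \<otimes>\<^bsub>D\<^esub> h' y"
      unfolding x(1) y(1) using x(2) y(2) hc d a
      by (simp add: prod h'_eq hm D.int_pow_mult D.m_ac)
    then show "h' (x \<otimes>\<^bsub>A\<lparr>carrier := H'\<rparr>\<^esub> y) = h' x \<otimes>\<^bsub>D\<^esub> h' y" by simp
  qed
  moreover have "h' x = h x" if "x \<in> H" for x
    using h'_eq[OF that, of 0] that hc by simp
  moreover have "insert a H \<subseteq> H'" using HH' aH' by auto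
  moreover have "h' a = d" using h'_eq[OF H.one_closed, of 1] h.hom_one a d by simp
  ultimately show ?thesis using sub by (intro exI[of _ H'] exI[of _ h']) simp
qed

text \<open>The exponents k with a^k in \<open>H\<close> are the multiples of a least positive m. An
  m-th root \<open>d\<close> of h(a^m) thus satisfies all the compatibility conditions of
  \<open>hom_adjoin_element\<close> at once.\<close>

lemma hom_adjoin_divisible:
  assumes A: "comm_group A" and fin: "finite (carrier A)"
    and D: "comm_group D" "divisible D"
    and H: "subgroup H A" and h: "h \<in> hom (A\<lparr>carrier := H\<rparr>) D"
    and a: "a \<in> carrier A"
  shows "\<exists>H' h'. subgroup H' A \<and> insert a H \<subseteq> H' \<and> h' \<in> hom (A\<lparr>carrier := H'\<rparr>) D \<and> (\<forall>x\<in>H. h' x = h x)"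
proof -
  interpret A: comm_group A by (rule A)
  interpret D: comm_group D by (rule D)
  interpret H: subgroup H A by (rule H)
  have gH: "group (A\<lparr>carrier := H\<rparr>)" by (rule H.subgroup_is_group) (rule A.group_axioms)
  interpret h: group_hom "A\<lparr>carrier := H\<rparr>" D h
    using gH h by (simp add: group_hom_def group_hom_axioms_def D.group_axioms)
  have hc: "h x \<in> carrier D" if "x \<in> H" for x using h.hom_closed that by simp
  have hp: "h (x [^]\<^bsub>A\<^esub> (k::int)) = h x [^]\<^bsub>D\<^esub> k" if "x \<in> H" for x k
    using h.hom_int_pow[of x k] A.int_pow_consistent[OF H that, of k] that by simp
  \<comment> \<open>Finiteness enters here: the order of \<open>a\<close> is a positive exponent
    whose power is the identity, which lies in \<open>H\<close>.\<close>
  have ex: "\<exists>m::nat. 0 < m \<and> a [^]\<^bsub>A\<^esub> m \<in> H"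
    using A.ord_ge_1[OF fin a] A.pow_ord_eq_1[OF a]
    by (intro exI[of _ "A.ord a"]) simp
  define m where "m = (LEAST m::nat. 0 < m \<and> a [^]\<^bsub>A\<^esub> m \<in> H)"
  have m: "0 < m" "a [^]\<^bsub>A\<^esub> m \<in> H" unfolding m_def using LeastI_ex[OF ex] by auto
  have mmin: "m \<le> k" if "0 < k" "a [^]\<^bsub>A\<^esub> k \<in> H" for k :: nat
    unfolding m_def by (rule Least_le) (use that in simp)
  have mH: "(a [^]\<^bsub>A\<^esub> m) [^]\<^bsub>A\<^esub> (q::int) \<in> H" for q
    using A.subgroup_int_pow_closed[OF H m(2)] .
  have apm: "a [^]\<^bsub>A\<^esub> (int m * q) = (a [^]\<^bsub>A\<^esub> m) [^]\<^bsub>A\<^esub> q" for q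
    using A.int_pow_pow[OF a, of "int m" q] by (simp add: int_pow_int)
  \<comment> \<open>Euclidean division: the remainder of k modulo m is again such an exponent and is
    smaller than m, so it is 0.\<close>
  have dvd: "int m dvd k" if "a [^]\<^bsub>A\<^esub> (k::int) \<in> H" for k
  proof -
    have "a [^]\<^bsub>A\<^esub> (k mod int m) = a [^]\<^bsub>A\<^esub> (k - int m * (k div int m))"
      by (simp add: minus_mult_div_eq_mod)
    also have "\<dots> = a [^]\<^bsub>A\<^esub> k \<otimes>\<^bsub>A\<^esub> inv\<^bsub>A\<^esub> ((a [^]\<^bsub>A\<^esub> m) [^]\<^bsub>A\<^esub> (k div int m))"
      by (simp add: A.int_pow_diff a apm)
    also have "\<dots> \<in> H" by (intro H.m_closed H.m_inv_closed that mH)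
    finally have H: "a [^]\<^bsub>A\<^esub> nat (k mod int m) \<in> H"
      using m(1) by (simp add: int_pow_int[symmetric])
    have "nat (k mod int m) < m" using m(1) by (simp add: nat_less_iff)
    then have "\<not> 0 < nat (k mod int m)" using mmin[OF _ H] by linarith
    moreover have "0 \<le> k mod int m" using m(1) by simp
    ultimately have "k mod int m = 0" by linarith
    then show ?thesis by (simp add: dvd_eq_mod_eq_0)
  qed
  obtain d where d: "d \<in> carrier D" "d [^]\<^bsub>D\<^esub> m = h (a [^]\<^bsub>A\<^esub> m)"
    using D(2) m hc unfolding divisible_def by blast
  have hd: "h (a [^]\<^bsub>A\<^esub> k) = d [^]\<^bsub>D\<^esub> k" if kH: "a [^]\<^bsub>A\<^esub> (k::int) \<in> H" for k
  proof -
    obtain q where q: "k = int m * q" using dvd[OF kH] by (auto elim: dvdE)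
    show ?thesis unfolding q apm using hp[OF m(2), of q] d D.int_pow_pow[OF d(1), of "int m" q]
      by (simp add: int_pow_int)
  qed
  show ?thesis using hom_adjoin_element[OF A D(1) H h a d(1) hd] by auto
qed

text \<open>Injectivity of divisible groups. As the domain is finite, adjoining elements one by one
  exhausts it, so induction on the number of missing elements replaces a maximality
  argument.\<close>

lemma hom_extension:
  assumes A: "comm_group A" and fin: "finite (carrier A)"
    and D: "comm_group D" "divisible D"
    and H: "subgroup H A" and h: "h \<in> hom (A\<lparr>carrier := H\<rparr>) D"
  shows "\<exists>h'\<in>hom A D. \<forall>x\<in>H. h' x = h x"
  using H h
proof (induction "card (carrier A) - card H" arbitrary: H h rule: less_induct)
  case less
  show ?case
  proof (cases "H = carrier A")
    case True
    then show ?thesis using less.prems by (auto intro!: bexI[of _ h])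
  next
    case False
    then obtain a where a: "a \<in> carrier A" "a \<notin> H"
      using less.prems(1) subgroup.subset by blast
    from hom_adjoin_divisible[OF A fin D less.prems a(1)]
    obtain H' h' where H': "subgroup H' A" "insert a H \<subseteq> H'" "h' \<in> hom (A\<lparr>carrier := H'\<rparr>) D" "\<forall>x\<in>H. h' x = h x"
      by blast
    have "finite H'" "H' \<subseteq> carrier A" using H'(1) fin subgroup.subset finite_subset by metis+
    then have "card H < card H'" "card H' \<le> card (carrier A)" using H'(2) fin a(2) by (auto intro!: psubset_card_mono card_mono)
    then have "card (carrier A) - card H' < card (carrier A) - card H" by simp
    from less.hyps[OF this H'(1,3)] obtain k where "k \<in> hom A D" "\<forall>x\<in>H'. k x = h' x" ..
    then show ?thesis using H'(2,4) by (intro bexI[of _ k]) auto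
  qed
qed

subsection \<open>Characters of finite abelian groups\<close>

text \<open>A power of the circle U(1). The index type \<open>unit\<close> gives the circle itself;
  indexed by functions to the complex numbers, it has a coordinate for every character, which makes
  room for an embedding of a finite abelian group.\<close>

definition torus :: "('i \<Rightarrow> complex) monoid" where
  "torus = \<lparr>carrier = {t. \<forall>i. cmod (t i) = 1}, monoid.mult = (\<lambda>s t i. s i * t i), monoid.one = (\<lambda>_. 1)\<rparr>"

lemma torus_simps [simp]:
  "t \<in> carrier torus \<longleftrightarrow> (\<forall>i. cmod (t i) = 1)"
  "s \<otimes>\<^bsub>torus\<^esub> t = (\<lambda>i. s i * t i)" "\<one>\<^bsub>torus\<^esub> = (\<lambda>_. 1)"
  by (auto simp: torus_def)

lemma comm_group_torus: "comm_group torus"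
proof (rule comm_groupI)
  fix t :: "'i \<Rightarrow> complex" assume t: "t \<in> carrier torus"
  then have "t i \<noteq> 0" for i by (metis torus_simps(1) norm_zero zero_neq_one)
  then show "\<exists>s\<in>carrier torus. s \<otimes>\<^bsub>torus\<^esub> t = \<one>\<^bsub>torus\<^esub>"
    using t by (intro bexI[of _ "\<lambda>i. inverse (t i)"]) (auto simp: norm_inverse)
qed (auto simp: norm_mult mult_ac)

lemma torus_pow: "t [^]\<^bsub>torus\<^esub> (m::nat) = (\<lambda>i. t i ^ m)"
  by (induction m) (auto simp: mult.commute nat_pow_def)

lemma divisible_torus: "divisible torus"
  unfolding divisible_def
proof (intro allI impI ballI)
  fix m :: nat and t :: "'i \<Rightarrow> complex" assume m: "0 < m" and t: "t \<in> carrier torus"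
  have "cis (Arg (t i) / real m) ^ m = t i" for i
  proof -
    have "cis (Arg (t i) / real m) ^ m = cis (Arg (t i))" using m by (simp add: DeMoivre)
    also have "\<dots> = t i" using t cis_Arg[of "t i"]
      by (cases "t i = 0") (auto simp: sgn_div_norm dest: spec[of _ i])
    finally show ?thesis .
  qed
  then show "\<exists>e\<in>carrier torus. e [^]\<^bsub>torus\<^esub> m = t"
    by (intro bexI[of _ "\<lambda>i. cis (Arg (t i) / real m)"]) (auto simp: torus_pow)
qed

lemma chars_iff:
  "r \<in> chars A \<longleftrightarrow> r \<in> extensional (carrier A) \<and> (\<forall>a\<in>carrier A. cmod (r a) = 1) \<and>
     (\<forall>a\<in>carrier A. \<forall>b\<in>carrier A. r (a \<otimes>\<^bsub>A\<^esub> b) = r a * r b)"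
  by (auto simp: chars_def PiE_iff)

context comm_group
begin

lemma chars_one: "r \<in> chars G \<Longrightarrow> r \<one> = 1"
proof -
  assume r: "r \<in> chars G"
  then have "cmod (r \<one>) = 1" "r (\<one> \<otimes> \<one>) = r \<one> * r \<one>" unfolding chars_iff by blast+
  then show ?thesis by auto
qed

text \<open>Sending \<open>a\<close> to exp(2 pi i / ord a) respects every relation of the cyclic
  group that \<open>a\<close> generates, and the circle is divisible, so this extends to a character
  of the whole group.\<close>

lemma chars_separate:
  assumes fin: "finite (carrier G)" and a: "a \<in> carrier G" "a \<noteq> \<one>"
  shows "\<exists>r\<in>chars G. r a \<noteq> 1"
proof -
  define d :: "unit \<Rightarrow> complex" where "d = (\<lambda>_. cis (2 * pi / ord a))"
  have o: "ord a > 1" using ord_ge_1[OF fin a(1)] ord_eq_1[OF a(1)] a(2) by linarith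
  have d: "d \<in> carrier torus" by (simp add: d_def)
  interpret T: comm_group torus by (rule comm_group_torus)
  have triv: "(\<lambda>_. \<one>\<^bsub>torus\<^esub>) \<in> hom (G\<lparr>carrier := {\<one>}\<rparr>) torus" by (auto intro!: homI)
  have do: "d [^]\<^bsub>torus\<^esub> ord a = \<one>\<^bsub>torus\<^esub>"
    using o by (simp add: torus_pow d_def DeMoivre)
  have hd: "\<one>\<^bsub>torus\<^esub> = d [^]\<^bsub>torus\<^esub> k" if k: "a [^] k \<in> {\<one>}" for k :: int
  proof -
    have "int (ord a) dvd k" using k int_pow_eq_id[OF a(1)] by simp
    then obtain q where q: "k = int (ord a) * q" by auto
    have "d [^]\<^bsub>torus\<^esub> k = (d [^]\<^bsub>torus\<^esub> ord a) [^]\<^bsub>torus\<^esub> q"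
      unfolding q using T.int_pow_pow[OF d, of "int (ord a)" q] by (simp add: int_pow_int)
    then show ?thesis unfolding do by (simp add: T.int_pow_one del: torus_simps)
  qed
  obtain H h where H: "subgroup H G" "a \<in> H" "h \<in> hom (G\<lparr>carrier := H\<rparr>) torus" "h a = d"
    using hom_adjoin_element[OF comm_group_axioms comm_group_torus triv_subgroup triv a(1) d hd] by auto
  obtain \<chi> where \<chi>: "\<chi> \<in> hom G torus" "\<forall>x\<in>H. \<chi> x = h x"
    using hom_extension[OF comm_group_axioms fin comm_group_torus divisible_torus H(1,3)] by auto
  define r where "r = (\<lambda>x\<in>carrier G. \<chi> x ())"
  have "r \<in> chars G"
    using \<chi>(1) unfolding chars_iff r_def by (auto simp: hom_def Pi_iff)
  moreover have "r a = cis (2 * pi / ord a)" using H \<chi>(2) a by (auto simp: r_def d_def)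
  moreover have "cis (2 * pi / ord a) \<noteq> 1"
  proof
    assume "cis (2 * pi / ord a) = 1"
    then have "cos (2 * pi / ord a) = 1" by (metis cis.simps(1) one_complex.simps(1))
    then obtain n where "2 * pi / ord a = of_int n * 2 * pi" using cos_one_2pi_int by auto
    then have "real_of_int (n * int (ord a)) = 1" using o by (simp add: field_simps)
    then have "n * int (ord a) = 1" by linarith
    then show False using o by (simp add: zmult_eq_1_iff)
  qed
  ultimately show ?thesis by metis
qed

text \<open>All values of a character are roots of unity of order dividing the order of the group,
  so only finitely many functions qualify.\<close>

lemma finite_chars:
  assumes fin: "finite (carrier G)"
  shows "finite (chars G)"
proof (rule finite_subset)
  have pw: "r (a [^] n) = r a ^ n" if "r \<in> chars G" "a \<in> carrier G" for r a and n :: nat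
    using that by (induction n) (auto simp: chars_one chars_iff mult.commute)
  show "chars G \<subseteq> carrier G \<rightarrow>\<^sub>E {z. z ^ order G = 1}"
  proof
    fix r assume r: "r \<in> chars G"
    have "r a ^ order G = 1" if "a \<in> carrier G" for a
      using pw[OF r that, of "order G"] pow_order_eq_1[OF that] chars_one[OF r] by simp
    then show "r \<in> carrier G \<rightarrow>\<^sub>E {z. z ^ order G = 1}" using r by (auto simp: chars_iff PiE_iff)
  qed
  have "order G > 0" using fin by (simp add: order_gt_0_iff_finite)
  then show "finite (carrier G \<rightarrow>\<^sub>E {z::complex. z ^ order G = 1})"
    using fin by (intro finite_PiE finite_roots_unity) auto
qed

text \<open>Multiplication by a character \<open>s\<close> with s(a) different from 1 permutes the
  characters and multiplies the sum by s(a).\<close>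

lemma sum_chars_nontrivial:
  assumes fin: "finite (carrier G)" and a: "a \<in> carrier G" "a \<noteq> \<one>"
  shows "(\<Sum>r\<in>chars G. r a) = 0"
proof -
  obtain s where s: "s \<in> chars G" "s a \<noteq> 1" using chars_separate[OF assms] by auto
  define f g where "f r = (\<lambda>x\<in>carrier G. s x * r x)" and "g r = (\<lambda>x\<in>carrier G. inverse (s x) * r x)" for r
  have s0: "s x \<noteq> 0" if "x \<in> carrier G" for x using s(1) that unfolding chars_iff by force
  have f: "f r \<in> chars G" if "r \<in> chars G" for r
    using that s(1) unfolding chars_iff f_def by (auto simp: norm_mult)
  have g: "g r \<in> chars G" if "r \<in> chars G" for r
    using that s(1) unfolding chars_iff g_def by (auto simp: norm_mult norm_inverse)
  have "bij_betw f (chars G) (chars G)"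
  proof (rule bij_betw_byWitness[where f' = g])
    show "\<forall>r\<in>chars G. g (f r) = r" "\<forall>r\<in>chars G. f (g r) = r"
      using s0 unfolding f_def g_def by (auto simp: fun_eq_iff extensional_def chars_iff)
  qed (use f g in auto)
  from sum.reindex_bij_betw[OF this, of "\<lambda>r. r a"]
  have "s a * (\<Sum>r\<in>chars G. r a) = (\<Sum>r\<in>chars G. r a)"
    using a by (simp add: f_def sum_distrib_left)
  then show ?thesis using s(2) by auto
qed

text \<open>The dual argument: translation by \<open>b\<close> permutes the group and multiplies the
  sum by r(b).\<close>

lemma sum_char_nontrivial:
  assumes r: "r \<in> chars G" and b: "b \<in> carrier G" "r b \<noteq> 1"
  shows "(\<Sum>a\<in>carrier G. r a) = 0"
proof -
  have "bij_betw (\<lambda>a. b \<otimes> a) (carrier G) (carrier G)"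
    by (rule bij_betw_byWitness[where f' = "\<lambda>a. inv b \<otimes> a"])
       (use b in \<open>auto simp: m_assoc[symmetric]\<close>)
  from sum.reindex_bij_betw[OF this, of r]
  have "r b * (\<Sum>a\<in>carrier G. r a) = (\<Sum>a\<in>carrier G. r a)"
    using r b by (simp add: chars_iff sum_distrib_left)
  then show ?thesis using b(2) by auto
qed

lemma sum_chars_one: "(\<Sum>r\<in>chars G. r \<one>) = of_nat (card (chars G))"
proof -
  have "(\<Sum>r\<in>chars G. r \<one>) = (\<Sum>r\<in>chars G. 1)" by (intro sum.cong refl chars_one)
  then show ?thesis by simp
qed

text \<open>The sum of r(a) over all pairs is evaluated twice. Summed over \<open>r\<close> first,
  only the identity survives and leaves the number of characters; summed over \<open>a\<close>
  first, only the trivial character \<open>e\<close> survives and leaves the order of the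
  group.\<close>

lemma card_chars:
  assumes fin: "finite (carrier G)"
  shows "card (chars G) = card (carrier G)"
proof -
  define e :: "'a \<Rightarrow> complex" where "e = (\<lambda>x\<in>carrier G. 1)"
  have e: "e \<in> chars G" by (auto simp: chars_iff e_def)
  have "(\<Sum>a\<in>carrier G. \<Sum>r\<in>chars G. r a) = (\<Sum>a\<in>carrier G. if a = \<one> then of_nat (card (chars G)) else 0)"
    using sum_chars_nontrivial[OF fin] sum_chars_one by (intro sum.cong) auto
  also have "\<dots> = of_nat (card (chars G))" using fin by simp
  finally have 1: "(\<Sum>a\<in>carrier G. \<Sum>r\<in>chars G. r a) = of_nat (card (chars G))" .
  have "(\<Sum>r\<in>chars G. \<Sum>a\<in>carrier G. r a) = (\<Sum>r\<in>chars G. if r = e then of_nat (card (carrier G)) else 0)"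
  proof (rule sum.cong[OF refl])
    fix r assume r: "r \<in> chars G"
    show "(\<Sum>a\<in>carrier G. r a) = (if r = e then of_nat (card (carrier G)) else 0)"
    proof (cases "r = e")
      case False
      then obtain b where "b \<in> carrier G" "r b \<noteq> 1"
        using r by (force simp: e_def chars_iff extensional_def)
      then show ?thesis using sum_char_nontrivial[OF r] False by simp
    qed (simp add: e_def)
  qed
  also have "\<dots> = of_nat (card (carrier G))" using e finite_chars[OF fin] by simp
  finally show ?thesis using 1 sum.swap[of "\<lambda>a r. r a" "chars G" "carrier G"] by (metis of_nat_eq_iff)
qed

text \<open>With the count of characters known, the nonzero value is the order of the group, which
  is exactly the denominator in \<open>Bvert\<close>.\<close>

lemma sum_chars:
  assumes fin: "finite (carrier G)" and a: "a \<in> carrier G"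
  shows "(\<Sum>r\<in>chars G. r a) = (if a = \<one> then of_nat (card (carrier G)) else 0)"
  using sum_chars_nontrivial[OF assms] card_chars[OF fin] sum_chars_one by auto

end

subsection \<open>Enlarging the image of a homomorphism without changing its kernel\<close>

text \<open>Roots are taken in a representative. This is the step that makes every subgroup of a
  torus have an injective cokernel.\<close>

lemma divisible_FactGroup:
  assumes N: "N \<lhd> D" and D: "divisible D"
  shows "divisible (D Mod N)"
  unfolding divisible_def
proof (intro allI impI ballI)
  interpret N: normal N D by (rule N)
  fix m :: nat and d assume m: "0 < m" and d: "d \<in> carrier (D Mod N)"
  obtain c where c: "c \<in> carrier D" "d = N #>\<^bsub>D\<^esub> c" using d by (auto simp: FactGroup_def RCOSETS_def)
  obtain e where e: "e \<in> carrier D" "e [^]\<^bsub>D\<^esub> m = c" using D m c(1) unfolding divisible_def by auto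
  show "\<exists>e\<in>carrier (D Mod N). e [^]\<^bsub>D Mod N\<^esub> m = d"
  proof
    show "N #>\<^bsub>D\<^esub> e \<in> carrier (D Mod N)" using e by (auto simp: FactGroup_def RCOSETS_def)
    show "(N #>\<^bsub>D\<^esub> e) [^]\<^bsub>D Mod N\<^esub> m = d" using N.FactGroup_pow[OF e(1), of m] e c by simp
  qed
qed

lemma comm_group_subgroup:
  assumes "comm_group A" "subgroup H A"
  shows "comm_group (A\<lparr>carrier := H\<rparr>)"
proof -
  interpret A: comm_group A by fact
  interpret H: subgroup H A by fact
  show ?thesis
    by (rule group.group_comm_groupI[OF H.subgroup_is_group[OF A.group_axioms]]) (auto simp: A.m_comm)
qed

text \<open>
  The group \<open>U\<close> embeds into a torus via \<open>J\<close>; the map \<open>p x \<mapsto> [J x]\<close> into the divisible group \<open>torus / J(ker p)\<close>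
  extends to \<open>w\<close> on \<open>V\<close>, and \<open>E\<close> is the pullback \<open>{(t, y). [t] = w y}\<close>.
\<close>

lemma acyclic_extension:
  fixes U :: "'a monoid" and V :: "'b monoid"
  assumes U: "comm_group U" "finite (carrier U)" and V: "comm_group V" "finite (carrier V)"
    and p: "p \<in> hom U V"
  shows "\<exists>(E :: ((('a \<Rightarrow> complex) \<Rightarrow> complex) \<times> 'b) monoid) em pr.
    comm_group E \<and> em \<in> hom U E \<and> inj_on em (carrier U) \<and> pr \<in> hom E V \<and> pr ` carrier E = carrier V \<and>
    (\<forall>x\<in>carrier U. pr (em x) = p x) \<and>
    (\<forall>e\<in>carrier E. pr e = \<one>\<^bsub>V\<^esub> \<longrightarrow> (\<exists>x\<in>carrier U. p x = \<one>\<^bsub>V\<^esub> \<and> e = em x))"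
proof -
  interpret U: comm_group U by (rule U)
  interpret V: comm_group V by (rule V)
  interpret p: group_hom U V p by (unfold_locales) (rule p)
  let ?T = "torus :: (('a \<Rightarrow> complex) \<Rightarrow> complex) monoid"
  interpret T: comm_group ?T by (rule comm_group_torus)
  \<comment> \<open>Evaluation at all characters at once. Coordinates that are not characters are
    filled with 1 so that the value lies in the torus.\<close>
  define J where "J x = (\<lambda>r. if r \<in> chars U then r x else 1)" for x
  have J: "J \<in> hom U ?T"
    by (rule homI) (auto simp: J_def chars_iff fun_eq_iff)
  interpret J: group_hom U ?T J by (unfold_locales) (rule J)
  have Jinj: "inj_on J (carrier U)"
  proof (rule J.inj_iff_trivial_ker[THEN iffD2], rule equalityI; rule subsetI)
    fix x assume x: "x \<in> kernel U torus J"
    then have "J x = (\<lambda>_. 1)" by (simp add: kernel_def)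
    then have "J x r = 1" for r by simp
    then have "r x = 1" if "r \<in> chars U" for r using that by (metis J_def)
    then show "x \<in> {\<one>\<^bsub>U\<^esub>}" using U.chars_separate[OF U(2), of x] x by (auto simp: kernel_def)
  next
    fix x assume "x \<in> {\<one>\<^bsub>U\<^esub>}"
    then show "x \<in> kernel U torus J" using J.hom_one by (simp add: kernel_def)
  qed
  \<comment> \<open>Only the kernel of \<open>p\<close> is divided out: \<open>J\<close> then still
    induces a map on the image of \<open>p\<close>, and the fibre of the pullback over the identity
    is just a copy of this kernel.\<close>
  define N where "N = J ` kernel U V p"
  have NT: "subgroup N ?T" unfolding N_def by (rule J.subgroup_img_is_subgroup[OF p.subgroup_kernel])
  interpret N: normal N ?T using T.subgroup_imp_normal[OF NT] .
  let ?Q = "?T Mod N"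
  have Q: "comm_group ?Q" by (rule T.abelian_FactGroup[OF NT])
  interpret Q: comm_group ?Q by (rule Q)
  have divQ: "divisible ?Q" by (rule divisible_FactGroup[OF N.normal_axioms divisible_torus])
  define B where "B = p ` carrier U"
  have BV: "subgroup B V" unfolding B_def by (rule p.img_is_subgroup)
  define w0 where "w0 y = N #>\<^bsub>?T\<^esub> J (SOME x. x \<in> carrier U \<and> p x = y)" for y
  \<comment> \<open>Two preimages of the same element differ by an element of the kernel of
    \<open>p\<close>, which \<open>J\<close> sends into \<open>N\<close>; so the choice in
    \<open>w0\<close> is immaterial.\<close>
  have w0: "w0 (p x) = N #>\<^bsub>?T\<^esub> J x" if x: "x \<in> carrier U" for x
  proof -
    define x' where "x' = (SOME x'. x' \<in> carrier U \<and> p x' = p x)"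
    have x': "x' \<in> carrier U" "p x' = p x"
      unfolding x'_def using someI[of "\<lambda>x'. x' \<in> carrier U \<and> p x' = p x" x] x by auto
    have "x' \<otimes>\<^bsub>U\<^esub> inv\<^bsub>U\<^esub> x \<in> kernel U V p" using x x' by (simp add: kernel_def)
    then have "J (x' \<otimes>\<^bsub>U\<^esub> inv\<^bsub>U\<^esub> x) \<in> N" unfolding N_def by (rule imageI)
    then have "J x' \<otimes>\<^bsub>?T\<^esub> inv\<^bsub>?T\<^esub> (J x) \<in> N" using x x' J.hom_mult J.hom_inv by (metis U.inv_closed)
    then have "J x' \<in> N #>\<^bsub>?T\<^esub> J x"
      using N.rcos_module[OF T.group_axioms J.hom_closed[OF x] J.hom_closed[OF x'(1)]] by blast
    then show ?thesis unfolding w0_def x'_def[symmetric]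
      using T.repr_independence[OF _ J.hom_closed[OF x] NT] by metis
  qed
  have "w0 \<in> hom (V\<lparr>carrier := B\<rparr>) ?Q"
  proof (rule homI)
    fix y assume "y \<in> carrier (V\<lparr>carrier := B\<rparr>)"
    then obtain x where x: "x \<in> carrier U" "y = p x" unfolding B_def by auto
    show "w0 y \<in> carrier ?Q" unfolding x(2) w0[OF x(1)] using J.hom_closed[OF x(1)]
      unfolding FactGroup_def RCOSETS_def by auto
  next
    fix y y' assume "y \<in> carrier (V\<lparr>carrier := B\<rparr>)" "y' \<in> carrier (V\<lparr>carrier := B\<rparr>)"
    then obtain x x' where x: "x \<in> carrier U" "y = p x" "x' \<in> carrier U" "y' = p x'"
      unfolding B_def by auto
    have "w0 (y \<otimes>\<^bsub>V\<^esub> y') = w0 (p (x \<otimes>\<^bsub>U\<^esub> x'))" using x by simp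
    also have "\<dots> = N #>\<^bsub>?T\<^esub> (J x \<otimes>\<^bsub>?T\<^esub> J x')" using x J.hom_mult by (metis w0 U.m_closed)
    also have "\<dots> = (N #>\<^bsub>?T\<^esub> J x) <#>\<^bsub>?T\<^esub> (N #>\<^bsub>?T\<^esub> J x')"
      by (rule N.rcos_sum[OF J.hom_closed[OF x(1)] J.hom_closed[OF x(3)], symmetric])
    also have "\<dots> = w0 y \<otimes>\<^bsub>?Q\<^esub> w0 y'" using x by (simp add: w0 FactGroup_def)
    finally show "w0 (y \<otimes>\<^bsub>V\<lparr>carrier := B\<rparr>\<^esub> y') = w0 y \<otimes>\<^bsub>?Q\<^esub> w0 y'" by simp
  qed
  from hom_extension[OF V Q divQ BV this] obtain w
    where w: "w \<in> hom V ?Q" "\<forall>y\<in>B. w y = w0 y" by auto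
  interpret w: group_hom V ?Q w by (unfold_locales) (rule w)
  have wT: "w y \<in> rcosets\<^bsub>?T\<^esub> N" if "y \<in> carrier V" for y
    using w.hom_closed[OF that] by (simp add: FactGroup_def)
  have wm: "w (y \<otimes>\<^bsub>V\<^esub> y') = w y <#>\<^bsub>?T\<^esub> w y'" if "y \<in> carrier V" "y' \<in> carrier V" for y y'
    using w.hom_mult[OF that] by (simp add: FactGroup_def)
  have wone: "w \<one>\<^bsub>V\<^esub> = N" using w.hom_one by (simp add: FactGroup_def)
  define C where "C = {(t, y). y \<in> carrier V \<and> t \<in> w y}"
  have DP: "comm_group (?T \<times>\<times> V)"
    by (rule group.group_comm_groupI[OF DirProd_group[OF T.group_axioms V.group_axioms]])
       (auto simp: V.m_comm mult.commute)
  have C: "subgroup C (?T \<times>\<times> V)"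
  proof (rule group.subgroupI[OF DirProd_group[OF T.group_axioms V.group_axioms]])
    show "C \<subseteq> carrier (?T \<times>\<times> V)"
      using N.rcosets_carrier[OF T.group_axioms wT] by (auto simp: C_def simp del: torus_simps)
    show "C \<noteq> {}" 
    proof -
      have "(\<one>\<^bsub>?T\<^esub>, \<one>\<^bsub>V\<^esub>) \<in> C" using wone N.one_closed by (simp add: C_def)
      then show ?thesis by auto
    qed
  next
    fix a assume a: "a \<in> C"
    then obtain t y where ty: "a = (t, y)" "y \<in> carrier V" "t \<in> w y" unfolding C_def by auto
    have tc: "t \<in> carrier ?T" using N.rcosets_carrier[OF T.group_axioms wT[OF ty(2)]] ty(3) by auto
    have "w (inv\<^bsub>V\<^esub> y) = set_inv\<^bsub>?T\<^esub> (w y)"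
      using w.hom_inv[OF ty(2)] N.inv_FactGroup[OF w.hom_closed[OF ty(2)]] by simp
    then have "inv\<^bsub>?T\<^esub> t \<in> w (inv\<^bsub>V\<^esub> y)" using ty(3) by (auto simp: SET_INV_def)
    then show "inv\<^bsub>?T \<times>\<times> V\<^esub> a \<in> C"
      using ty tc inv_DirProd[OF T.group_axioms V.group_axioms tc ty(2)] by (simp add: C_def)
  next
    fix a b assume "a \<in> C" "b \<in> C"
    then obtain t y t' y' where ty: "a = (t, y)" "y \<in> carrier V" "t \<in> w y"
      "b = (t', y')" "y' \<in> carrier V" "t' \<in> w y'" unfolding C_def by auto
    have "t \<otimes>\<^bsub>?T\<^esub> t' \<in> w (y \<otimes>\<^bsub>V\<^esub> y')" unfolding wm[OF ty(2,5)] set_mult_def using ty(3,6) by auto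
    then show "a \<otimes>\<^bsub>?T \<times>\<times> V\<^esub> b \<in> C" using ty by (simp add: C_def)
  qed
  define E where "E = (?T \<times>\<times> V)\<lparr>carrier := C\<rparr>"
  have E: "comm_group E" unfolding E_def by (rule comm_group_subgroup[OF DP C])
  have JC: "(J x, p x) \<in> C" if x: "x \<in> carrier U" for x
  proof -
    have "w (p x) = N #>\<^bsub>?T\<^esub> J x" using w(2) w0[OF x] x unfolding B_def by auto
    then show ?thesis using T.rcos_self[OF J.hom_closed[OF x] NT] x by (simp add: C_def)
  qed
  have "(\<lambda>x. (J x, p x)) \<in> hom U E"
    by (rule homI) (use J.hom_mult in \<open>auto simp: E_def JC\<close>)
  moreover have "inj_on (\<lambda>x. (J x, p x)) (carrier U)" using Jinj by (auto simp: inj_on_def)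
  moreover have "snd \<in> hom E V" by (rule homI) (auto simp: E_def C_def mult_DirProd')
  moreover have "snd ` carrier E = carrier V"
  proof
    show "carrier V \<subseteq> snd ` carrier E"
    proof
      fix y assume y: "y \<in> carrier V"
      obtain t where "t \<in> w y" using N.rcosets_non_empty[OF wT[OF y]] by auto
      then show "y \<in> snd ` carrier E" using y by (force simp: E_def C_def)
    qed
  qed (auto simp: E_def C_def)
  \<comment> \<open>Over the identity the torus component lies in the trivial coset
    \<open>N\<close>, hence comes from the kernel of \<open>p\<close>.\<close>
  moreover have "\<exists>x\<in>carrier U. p x = \<one>\<^bsub>V\<^esub> \<and> e = (J x, p x)" if "e \<in> carrier E" "snd e = \<one>\<^bsub>V\<^esub>" for e
    using that wone by (clarsimp simp: E_def C_def N_def kernel_def) metis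
  ultimately show ?thesis using E
    by (intro exI[of _ E] exI[of _ "\<lambda>x. (J x, p x)"] exI[of _ snd]) auto
qed

subsection \<open>Cochains on a based complex\<close>

text \<open>The composite of \<open>\<phi>\<close> with the boundary of C, shared by
  \<open>cobdry\<close> and \<open>cobdryA\<close>. The result is not cut down to
  \<open>K n\<close>, so calculations with values are free of extensionality conditions.\<close>

definition pull :: "(int \<Rightarrow> 'k set) \<Rightarrow> (int \<Rightarrow> 'k \<Rightarrow> 'k \<Rightarrow> int) \<Rightarrow> ('a, 'b) monoid_scheme \<Rightarrow> int
    \<Rightarrow> ('k \<Rightarrow> 'a) \<Rightarrow> 'k \<Rightarrow> 'a" where
  "pull K dC A n \<phi> x = finprod A (\<lambda>y. \<phi> y [^]\<^bsub>A\<^esub> dC n x y) (K (n - 1))"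

lemma group_hom_of_comm_groups: "comm_group A \<Longrightarrow> comm_group B \<Longrightarrow> h \<in> hom A B \<Longrightarrow> group_hom A B h"
  by (simp add: group_hom_def group_hom_axioms_def comm_group_def)

lemma hom_finprod_comm_group:
  assumes A: "comm_group A" and B: "comm_group B" and h: "h \<in> hom A B"
    and f: "f \<in> S \<rightarrow> carrier A"
  shows "h (finprod A f S) = finprod B (\<lambda>y. h (f y)) S"
proof -
  interpret A: comm_group A by fact
  interpret B: comm_group B by fact
  interpret h: group_hom A B h by (rule group_hom_of_comm_groups[OF A B h])
  show ?thesis
  proof (cases "finite S")
    case True
    then show ?thesis using f
    proof (induction S rule: finite_induct)
      case (insert y S)
      then have "f y \<in> carrier A" "f \<in> S \<rightarrow> carrier A" by auto
      with insert show ?case by (simp add: Pi_iff)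
    qed simp
  qed simp
qed

locale based_complex =
  fixes K :: "int \<Rightarrow> 'k set" and dC :: "int \<Rightarrow> 'k \<Rightarrow> 'k \<Rightarrow> int"
  assumes finite_K: "finite (K n)"
    and finite_support: "finite {n. K n \<noteq> {}}"
    and dC_dC: "x \<in> K n \<Longrightarrow> z \<in> K (n - 2) \<Longrightarrow> (\<Sum>y\<in>K (n - 1). dC n x y * dC (n - 1) y z) = 0"
begin

abbreviation bd where "bd \<equiv> pull K dC"

lemma bd_closed: "comm_group A \<Longrightarrow> \<phi> \<in> K (n - 1) \<rightarrow> carrier A \<Longrightarrow> bd A n \<phi> x \<in> carrier A"
  unfolding pull_def by (auto intro!: comm_monoid.finprod_closed group.int_pow_closed simp: comm_group_def Pi_iff)

lemma bd_cong:
  assumes "comm_group A" "\<psi> \<in> K (n - 1) \<rightarrow> carrier A" "\<And>y. y \<in> K (n - 1) \<Longrightarrow> \<phi> y = \<psi> y"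
  shows "bd A n \<phi> x = bd A n \<psi> x"
proof -
  interpret A: comm_group A by fact
  show ?thesis unfolding pull_def by (rule A.finprod_cong') (use assms in \<open>auto simp: Pi_iff\<close>)
qed

lemma bd_mult:
  assumes "comm_group A" "\<phi> \<in> K (n - 1) \<rightarrow> carrier A" "\<psi> \<in> K (n - 1) \<rightarrow> carrier A"
  shows "bd A n (\<lambda>y. \<phi> y \<otimes>\<^bsub>A\<^esub> \<psi> y) x = bd A n \<phi> x \<otimes>\<^bsub>A\<^esub> bd A n \<psi> x"
proof -
  interpret A: comm_group A by fact
  have "bd A n (\<lambda>y. \<phi> y \<otimes>\<^bsub>A\<^esub> \<psi> y) x = finprod A (\<lambda>y. \<phi> y [^]\<^bsub>A\<^esub> dC n x y \<otimes>\<^bsub>A\<^esub> \<psi> y [^]\<^bsub>A\<^esub> dC n x y) (K (n - 1))"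
    unfolding pull_def by (rule A.finprod_cong') (use assms in \<open>auto simp: Pi_iff A.int_pow_distrib\<close>)
  also have "\<dots> = bd A n \<phi> x \<otimes>\<^bsub>A\<^esub> bd A n \<psi> x"
    unfolding pull_def by (rule A.finprod_multf) (use assms in \<open>auto simp: Pi_iff\<close>)
  finally show ?thesis .
qed

lemma hom_bd:
  assumes A: "comm_group A" and B: "comm_group B" and h: "h \<in> hom A B"
    and \<phi>: "\<phi> \<in> K (n - 1) \<rightarrow> carrier A"
  shows "h (bd A n \<phi> x) = bd B n (\<lambda>y. h (\<phi> y)) x"
proof -
  interpret A: comm_group A by fact
  interpret B: comm_group B by fact
  interpret h: group_hom A B h by (rule group_hom_of_comm_groups[OF A B h])
  have "h (bd A n \<phi> x) = finprod B (\<lambda>y. h (\<phi> y [^]\<^bsub>A\<^esub> dC n x y)) (K (n - 1))"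
    unfolding pull_def by (rule hom_finprod_comm_group[OF A B h]) (use \<phi> in \<open>auto simp: Pi_iff\<close>)
  also have "\<dots> = bd B n (\<lambda>y. h (\<phi> y)) x"
    unfolding pull_def
    by (rule B.finprod_cong') (use \<phi> in \<open>auto simp: Pi_iff h.hom_int_pow\<close>)
  finally show ?thesis .
qed

lemma bd_inv:
  assumes "comm_group A" "\<phi> \<in> K (n - 1) \<rightarrow> carrier A"
  shows "bd A n (\<lambda>y. inv\<^bsub>A\<^esub> \<phi> y) x = inv\<^bsub>A\<^esub> bd A n \<phi> x"
proof -
  interpret A: comm_group A by fact
  have "(\<lambda>a. inv\<^bsub>A\<^esub> a) \<in> hom A A" by (rule homI) (auto simp: A.inv_mult)
  from hom_bd[OF assms(1,1) this assms(2)] show ?thesis by simp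
qed

text \<open>After the two products are interchanged, the exponent of each \<phi>(z) is an entry of
  the matrix of the squared boundary, which is zero.\<close>

lemma bd_bd:
  assumes A: "comm_group A" and x: "x \<in> K n" and \<phi>: "\<phi> \<in> K (n - 2) \<rightarrow> carrier A"
  shows "bd A n (bd A (n - 1) \<phi>) x = \<one>\<^bsub>A\<^esub>"
proof -
  interpret A: comm_group A by fact
  have c: "\<phi> z \<in> carrier A" if "z \<in> K (n - 2)" for z using \<phi> that by auto
  have closed: "bd A (n - 1) \<phi> y \<in> carrier A" for y using bd_closed[OF A, of \<phi> "n - 1"] \<phi> by simp
  \<comment> \<open>The interchange is proved for an arbitrary finite set \<open>S\<close> in place
    of \<open>K (n - 1)\<close>, since the induction removes single elements.\<close>
  have "finprod A (\<lambda>y. bd A (n - 1) \<phi> y [^]\<^bsub>A\<^esub> dC n x y) S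
      = finprod A (\<lambda>z. \<phi> z [^]\<^bsub>A\<^esub> (\<Sum>y\<in>S. dC n x y * dC (n - 1) y z)) (K (n - 2))" if "finite S" for S
    using that
  proof (induction S rule: finite_induct)
    case empty
    show ?case by simp
  next
    case (insert y S)
    have pw: "(\<lambda>a. a [^]\<^bsub>A\<^esub> (dC n x y)) \<in> hom A A" by (rule homI) (auto simp: A.int_pow_distrib)
    have fz: "(\<lambda>z. \<phi> z [^]\<^bsub>A\<^esub> dC (n - 1) y z) \<in> K (n - 2) \<rightarrow> carrier A" using c by simp
    have "bd A (n - 1) \<phi> y [^]\<^bsub>A\<^esub> dC n x y
        = finprod A (\<lambda>z. (\<phi> z [^]\<^bsub>A\<^esub> dC (n - 1) y z) [^]\<^bsub>A\<^esub> dC n x y) (K (n - 2))"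
      unfolding pull_def using hom_finprod_comm_group[OF A A pw fz] by simp
    also have "\<dots> = finprod A (\<lambda>z. \<phi> z [^]\<^bsub>A\<^esub> (dC n x y * dC (n - 1) y z)) (K (n - 2))"
      by (rule A.finprod_cong') (auto simp: Pi_iff c A.int_pow_pow mult.commute)
    finally have step: "bd A (n - 1) \<phi> y [^]\<^bsub>A\<^esub> dC n x y
      = finprod A (\<lambda>z. \<phi> z [^]\<^bsub>A\<^esub> (dC n x y * dC (n - 1) y z)) (K (n - 2))" .
    have "finprod A (\<lambda>y. bd A (n - 1) \<phi> y [^]\<^bsub>A\<^esub> dC n x y) (insert y S)
      = bd A (n - 1) \<phi> y [^]\<^bsub>A\<^esub> dC n x y \<otimes>\<^bsub>A\<^esub> finprod A (\<lambda>y. bd A (n - 1) \<phi> y [^]\<^bsub>A\<^esub> dC n x y) S"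
      by (rule A.finprod_insert) (use insert closed in auto)
    also have "\<dots> = finprod A (\<lambda>z. \<phi> z [^]\<^bsub>A\<^esub> (dC n x y * dC (n - 1) y z)) (K (n - 2)) \<otimes>\<^bsub>A\<^esub>
        finprod A (\<lambda>z. \<phi> z [^]\<^bsub>A\<^esub> (\<Sum>y\<in>S. dC n x y * dC (n - 1) y z)) (K (n - 2))"
      unfolding step insert.IH ..
    also have "\<dots> = finprod A (\<lambda>z. \<phi> z [^]\<^bsub>A\<^esub> (dC n x y * dC (n - 1) y z) \<otimes>\<^bsub>A\<^esub>
        \<phi> z [^]\<^bsub>A\<^esub> (\<Sum>y\<in>S. dC n x y * dC (n - 1) y z)) (K (n - 2))"
      by (rule A.finprod_multf[symmetric]) (auto simp: c)
    also have "\<dots> = finprod A (\<lambda>z. \<phi> z [^]\<^bsub>A\<^esub> (\<Sum>y\<in>insert y S. dC n x y * dC (n - 1) y z)) (K (n - 2))"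
      by (rule A.finprod_cong') (use insert in \<open>auto simp: Pi_iff c A.int_pow_mult\<close>)
    finally show ?case .
  qed
  from this[OF finite_K, of "n - 1"]
  have "bd A n (bd A (n - 1) \<phi>) x = finprod A (\<lambda>z. \<phi> z [^]\<^bsub>A\<^esub> (\<Sum>y\<in>K (n - 1). dC n x y * dC (n - 1) y z)) (K (n - 2))"
    by (simp add: pull_def)
  also have "\<dots> = \<one>\<^bsub>A\<^esub>" by (rule A.finprod_one_eqI) (simp add: dC_dC[OF x])
  finally show ?thesis .
qed

lemma support_bounded_below: "\<exists>N. \<forall>n<N. K n = {}"
proof -
  let ?S = "{n. K n \<noteq> {}}"
  have "K n = {}" if "n < (if ?S = {} then 0 else Min ?S)" for n
    using that Min_le[OF finite_support, of n] by (auto split: if_splits)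
  then show ?thesis by blast
qed

text \<open>The contracting argument for maps from a free complex bounded below into an exact one.
  Once \<open>w (n - 1)\<close> is found, a_n - w_{n-1} \<partial> is closed under \<open>d\<close>,
  and exactness supplies \<open>w n\<close>; because C is free, its values on the basis elements can
  be chosen independently.\<close>

lemma hom_into_exact:
  fixes E :: "int \<Rightarrow> 'e monoid" and d :: "int \<Rightarrow> 'e \<Rightarrow> 'e"
  assumes E: "\<And>n. comm_group (E n)" and d: "\<And>n. d n \<in> hom (E n) (E (n - 1))"
    and exact: "\<And>n e. e \<in> carrier (E n) \<Longrightarrow> d n e = \<one>\<^bsub>E (n - 1)\<^esub> \<Longrightarrow> \<exists>e'\<in>carrier (E (n + 1)). d (n + 1) e' = e"
    and a: "\<And>n. a n \<in> K n \<rightarrow> carrier (E n)"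
    and cocycle: "\<And>n x. x \<in> K n \<Longrightarrow> bd (E (n - 1)) n (a (n - 1)) x = d n (a n x)"
  shows "\<exists>w. \<forall>n. w n \<in> K n \<rightarrow> carrier (E (n + 1)) \<and>
    (\<forall>x\<in>K n. a n x = bd (E n) n (w (n - 1)) x \<otimes>\<^bsub>E n\<^esub> d (n + 1) (w n x))"
proof -
  obtain N where N: "\<And>n. n < N \<Longrightarrow> K n = {}" using support_bounded_below by auto
  define step where "step n v = (\<lambda>x. SOME e. e \<in> carrier (E (n + 1)) \<and> d (n + 1) e = a n x \<otimes>\<^bsub>E n\<^esub> inv\<^bsub>E n\<^esub> (bd (E n) n v x))" for n v
  \<comment> \<open>The recursion climbs from the lowest degree N that may be occupied. The starting
    value \<open>undefined\<close> stands for \<open>w (N - 1)\<close>, a function on the empty set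
    \<open>K (N - 1)\<close>.\<close>
  define W where "W = rec_nat (step N undefined) (\<lambda>k v. step (N + int k + 1) v)"
  define w where "w n = (if n < N then undefined else W (nat (n - N)))" for n
  have w_step: "w n = step n (w (n - 1))" if "n \<ge> N" for n
  proof (cases "n = N")
    case True
    then show ?thesis by (simp add: w_def W_def)
  next
    case False
    define k where "k = nat (n - N - 1)"
    have k: "nat (n - N) = Suc k" "nat (n - 1 - N) = k" "N + int k + 1 = n" using that False by (auto simp: k_def)
    then show ?thesis using that False by (simp add: w_def W_def)
  qed
  \<comment> \<open>The invariant also records that \<open>w (n - 1)\<close> is well typed, because
    the step to degree \<open>n\<close> substitutes the equation of degree \<open>n - 1\<close>, in
    which \<open>w (n - 2)\<close> occurs.\<close>
  define ok where "ok n \<longleftrightarrow> w (n - 1) \<in> K (n - 1) \<rightarrow> carrier (E n) \<and> w n \<in> K n \<rightarrow> carrier (E (n + 1)) \<and>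
    (\<forall>x\<in>K n. a n x = bd (E n) n (w (n - 1)) x \<otimes>\<^bsub>E n\<^esub> d (n + 1) (w n x))" for n
  have low: "ok n" if "n < N" for n using N[of n] N[of "n - 1"] that by (simp add: ok_def)
  have up: "ok n" if n: "n \<ge> N" and prev: "ok (n - 1)" for n
  proof -
    interpret E: comm_group "E n" by (rule E)
    interpret E1: comm_group "E (n - 1)" by (rule E)
    interpret d: group_hom "E n" "E (n - 1)" "d n" by (rule group_hom_of_comm_groups[OF E E d])
    have w1: "w (n - 1) \<in> K (n - 1) \<rightarrow> carrier (E n)"
      and w2: "w (n - 2) \<in> K (n - 2) \<rightarrow> carrier (E (n - 1))"
      and eq: "\<And>y. y \<in> K (n - 1) \<Longrightarrow> a (n - 1) y = bd (E (n - 1)) (n - 1) (w (n - 2)) y \<otimes>\<^bsub>E (n - 1)\<^esub> d n (w (n - 1) y)"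
      using prev by (simp_all add: ok_def)
    have bw2: "bd (E (n - 1)) (n - 1) (w (n - 2)) y \<in> carrier (E (n - 1))" for y
      by (rule bd_closed[OF E]) (use w2 in simp)
    have dw: "(\<lambda>y. d n (w (n - 1) y)) \<in> K (n - 1) \<rightarrow> carrier (E (n - 1))" using w1 by (auto simp: Pi_iff)
    have ex: "\<exists>e. e \<in> carrier (E (n + 1)) \<and> d (n + 1) e = a n x \<otimes>\<^bsub>E n\<^esub> inv\<^bsub>E n\<^esub> (bd (E n) n (w (n - 1)) x)" if x: "x \<in> K n" for x
    proof -
      let ?p = "bd (E n) n (w (n - 1)) x"
      have p: "?p \<in> carrier (E n)" by (rule bd_closed[OF E w1])
      have an: "a n x \<in> carrier (E n)" using a x by auto
      \<comment> \<open>Substitution of the equation one degree lower produces w_{n-2} \<partial>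
        \<partial>, which vanishes, and a term equal to d(w_{n-1} \<partial>).\<close>
      have "d n (a n x) = bd (E (n - 1)) n (a (n - 1)) x" using cocycle[OF x] by simp
      also have "\<dots> = bd (E (n - 1)) n (\<lambda>y. bd (E (n - 1)) (n - 1) (w (n - 2)) y \<otimes>\<^bsub>E (n - 1)\<^esub> d n (w (n - 1) y)) x"
        by (rule bd_cong[OF E]) (use eq bw2 dw in \<open>auto simp: Pi_iff\<close>)
      also have "\<dots> = bd (E (n - 1)) n (bd (E (n - 1)) (n - 1) (w (n - 2))) x \<otimes>\<^bsub>E (n - 1)\<^esub> bd (E (n - 1)) n (\<lambda>y. d n (w (n - 1) y)) x"
        by (rule bd_mult[OF E]) (use bw2 dw in auto)
      also have "\<dots> = bd (E (n - 1)) n (\<lambda>y. d n (w (n - 1) y)) x"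
        using bd_bd[OF E x w2] bd_closed[OF E dw] by simp
      also have "\<dots> = d n ?p" by (rule hom_bd[OF E E d w1, symmetric])
      finally have "d n (a n x \<otimes>\<^bsub>E n\<^esub> inv\<^bsub>E n\<^esub> ?p) = \<one>\<^bsub>E (n - 1)\<^esub>" using p an by simp
      from exact[OF _ this] show ?thesis using p an by auto
    qed
    have wn: "w n x \<in> carrier (E (n + 1)) \<and> d (n + 1) (w n x) = a n x \<otimes>\<^bsub>E n\<^esub> inv\<^bsub>E n\<^esub> (bd (E n) n (w (n - 1)) x)" if x: "x \<in> K n" for x
      using someI_ex[OF ex[OF x]] unfolding w_step[OF n] step_def by (simp add: w_step[symmetric])
    have "a n x = bd (E n) n (w (n - 1)) x \<otimes>\<^bsub>E n\<^esub> d (n + 1) (w n x)" if x: "x \<in> K n" for x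
    proof -
      have "bd (E n) n (w (n - 1)) x \<in> carrier (E n)" "a n x \<in> carrier (E n)" using bd_closed[OF E w1] a x by auto
      then show ?thesis using wn[OF x] by (simp add: E.m_lcomm[of "bd (E n) n (w (n - 1)) x"])
    qed
    then show ?thesis using w1 wn by (simp add: ok_def)
  qed
  have "ok n" for n
  proof (cases "n < N")
    case False
    \<comment> \<open>The induction starts one degree below N, where there are no basis elements and
      \<open>ok\<close> holds vacuously.\<close>
    then have "N - 1 \<le> n" by simp
    then show ?thesis
    proof (induction n rule: int_ge_induct)
      case base
      show ?case by (rule low) simp
    next
      case (step i)
      show ?case by (rule up) (use step in auto)
    qed
  qed (rule low)
  then show ?thesis unfolding ok_def by (intro exI[of _ w]) auto
qed

end

subsection \<open>The connecting relation\<close>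

locale hom_complex = based_complex K dC
  for K :: "int \<Rightarrow> 'k set" and dC :: "int \<Rightarrow> 'k \<Rightarrow> 'k \<Rightarrow> int" +
  fixes G :: "int \<Rightarrow> 'g monoid" and dG :: "int \<Rightarrow> 'g \<Rightarrow> 'g"
  assumes G: "comm_group (G n)"
    and finite_G: "finite (carrier (G n))"
    and dG: "dG n \<in> hom (G n) (G (n - 1))"
    and dG_dG: "a \<in> carrier (G n) \<Longrightarrow> dG (n - 1) (dG n a) = \<one>\<^bsub>G (n - 2)\<^esub>"
begin

definition cyc where "cyc n = kernel (G n) (G (n - 1)) (dG n)"

lemma dG_hom: "group_hom (G n) (G (n - 1)) (dG n)"
  by (rule group_hom_of_comm_groups[OF G G dG])

lemma dG_hom': "group_hom (G (n + 1)) (G n) (dG (n + 1))"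
  using dG_hom[of "n + 1"] by simp

lemma cyc_iff: "a \<in> cyc n \<longleftrightarrow> a \<in> carrier (G n) \<and> dG n a = \<one>\<^bsub>G (n - 1)\<^esub>"
  by (simp add: cyc_def kernel_def)

lemma subgroup_cyc: "subgroup (cyc n) (G n)"
  unfolding cyc_def by (rule group_hom.subgroup_kernel[OF dG_hom])

lemma dG_cyc: "a \<in> carrier (G (n + 1)) \<Longrightarrow> dG (n + 1) a \<in> cyc n"
  using dG_dG[of a "n + 1"] group_hom.hom_closed[OF dG_hom', of a n] by (simp add: cyc_iff)

end

lemma fibrewise_choice:
  assumes "\<And>n x. x \<in> K n \<Longrightarrow> \<exists>u. Q n x u"
  shows "\<exists>u. \<forall>n. \<forall>x\<in>K n. Q n x (u n x)"
proof (intro exI allI ballI)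
  fix n x assume "x \<in> K n"
  from someI_ex[OF assms[OF this]] show "Q n x (SOME u. Q n x u)" .
qed

text \<open>The maps of \<open>acyclic_extension\<close> in all degrees, with the cycles of degree
  \<open>n - 1\<close> as target. \<open>pr\<close> is typed into \<open>G (n - 1)\<close> so that
  \<open>em\<close> can follow it; the composite of the two is the differential of
  \<open>E\<close>.\<close>

locale resolved_hom_complex = hom_complex +
  fixes E :: "int \<Rightarrow> 'e monoid" and em :: "int \<Rightarrow> 'b \<Rightarrow> 'e" and pr :: "int \<Rightarrow> 'e \<Rightarrow> 'b"
  assumes E: "comm_group (E n)"
    and em: "em n \<in> hom (G n) (E n)"
    and inj_em: "inj_on (em n) (carrier (G n))"
    and pr: "pr n \<in> hom (E n) (G (n - 1))"
    and pr_image: "pr n ` carrier (E n) = cyc (n - 1)"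
    and pr_em: "a \<in> carrier (G n) \<Longrightarrow> pr n (em n a) = dG n a"
    and pr_one: "e \<in> carrier (E n) \<Longrightarrow> pr n e = \<one>\<^bsub>G (n - 1)\<^esub> \<Longrightarrow> \<exists>a\<in>cyc n. e = em n a"
begin

lemma em_hom: "group_hom (G n) (E n) (em n)"
  by (rule group_hom_of_comm_groups[OF G E em])

lemma pr_hom: "group_hom (E n) (G (n - 1)) (pr n)"
  by (rule group_hom_of_comm_groups[OF E G pr])

lemma pr': "pr (n + 1) \<in> hom (E (n + 1)) (G n)"
  using pr[of "n + 1"] by simp

lemma pr_hom': "group_hom (E (n + 1)) (G n) (pr (n + 1))"
  by (rule group_hom_of_comm_groups[OF E G pr'])

lemma pr_cyc: "e \<in> carrier (E (n + 1)) \<Longrightarrow> pr (n + 1) e \<in> cyc n"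
  using pr_image[of "n + 1"] by auto

lemma pr_surj: "a \<in> cyc n \<Longrightarrow> \<exists>e\<in>carrier (E (n + 1)). pr (n + 1) e = a"
  using pr_image[of "n + 1"] by (simp add: set_eq_iff image_iff) metis

text \<open>Injectivity of \<open>em\<close> makes the kernel of the differential the kernel of
  \<open>pr\<close>, which is \<open>em\<close> of the cycles; and every cycle is a value of the
  next \<open>pr\<close>.\<close>

lemma exact_em_pr:
  assumes e: "e \<in> carrier (E n)" and 1: "em (n - 1) (pr n e) = \<one>\<^bsub>E (n - 1)\<^esub>"
  shows "\<exists>e'\<in>carrier (E (n + 1)). em n (pr (n + 1) e') = e"
proof -
  interpret em: group_hom "G (n - 1)" "E (n - 1)" "em (n - 1)" by (rule em_hom)
  interpret pr: group_hom "E n" "G (n - 1)" "pr n" by (rule pr_hom)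
  have "pr n e = \<one>\<^bsub>G (n - 1)\<^esub>"
    by (rule inj_onD[OF inj_em]) (use e 1 in auto)
  then obtain a where "a \<in> cyc n" "e = em n a" using pr_one[OF e] by auto
  then show ?thesis using pr_surj by metis
qed

text \<open>
  \<open>related f e\<close> says that \<open>e\<close> bounds the image of \<open>f\<close> in \<open>hom(C, E)\<close>; the class that the connecting
  homomorphism attaches to \<open>f\<close> is then represented by \<open>pr \<circ> e\<close>.
\<close>

definition related :: "(int \<Rightarrow> 'a \<Rightarrow> 'b) \<Rightarrow> (int \<Rightarrow> 'a \<Rightarrow> 'e) \<Rightarrow> bool" where
  "related f e \<longleftrightarrow> (\<forall>n. f n \<in> K n \<rightarrow> carrier (G n) \<and> e n \<in> K n \<rightarrow> carrier (E (n + 1)) \<and>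
     (\<forall>x\<in>K n. em n (f n x) = bd (E n) n (e (n - 1)) x \<otimes>\<^bsub>E n\<^esub> em n (pr (n + 1) (e n x))))"

lemma relatedD:
  assumes "related f e"
  shows "f n \<in> K n \<rightarrow> carrier (G n)" "e n \<in> K n \<rightarrow> carrier (E (n + 1))"
    "e (n - 1) \<in> K (n - 1) \<rightarrow> carrier (E n)"
    "x \<in> K n \<Longrightarrow> em n (f n x) = bd (E n) n (e (n - 1)) x \<otimes>\<^bsub>E n\<^esub> em n (pr (n + 1) (e n x))"
    "x \<in> K n \<Longrightarrow> pr (n + 1) (e n x) \<in> cyc n"
    "(\<lambda>x. pr (n + 1) (e n x)) \<in> K n \<rightarrow> carrier (G n)"
    "(\<lambda>x. pr n (e (n - 1) x)) \<in> K (n - 1) \<rightarrow> carrier (G (n - 1))"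
proof -
  show e: "e n \<in> K n \<rightarrow> carrier (E (n + 1))" for n using assms by (simp add: related_def)
  show "f n \<in> K n \<rightarrow> carrier (G n)" 
    "x \<in> K n \<Longrightarrow> em n (f n x) = bd (E n) n (e (n - 1)) x \<otimes>\<^bsub>E n\<^esub> em n (pr (n + 1) (e n x))"
    using assms by (simp_all add: related_def)
  show "e (n - 1) \<in> K (n - 1) \<rightarrow> carrier (E n)" using e[of "n - 1"] by simp
  show 1: "x \<in> K n \<Longrightarrow> pr (n + 1) (e n x) \<in> cyc n" for n x using e[of n] pr_cyc by auto
  show 2: "(\<lambda>x. pr (n + 1) (e n x)) \<in> K n \<rightarrow> carrier (G n)" for n
    using 1[of _ n] by (auto simp: cyc_iff)
  show "(\<lambda>x. pr n (e (n - 1) x)) \<in> K (n - 1) \<rightarrow> carrier (G (n - 1))"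
    using 2[of "n - 1"] by simp
qed

text \<open>Under \<open>em\<close> the cocycle \<open>f\<close> becomes a cocycle with values in an
  exact complex, where it has to bound.\<close>

lemma related_left_total:
  assumes f: "\<And>n. f n \<in> K n \<rightarrow> carrier (G n)"
    and cocycle: "\<And>n x. x \<in> K n \<Longrightarrow> bd (G (n - 1)) n (f (n - 1)) x = dG n (f n x)"
  shows "\<exists>e. related f e"
proof -
  have d: "(\<lambda>e. em (n - 1) (pr n e)) \<in> hom (E n) (E (n - 1))" for n
    using Group.hom_compose[OF pr em, of n] by (simp add: comp_def)
  have "\<exists>w. \<forall>n. w n \<in> K n \<rightarrow> carrier (E (n + 1)) \<and>
    (\<forall>x\<in>K n. em n (f n x) = bd (E n) n (w (n - 1)) x \<otimes>\<^bsub>E n\<^esub> em (n + 1 - 1) (pr (n + 1) (w n x)))"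
  proof (rule hom_into_exact[where E = E and d = "\<lambda>n e. em (n - 1) (pr n e)" and a = "\<lambda>n x. em n (f n x)", OF E d])
    show "\<exists>e'\<in>carrier (E (n + 1)). em (n + 1 - 1) (pr (n + 1) e') = e"
      if "e \<in> carrier (E n)" "em (n - 1) (pr n e) = \<one>\<^bsub>E (n - 1)\<^esub>" for n e
      using exact_em_pr[OF that] by simp
    show "(\<lambda>x. em n (f n x)) \<in> K n \<rightarrow> carrier (E n)" for n
      using f[of n] group_hom.hom_closed[OF em_hom] by (auto simp: Pi_iff)
    fix n x assume x: "x \<in> K n"
    have f1: "f (n - 1) \<in> K (n - 1) \<rightarrow> carrier (G (n - 1))" and fx: "f n x \<in> carrier (G n)" using f x by auto
    show "bd (E (n - 1)) n (\<lambda>x. em (n - 1) (f (n - 1) x)) x = em (n - 1) (pr n (em n (f n x)))"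
      using hom_bd[OF G E em f1, of x] cocycle[OF x] pr_em[OF fx] by simp
  qed
  then show ?thesis using f by (simp add: related_def)
qed

text \<open>Apply \<open>pr\<close> to the defining equation: the last term dies because dG vanishes
  on cycles. The identity says that (pr e) \<partial> takes boundary values, so that pr e becomes a
  cocycle modulo boundaries.\<close>

lemma dG_related:
  assumes R: "related f e" and x: "x \<in> K n"
  shows "dG n (f n x) = bd (G (n - 1)) n (\<lambda>y. pr n (e (n - 1) y)) x"
proof -
  interpret En: comm_group "E n" by (rule E)
  interpret em: group_hom "G n" "E n" "em n" by (rule em_hom)
  interpret pr: group_hom "E n" "G (n - 1)" "pr n" by (rule pr_hom)
  note r = relatedD[OF R]
  have fx: "f n x \<in> carrier (G n)" using r(1) x by auto
  have z: "pr (n + 1) (e n x) \<in> carrier (G n)" "dG n (pr (n + 1) (e n x)) = \<one>\<^bsub>G (n - 1)\<^esub>"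
    using r(5)[OF x] by (auto simp: cyc_iff)
  have b: "bd (E n) n (e (n - 1)) x \<in> carrier (E n)" by (rule bd_closed[OF E r(3)])
  have "dG n (f n x) = pr n (em n (f n x))" using pr_em[OF fx] by simp
  also have "\<dots> = pr n (bd (E n) n (e (n - 1)) x)" unfolding r(4)[OF x] using b z by (simp add: pr_em)
  also have "\<dots> = bd (G (n - 1)) n (\<lambda>y. pr n (e (n - 1) y)) x" by (rule hom_bd[OF E G pr r(3)])
  finally show ?thesis .
qed

text \<open>Composing the defining equation with the boundary of C removes the \<open>e\<close>
  \<partial> \<partial> term; cancelling \<open>em\<close> shows that f \<partial> is the expression
  already identified in \<open>dG_related\<close>.\<close>

lemma related_cocycle:
  assumes R: "related f e" and x: "x \<in> K n"
  shows "bd (G (n - 1)) n (f (n - 1)) x = dG n (f n x)"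
proof -
  interpret em: group_hom "G (n - 1)" "E (n - 1)" "em (n - 1)" by (rule em_hom)
  interpret En: comm_group "E (n - 1)" by (rule E)
  note r = relatedD[OF R]
  have e2: "e (n - 2) \<in> K (n - 2) \<rightarrow> carrier (E (n - 1))" using r(2)[of "n - 2"] by simp
  have z: "(\<lambda>y. em (n - 1) (pr n (e (n - 1) y))) \<in> K (n - 1) \<rightarrow> carrier (E (n - 1))"
    using r(7)[of n] em.hom_closed by (auto simp: Pi_iff)
  have b: "bd (E (n - 1)) (n - 1) (e (n - 2)) y \<in> carrier (E (n - 1))" for y
    by (rule bd_closed[OF E]) (use e2 in simp)
  have "em (n - 1) (bd (G (n - 1)) n (f (n - 1)) x) = bd (E (n - 1)) n (\<lambda>y. em (n - 1) (f (n - 1) y)) x"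
    by (rule hom_bd[OF G E em r(1)])
  also have "\<dots> = bd (E (n - 1)) n (\<lambda>y. bd (E (n - 1)) (n - 1) (e (n - 2)) y \<otimes>\<^bsub>E (n - 1)\<^esub> em (n - 1) (pr n (e (n - 1) y))) x"
    by (rule bd_cong[OF E]) (use r(4)[of _ "n - 1"] b z in \<open>auto simp: Pi_iff\<close>)
  also have "\<dots> = bd (E (n - 1)) n (bd (E (n - 1)) (n - 1) (e (n - 2))) x \<otimes>\<^bsub>E (n - 1)\<^esub> bd (E (n - 1)) n (\<lambda>y. em (n - 1) (pr n (e (n - 1) y))) x"
    by (rule bd_mult[OF E]) (use b z in auto)
  also have "\<dots> = bd (E (n - 1)) n (\<lambda>y. em (n - 1) (pr n (e (n - 1) y))) x"
    using bd_bd[OF E x e2] bd_closed[OF E z] by simp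
  also have "\<dots> = em (n - 1) (bd (G (n - 1)) n (\<lambda>y. pr n (e (n - 1) y)) x)"
    by (rule hom_bd[OF G E em r(7), symmetric])
  finally have "bd (G (n - 1)) n (f (n - 1)) x = bd (G (n - 1)) n (\<lambda>y. pr n (e (n - 1) y)) x"
    by (rule inj_onD[OF inj_em]) (rule bd_closed[OF G], rule r)+
  then show ?thesis using dG_related[OF R x] by simp
qed

text \<open>Surjectivity of the connecting map on representatives: lift \<open>z\<close> through
  \<open>pr\<close> to \<open>e\<close>, and correct \<open>e\<close> \<partial> by elements of
  \<open>G\<close> until it lies in the image of \<open>em\<close>.\<close>

lemma related_right_total:
  assumes z: "\<And>n x. x \<in> K n \<Longrightarrow> z n x \<in> cyc n"
    and bdz: "\<And>n x. x \<in> K n \<Longrightarrow> bd (G (n - 1)) n (z (n - 1)) x \<in> dG n ` carrier (G n)"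
  shows "\<exists>f e. related f e \<and> (\<forall>n. \<forall>x\<in>K n. pr (n + 1) (e n x) = z n x)"
proof -
  have "\<forall>n x. \<exists>e. x \<in> K n \<longrightarrow> e \<in> carrier (E (n + 1)) \<and> pr (n + 1) e = z n x"
    using pr_surj z by metis
  then obtain e where e: "\<And>n x. x \<in> K n \<Longrightarrow> e n x \<in> carrier (E (n + 1)) \<and> pr (n + 1) (e n x) = z n x"
    by metis
  have e1: "e (n - 1) \<in> K (n - 1) \<rightarrow> carrier (E n)" for n using e[of _ "n - 1"] by auto
  have "\<exists>a. a \<in> carrier (G n) \<and> em n a = bd (E n) n (e (n - 1)) x \<otimes>\<^bsub>E n\<^esub> em n (z n x)" if x: "x \<in> K n" for n x
  proof -
    interpret En: comm_group "E n" by (rule E)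
    interpret em: group_hom "G n" "E n" "em n" by (rule em_hom)
    interpret pr: group_hom "E n" "G (n - 1)" "pr n" by (rule pr_hom)
    interpret Gn: comm_group "G n" by (rule G)
    let ?b = "bd (E n) n (e (n - 1)) x"
    have b: "?b \<in> carrier (E n)" by (rule bd_closed[OF E e1])
    have "pr n ?b = bd (G (n - 1)) n (\<lambda>y. pr n (e (n - 1) y)) x" by (rule hom_bd[OF E G pr e1])
    also have "\<dots> = bd (G (n - 1)) n (z (n - 1)) x"
      by (rule bd_cong[OF G]) (use e[of _ "n - 1"] z[of _ "n - 1"] in \<open>auto simp: cyc_iff\<close>)
    finally obtain g where g: "g \<in> carrier (G n)" "pr n ?b = dG n g" using bdz[OF x] by auto
    \<comment> \<open>Since \<open>pr\<close> of \<open>em g\<close> is \<open>dG n g\<close>,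
      subtracting \<open>em g\<close> moves \<open>?b\<close> into the kernel of \<open>pr\<close>,
      that is, into \<open>em\<close> of the cycles.\<close>
    then have "pr n (?b \<otimes>\<^bsub>E n\<^esub> inv\<^bsub>E n\<^esub> em n g) = \<one>\<^bsub>G (n - 1)\<^esub>" using b group_hom.hom_closed[OF dG_hom g(1)] by (simp add: pr_em)
    from pr_one[OF _ this] obtain a where a: "a \<in> carrier (G n)" "?b \<otimes>\<^bsub>E n\<^esub> inv\<^bsub>E n\<^esub> em n g = em n a"
      using b g by (auto simp: cyc_iff)
    have "?b = em n (a \<otimes>\<^bsub>G n\<^esub> g)" using a g b by (simp flip: a(2) add: En.m_assoc)
    moreover have "z n x \<in> carrier (G n)" using z[OF x] by (simp add: cyc_iff)
    ultimately show ?thesis using a g by (intro exI[of _ "a \<otimes>\<^bsub>G n\<^esub> g \<otimes>\<^bsub>G n\<^esub> z n x"]) simp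
  qed
  from fibrewise_choice[of K, OF this] obtain f where "\<forall>n. \<forall>x\<in>K n. f n x \<in> carrier (G n) \<and> em n (f n x) = bd (E n) n (e (n - 1)) x \<otimes>\<^bsub>E n\<^esub> em n (z n x)"
    ..
  then show ?thesis using e by (intro exI[of _ f] exI[of _ e]) (auto simp: related_def)
qed

text \<open>If f = u \<partial> + \<partial> u, then a = e - em u is a cocycle of degree -1 in
  hom(C, E), so it bounds some \<open>w\<close>. Applying \<open>pr\<close> to that equation leaves
  y \<partial> with y = pr w, because dG vanishes on the cycles y.\<close>

lemma related_coboundary_imp:
  assumes R: "related f e" and u: "\<And>n. u n \<in> K n \<rightarrow> carrier (G (n + 1))"
    and f: "\<And>n x. x \<in> K n \<Longrightarrow> f n x = bd (G n) n (u (n - 1)) x \<otimes>\<^bsub>G n\<^esub> dG (n + 1) (u n x)"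
  shows "\<exists>y. \<forall>n. \<forall>x\<in>K n. y n x \<in> cyc (n + 1) \<and>
    pr (n + 1) (e n x) = bd (G n) n (y (n - 1)) x \<otimes>\<^bsub>G n\<^esub> dG (n + 1) (u n x)"
proof -
  note r = relatedD[OF R]
  define a where "a n x = e n x \<otimes>\<^bsub>E (n + 1)\<^esub> inv\<^bsub>E (n + 1)\<^esub> em (n + 1) (u n x)" for n x
  \<comment> \<open>In degree -1 the internal differential enters the cocycle condition with the
    opposite sign. \<open>hom_into_exact\<close> carries no signs, so it is applied to the shifted
    complex with negated differential.\<close>
  define d where "d n t = inv\<^bsub>E n\<^esub> em n (pr (n + 1) t)" for n t
  have d: "d n \<in> hom (E (n + 1)) (E n)" for n
  proof (rule homI)
    interpret En: comm_group "E n" by (rule E)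
    interpret em: group_hom "G n" "E n" "em n" by (rule em_hom)
    interpret pr: group_hom "E (n + 1)" "G n" "pr (n + 1)" by (rule pr_hom')
    show "d n s \<in> carrier (E n)" if "s \<in> carrier (E (n + 1))" for s using that by (simp add: d_def)
    show "d n (s \<otimes>\<^bsub>E (n + 1)\<^esub> t) = d n s \<otimes>\<^bsub>E n\<^esub> d n t"
      if "s \<in> carrier (E (n + 1))" "t \<in> carrier (E (n + 1))" for s t
      using that by (simp add: d_def En.inv_mult)
  qed
  have ac: "a n x \<in> carrier (E (n + 1))" and pra: "pr (n + 1) (a n x) = pr (n + 1) (e n x) \<otimes>\<^bsub>G n\<^esub> inv\<^bsub>G n\<^esub> dG (n + 1) (u n x)"
    if x: "x \<in> K n" for n x
  proof -
    interpret En: comm_group "E (n + 1)" by (rule E)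
    interpret em: group_hom "G (n + 1)" "E (n + 1)" "em (n + 1)" by (rule em_hom)
    interpret pr: group_hom "E (n + 1)" "G n" "pr (n + 1)" by (rule pr_hom')
    have "u n x \<in> carrier (G (n + 1))" "e n x \<in> carrier (E (n + 1))" using u r(2) x by auto
    then show "a n x \<in> carrier (E (n + 1))" "pr (n + 1) (a n x) = pr (n + 1) (e n x) \<otimes>\<^bsub>G n\<^esub> inv\<^bsub>G n\<^esub> dG (n + 1) (u n x)"
      by (simp_all add: a_def pr_em del: em.hom_inv)
  qed
  have "\<exists>w. \<forall>n. w n \<in> K n \<rightarrow> carrier (E (n + 1 + 1)) \<and>
    (\<forall>x\<in>K n. a n x = bd (E (n + 1)) n (w (n - 1)) x \<otimes>\<^bsub>E (n + 1)\<^esub> d (n + 1) (w n x))"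
  proof (rule hom_into_exact[where E = "\<lambda>n. E (n + 1)"])
    show "comm_group (E (n + 1))" for n by (rule E)
    show "d n \<in> hom (E (n + 1)) (E (n - 1 + 1))" for n using d by simp
    show "a n \<in> K n \<rightarrow> carrier (E (n + 1))" for n using ac by auto
  next
    fix n t assume t: "t \<in> carrier (E (n + 1))" and 1: "d n t = \<one>\<^bsub>E (n - 1 + 1)\<^esub>"
    interpret En: comm_group "E n" by (rule E)
    interpret En1: comm_group "E (n + 1)" by (rule E)
    interpret em: group_hom "G n" "E n" "em n" by (rule em_hom)
    interpret pr: group_hom "E (n + 1)" "G n" "pr (n + 1)" by (rule pr_hom')
    interpret pr2: group_hom "E (n + 1 + 1)" "G (n + 1)" "pr (n + 1 + 1)" by (rule pr_hom')
    interpret em2: group_hom "G (n + 1)" "E (n + 1)" "em (n + 1)" by (rule em_hom)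
    have "em n (pr (n + 1) t) = \<one>\<^bsub>E n\<^esub>" using 1 t by (simp add: d_def flip: em.hom_inv) (simp add: En.inv_eq_1_iff)
    then obtain t' where t': "t' \<in> carrier (E (n + 1 + 1))" "em (n + 1) (pr (n + 1 + 1) t') = t"
      using exact_em_pr[OF t] by auto
    \<comment> \<open>Exactness survives the sign change: the negative of a preimage for em pr is a
      preimage for \<open>d\<close>.\<close>
    have "em (n + 1) (pr (n + 1 + 1) (inv\<^bsub>E (n + 1 + 1)\<^esub> t')) = inv\<^bsub>E (n + 1)\<^esub> t"
      unfolding pr2.hom_inv[OF t'(1)] em2.hom_inv[OF pr2.hom_closed[OF t'(1)]] t'(2) ..
    then have "d (n + 1) (inv\<^bsub>E (n + 1 + 1)\<^esub> t') = t"
      unfolding d_def using t by (simp only: En1.inv_inv)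
    moreover have "inv\<^bsub>E (n + 1 + 1)\<^esub> t' \<in> carrier (E (n + 1 + 1))" by (rule pr2.G.inv_closed[OF t'(1)])
    ultimately show "\<exists>e'\<in>carrier (E (n + 1 + 1)). d (n + 1) e' = t" ..
  next
    fix n x assume x: "x \<in> K n"
    interpret En: comm_group "E n" by (rule E)
    interpret Gn: comm_group "G n" by (rule G)
    interpret em: group_hom "G n" "E n" "em n" by (rule em_hom)
    interpret dG: group_hom "G (n + 1)" "G n" "dG (n + 1)" by (rule dG_hom')
    let ?z = "pr (n + 1) (e n x)" and ?p = "bd (G n) n (u (n - 1)) x" and ?q = "dG (n + 1) (u n x)"
    have u1: "u (n - 1) \<in> K (n - 1) \<rightarrow> carrier (G n)" using u[of "n - 1"] by simp
    have eu1: "(\<lambda>y. em n (u (n - 1) y)) \<in> K (n - 1) \<rightarrow> carrier (E n)" using u1 em.hom_closed by (auto simp: Pi_iff)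
    have c: "?z \<in> carrier (G n)" "?p \<in> carrier (G n)" "?q \<in> carrier (G n)" "bd (E n) n (e (n - 1)) x \<in> carrier (E n)"
      "f n x \<in> carrier (G n)"
      using r(5)[OF x] bd_closed[OF G u1] u[of n] x bd_closed[OF E r(3)] r(1)[of n] by (auto simp: cyc_iff Pi_iff)
    \<comment> \<open>The cocycle condition for \<open>a\<close>: solving the relation of
      \<open>f\<close> and \<open>e\<close> for e \<partial> and inserting f = ?p + ?q cancels
      \<open>?p\<close> and leaves em of ?q - ?z, which is the negated differential of
      \<open>a\<close>.\<close>
    have "bd (E n) n (a (n - 1)) x = bd (E n) n (e (n - 1)) x \<otimes>\<^bsub>E n\<^esub> bd (E n) n (\<lambda>y. inv\<^bsub>E n\<^esub> em n (u (n - 1) y)) x"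
      unfolding a_def using bd_mult[OF E r(3), of "\<lambda>y. inv\<^bsub>E n\<^esub> em n (u (n - 1) y)"] eu1 by (simp add: Pi_iff)
    also have "\<dots> = bd (E n) n (e (n - 1)) x \<otimes>\<^bsub>E n\<^esub> inv\<^bsub>E n\<^esub> em n ?p"
      using bd_inv[OF E eu1] hom_bd[OF G E em u1] by simp
    also have "bd (E n) n (e (n - 1)) x = em n (f n x) \<otimes>\<^bsub>E n\<^esub> inv\<^bsub>E n\<^esub> em n ?z"
      using r(4)[OF x] c by (simp add: En.m_assoc)
    also have "em n (f n x) \<otimes>\<^bsub>E n\<^esub> inv\<^bsub>E n\<^esub> em n ?z \<otimes>\<^bsub>E n\<^esub> inv\<^bsub>E n\<^esub> em n ?p
        = em n (f n x \<otimes>\<^bsub>G n\<^esub> inv\<^bsub>G n\<^esub> ?z \<otimes>\<^bsub>G n\<^esub> inv\<^bsub>G n\<^esub> ?p)"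
      using c by simp
    also have "f n x \<otimes>\<^bsub>G n\<^esub> inv\<^bsub>G n\<^esub> ?z \<otimes>\<^bsub>G n\<^esub> inv\<^bsub>G n\<^esub> ?p = inv\<^bsub>G n\<^esub> (?z \<otimes>\<^bsub>G n\<^esub> inv\<^bsub>G n\<^esub> ?q)"
    proof -
      have "f n x \<otimes>\<^bsub>G n\<^esub> inv\<^bsub>G n\<^esub> ?z \<otimes>\<^bsub>G n\<^esub> inv\<^bsub>G n\<^esub> ?p = ?q \<otimes>\<^bsub>G n\<^esub> inv\<^bsub>G n\<^esub> ?z \<otimes>\<^bsub>G n\<^esub> (?p \<otimes>\<^bsub>G n\<^esub> inv\<^bsub>G n\<^esub> ?p)"
        unfolding f[OF x] using c by (simp add: Gn.m_ac del: Gn.r_inv)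
      then show ?thesis using c by (simp add: Gn.inv_mult Gn.m_comm)
    qed
    also have "em n (inv\<^bsub>G n\<^esub> (?z \<otimes>\<^bsub>G n\<^esub> inv\<^bsub>G n\<^esub> ?q)) = d n (a n x)"
      unfolding d_def pra[OF x] using c by simp
    finally show "bd (E (n - 1 + 1)) n (a (n - 1)) x = d n (a n x)" by simp
  qed
  then obtain w where w: "\<And>n. w n \<in> K n \<rightarrow> carrier (E (n + 1 + 1))"
    and aw: "\<And>n x. x \<in> K n \<Longrightarrow> a n x = bd (E (n + 1)) n (w (n - 1)) x \<otimes>\<^bsub>E (n + 1)\<^esub> d (n + 1) (w n x)"
    by auto
  define y where "y n x = pr (n + 1 + 1) (w n x)" for n x
  have yc: "y n x \<in> cyc (n + 1)" if "x \<in> K n" for n x unfolding y_def by (rule pr_cyc[OF funcset_mem[OF w that]])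
  have "pr (n + 1) (e n x) = bd (G n) n (y (n - 1)) x \<otimes>\<^bsub>G n\<^esub> dG (n + 1) (u n x)" if x: "x \<in> K n" for n x
  proof -
    interpret En: comm_group "E (n + 1)" by (rule E)
    interpret Gn: comm_group "G n" by (rule G)
    interpret Gn1: comm_group "G (n + 1)" by (rule G)
    interpret em: group_hom "G (n + 1)" "E (n + 1)" "em (n + 1)" by (rule em_hom)
    interpret pr: group_hom "E (n + 1)" "G n" "pr (n + 1)" by (rule pr_hom')
    interpret dG: group_hom "G (n + 1)" "G n" "dG (n + 1)" by (rule dG_hom')
    have w1: "w (n - 1) \<in> K (n - 1) \<rightarrow> carrier (E (n + 1))" using w[of "n - 1"] by simp
    have b: "bd (E (n + 1)) n (w (n - 1)) x \<in> carrier (E (n + 1))" by (rule bd_closed[OF E w1])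
    have y: "y n x \<in> carrier (G (n + 1))" "dG (n + 1) (y n x) = \<one>\<^bsub>G n\<^esub>" using yc[OF x] by (simp_all add: cyc_iff)
    have yy: "y (n - 1) = (\<lambda>t. pr (n + 1) (w (n - 1) t))" by (simp add: y_def fun_eq_iff)
    have dw: "d (n + 1) (w n x) = em (n + 1) (inv\<^bsub>G (n + 1)\<^esub> y n x)" using y by (simp add: d_def y_def)
    have q: "dG (n + 1) (u n x) \<in> carrier (G n)" using funcset_mem[OF u x] by (rule dG.hom_closed)
    have z: "pr (n + 1) (e n x) \<in> carrier (G n)" using r(5)[OF x] by (simp add: cyc_iff)
    have "pr (n + 1) (a n x) = pr (n + 1) (bd (E (n + 1)) n (w (n - 1)) x)"
      unfolding aw[OF x] dw using b y by (simp add: pr_em del: em.hom_inv)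
    also have "\<dots> = bd (G n) n (y (n - 1)) x" unfolding yy by (rule hom_bd[OF E G pr' w1])
    finally have eq: "pr (n + 1) (e n x) \<otimes>\<^bsub>G n\<^esub> inv\<^bsub>G n\<^esub> dG (n + 1) (u n x) = bd (G n) n (y (n - 1)) x"
      unfolding pra[OF x] .
    show ?thesis unfolding eq[symmetric] using q z by (simp add: Gn.m_assoc)
  qed
  then show ?thesis using yc by (intro exI[of _ y]) auto
qed

text \<open>Lift \<open>y\<close> through \<open>pr\<close> to \<open>w\<close> in E. Then e - w
  \<partial> lies in the image of \<open>em\<close>, say e = w \<partial> + em u, so e \<partial> =
  em (u \<partial>) and f = u \<partial> + pr e = (u + y) \<partial> + \<partial> (u + y).\<close>

lemma related_coboundary_if:
  assumes R: "related f e"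
    and y: "\<And>n x. x \<in> K n \<Longrightarrow> y n x \<in> cyc (n + 1)"
    and zy: "\<And>n x. x \<in> K n \<Longrightarrow> \<exists>g\<in>carrier (G (n + 1)). pr (n + 1) (e n x) = bd (G n) n (y (n - 1)) x \<otimes>\<^bsub>G n\<^esub> dG (n + 1) g"
  shows "\<exists>u. \<forall>n. \<forall>x\<in>K n. u n x \<in> carrier (G (n + 1)) \<and> f n x = bd (G n) n (u (n - 1)) x \<otimes>\<^bsub>G n\<^esub> dG (n + 1) (u n x)"
proof -
  note r = relatedD[OF R]
  have "\<forall>n x. \<exists>t. x \<in> K n \<longrightarrow> t \<in> carrier (E (n + 1 + 1)) \<and> pr (n + 1 + 1) t = y n x"
    using pr_surj y by metis
  then obtain w where w: "\<And>n x. x \<in> K n \<Longrightarrow> w n x \<in> carrier (E (n + 1 + 1)) \<and> pr (n + 1 + 1) (w n x) = y n x"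
    by metis
  have w1: "w (n - 1) \<in> K (n - 1) \<rightarrow> carrier (E (n + 1))" for n using w[of _ "n - 1"] by auto
  have y1: "y (n - 1) \<in> K (n - 1) \<rightarrow> carrier (G n)" for n using y[of _ "n - 1"] by (auto simp: cyc_iff)
  \<comment> \<open>\<open>u\<close> is the given \<open>g\<close> corrected by a cycle:
    \<open>e\<close> and w \<partial> + em g have the same image under \<open>pr\<close>, so they
    differ by \<open>em\<close> of a cycle, which leaves \<open>dG\<close> of \<open>g\<close>
    unchanged.\<close>
  have "\<exists>u. u \<in> carrier (G (n + 1)) \<and> e n x = bd (E (n + 1)) n (w (n - 1)) x \<otimes>\<^bsub>E (n + 1)\<^esub> em (n + 1) u \<and>
      pr (n + 1) (e n x) = bd (G n) n (y (n - 1)) x \<otimes>\<^bsub>G n\<^esub> dG (n + 1) u" if x: "x \<in> K n" for n x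
  proof -
    interpret En: comm_group "E (n + 1)" by (rule E)
    interpret Gn: comm_group "G n" by (rule G)
    interpret Gn1: comm_group "G (n + 1)" by (rule G)
    interpret em: group_hom "G (n + 1)" "E (n + 1)" "em (n + 1)" by (rule em_hom)
    interpret pr: group_hom "E (n + 1)" "G n" "pr (n + 1)" by (rule pr_hom')
    interpret dG: group_hom "G (n + 1)" "G n" "dG (n + 1)" by (rule dG_hom')
    obtain g where g: "g \<in> carrier (G (n + 1))" "pr (n + 1) (e n x) = bd (G n) n (y (n - 1)) x \<otimes>\<^bsub>G n\<^esub> dG (n + 1) g"
      using zy[OF x] by auto
    let ?b = "bd (E (n + 1)) n (w (n - 1)) x"
    have b: "?b \<in> carrier (E (n + 1))" by (rule bd_closed[OF E w1])
    have ex: "e n x \<in> carrier (E (n + 1))" using r(2) x by auto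
    have yb: "bd (G n) n (y (n - 1)) x \<in> carrier (G n)" by (rule bd_closed[OF G y1])
    have "pr (n + 1) ?b = bd (G n) n (\<lambda>t. pr (n + 1) (w (n - 1) t)) x" by (rule hom_bd[OF E G pr' w1])
    also have "\<dots> = bd (G n) n (y (n - 1)) x" by (rule bd_cong[OF G y1]) (use w[of _ "n - 1"] in simp)
    finally have "pr (n + 1) (?b \<otimes>\<^bsub>E (n + 1)\<^esub> em (n + 1) g) = pr (n + 1) (e n x)"
      using b g by (simp add: pr_em)
    then have "pr (n + 1) (e n x \<otimes>\<^bsub>E (n + 1)\<^esub> inv\<^bsub>E (n + 1)\<^esub> (?b \<otimes>\<^bsub>E (n + 1)\<^esub> em (n + 1) g)) = \<one>\<^bsub>G (n + 1 - 1)\<^esub>"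
      using b g(1) ex pr.hom_closed[OF ex] by (simp del: pr.hom_mult add: pr.hom_mult[OF ex])
    from pr_one[OF _ this] obtain v where v: "v \<in> carrier (G (n + 1))" "dG (n + 1) v = \<one>\<^bsub>G n\<^esub>"
      and ev: "e n x \<otimes>\<^bsub>E (n + 1)\<^esub> inv\<^bsub>E (n + 1)\<^esub> (?b \<otimes>\<^bsub>E (n + 1)\<^esub> em (n + 1) g) = em (n + 1) v"
      using b g(1) ex by (auto simp: cyc_iff)
    have "e n x = em (n + 1) v \<otimes>\<^bsub>E (n + 1)\<^esub> (?b \<otimes>\<^bsub>E (n + 1)\<^esub> em (n + 1) g)"
      unfolding ev[symmetric] using b g(1) ex by (simp add: En.m_assoc)
    then have "e n x = ?b \<otimes>\<^bsub>E (n + 1)\<^esub> em (n + 1) (g \<otimes>\<^bsub>G (n + 1)\<^esub> v)"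
      using b g(1) v by (simp add: En.m_ac)
    moreover have "dG (n + 1) (g \<otimes>\<^bsub>G (n + 1)\<^esub> v) = dG (n + 1) g" using g v by simp
    ultimately show ?thesis using g v by (intro exI[of _ "g \<otimes>\<^bsub>G (n + 1)\<^esub> v"]) simp
  qed
  from fibrewise_choice[of K, OF this] obtain u where "\<forall>n. \<forall>x\<in>K n. u n x \<in> carrier (G (n + 1)) \<and> e n x = bd (E (n + 1)) n (w (n - 1)) x \<otimes>\<^bsub>E (n + 1)\<^esub> em (n + 1) (u n x) \<and>
      pr (n + 1) (e n x) = bd (G n) n (y (n - 1)) x \<otimes>\<^bsub>G n\<^esub> dG (n + 1) (u n x)" ..
  note u = this[rule_format]
  have u1: "u (n - 1) \<in> K (n - 1) \<rightarrow> carrier (G n)" for n using u[of _ "n - 1"] by auto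
  \<comment> \<open>Adding the cycle \<open>y\<close> absorbs the term y \<partial> and does not
    affect the part involving \<open>dG\<close>.\<close>
  define v where "v n x = u n x \<otimes>\<^bsub>G (n + 1)\<^esub> y n x" for n x
  have "v n x \<in> carrier (G (n + 1)) \<and> f n x = bd (G n) n (v (n - 1)) x \<otimes>\<^bsub>G n\<^esub> dG (n + 1) (v n x)" if x: "x \<in> K n" for n x
  proof -
    interpret En: comm_group "E n" by (rule E)
    interpret Gn: comm_group "G n" by (rule G)
    interpret Gn1: comm_group "G (n + 1)" by (rule G)
    interpret em: group_hom "G n" "E n" "em n" by (rule em_hom)
    interpret dG: group_hom "G (n + 1)" "G n" "dG (n + 1)" by (rule dG_hom')
    have uy: "u n x \<in> carrier (G (n + 1))" "y n x \<in> carrier (G (n + 1))" "dG (n + 1) (y n x) = \<one>\<^bsub>G n\<^esub>"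
      using u[OF x] y[OF x] by (simp_all add: cyc_iff)
    have w2: "w (n - 2) \<in> K (n - 2) \<rightarrow> carrier (E n)" using w1[of "n - 1"] by simp
    have bw2: "bd (E n) (n - 1) (w (n - 2)) t \<in> carrier (E n)" for t
      by (rule bd_closed[OF E]) (use w2 in simp)
    have eu1: "(\<lambda>t. em n (u (n - 1) t)) \<in> K (n - 1) \<rightarrow> carrier (E n)" using u1[of n] em.hom_closed by (auto simp: Pi_iff)
    let ?z = "pr (n + 1) (e n x)"
    have z: "?z \<in> carrier (G n)" using r(5)[OF x] by (simp add: cyc_iff)
    have c: "bd (G n) n (u (n - 1)) x \<in> carrier (G n)" "bd (G n) n (y (n - 1)) x \<in> carrier (G n)"
      using bd_closed[OF G u1] bd_closed[OF G y1] by auto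
    have "bd (E n) n (e (n - 1)) x = bd (E n) n (\<lambda>t. bd (E n) (n - 1) (w (n - 2)) t \<otimes>\<^bsub>E n\<^esub> em n (u (n - 1) t)) x"
      by (rule bd_cong[OF E]) (use u[of _ "n - 1"] bw2 eu1 in \<open>auto simp: Pi_iff\<close>)
    also have "\<dots> = bd (E n) n (bd (E n) (n - 1) (w (n - 2))) x \<otimes>\<^bsub>E n\<^esub> bd (E n) n (\<lambda>t. em n (u (n - 1) t)) x"
      by (rule bd_mult[OF E]) (use bw2 eu1 in auto)
    also have "\<dots> = em n (bd (G n) n (u (n - 1)) x)"
      using bd_bd[OF E x w2] bd_closed[OF E eu1] hom_bd[OF G E em u1] by simp
    finally have "em n (f n x) = em n (bd (G n) n (u (n - 1)) x \<otimes>\<^bsub>G n\<^esub> ?z)"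
      unfolding r(4)[OF x] using c z by simp
    then have "f n x = bd (G n) n (u (n - 1)) x \<otimes>\<^bsub>G n\<^esub> ?z"
      by (rule inj_onD[OF inj_em]) (use c z r(1)[of n] x in auto)
    also have "\<dots> = bd (G n) n (u (n - 1)) x \<otimes>\<^bsub>G n\<^esub> bd (G n) n (y (n - 1)) x \<otimes>\<^bsub>G n\<^esub> dG (n + 1) (u n x)"
      using conjunct2[OF conjunct2[OF u[OF x]]] c uy by (simp add: Gn.m_assoc)
    also have "bd (G n) n (u (n - 1)) x \<otimes>\<^bsub>G n\<^esub> bd (G n) n (y (n - 1)) x = bd (G n) n (v (n - 1)) x"
      unfolding v_def using bd_mult[OF G u1 y1] by simp
    also have "dG (n + 1) (u n x) = dG (n + 1) (v n x)" using uy by (simp add: v_def)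
    finally show ?thesis using Gn1.m_closed[OF uy(1,2)] unfolding v_def[of n x] by (rule conjI[rotated])
  qed
  then show ?thesis by (intro exI[of _ v]) auto
qed

end

subsection \<open>Cohomology groups as sets of cosets\<close>

text \<open>Both images count the classes of one equivalence relation on \<open>S\<close>. Cosets
  can thus be counted through any invariant that separates exactly them.\<close>

lemma card_image_same_fibres:
  assumes "\<And>a b. a \<in> S \<Longrightarrow> b \<in> S \<Longrightarrow> f a = f b \<longleftrightarrow> g a = g b"
  shows "card (f ` S) = card (g ` S)"
proof -
  have "bij_betw (\<lambda>y. g (inv_into S f y)) (f ` S) (g ` S)"
    unfolding bij_betw_def
  proof
    show "inj_on (\<lambda>y. g (inv_into S f y)) (f ` S)"
      by (rule inj_onI) (metis assms f_inv_into_f inv_into_into)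
    show "(\<lambda>y. g (inv_into S f y)) ` f ` S = g ` S"
      unfolding image_image by (rule image_cong[OF refl]) (metis assms f_inv_into_f imageI inv_into_into)
  qed
  then show ?thesis by (rule bij_betw_same_card)
qed

lemma (in group) rcos_eq_iff:
  assumes H: "subgroup H G" and a: "a \<in> carrier G" "b \<in> carrier G"
  shows "H #> a = H #> b \<longleftrightarrow> a \<otimes> inv b \<in> H"
proof -
  have "a \<in> H #> b \<longleftrightarrow> a \<otimes> inv b \<in> H"
    using subgroup.rcos_module[OF H group_axioms a(2,1)] .
  moreover have "H #> a = H #> b \<longleftrightarrow> a \<in> H #> b"
    using repr_independence[OF _ a(2) H] rcos_self[OF a(1) H] by metis
  ultimately show ?thesis by simp
qed

lemma carrier_FactGroup_image: "carrier (A Mod N) = (\<lambda>a. N #>\<^bsub>A\<^esub> a) ` carrier A"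
  by (auto simp: FactGroup_def RCOSETS_def)

lemma card_FactGroup_fibres:
  assumes "group A" "subgroup N A"
    and "\<And>a b. a \<in> carrier A \<Longrightarrow> b \<in> carrier A \<Longrightarrow> p a = p b \<longleftrightarrow> a \<otimes>\<^bsub>A\<^esub> inv\<^bsub>A\<^esub> b \<in> N"
  shows "card (carrier (A Mod N)) = card (p ` carrier A)"
  unfolding carrier_FactGroup_image
  by (rule card_image_same_fibres) (simp add: group.rcos_eq_iff[OF assms(1,2)] assms(3))

lemma comm_group_cochgrp:
  assumes "comm_group A" shows "comm_group (cochgrp K A n)"
proof -
  interpret A: comm_group A by fact
  show ?thesis
  proof (rule comm_groupI)
    fix f assume f: "f \<in> carrier (cochgrp K A n)"
    then show "\<exists>g\<in>carrier (cochgrp K A n). g \<otimes>\<^bsub>cochgrp K A n\<^esub> f = \<one>\<^bsub>cochgrp K A n\<^esub>"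
      by (intro bexI[of _ "\<lambda>x\<in>K n. inv\<^bsub>A\<^esub> f x"]) (auto simp: cochgrp_def fun_eq_iff PiE_iff)
  qed (auto simp: cochgrp_def fun_eq_iff PiE_iff A.m_ac extensional_def)
qed

lemma comm_group_homgrp:
  assumes "\<And>n. comm_group (G n)" shows "comm_group (homgrp K G p)"
proof -
  interpret G: comm_group "G n" for n by fact
  show ?thesis
  proof (rule comm_groupI)
    fix f assume f: "f \<in> carrier (homgrp K G p)"
    then show "\<exists>g\<in>carrier (homgrp K G p). g \<otimes>\<^bsub>homgrp K G p\<^esub> f = \<one>\<^bsub>homgrp K G p\<^esub>"
      by (intro bexI[of _ "hneg K G p f"])
         (auto simp: homgrp_def homset_def hadd_def hneg_def hzero_def fun_eq_iff PiE_iff)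
  qed (auto simp: homgrp_def homset_def hadd_def hzero_def fun_eq_iff PiE_iff G.m_ac extensional_def)
qed

lemma inv_cochgrp:
  assumes "comm_group A" "f \<in> K n \<rightarrow>\<^sub>E carrier A"
  shows "inv\<^bsub>cochgrp K A n\<^esub> f = (\<lambda>x\<in>K n. inv\<^bsub>A\<^esub> f x)"
proof -
  interpret A: comm_group A by fact
  interpret C: comm_group "cochgrp K A n" by (rule comm_group_cochgrp[OF assms(1)])
  show ?thesis
    by (rule C.inv_equality) (use assms(2) in \<open>auto simp: cochgrp_def fun_eq_iff PiE_iff\<close>)
qed

lemma inv_homgrp:
  assumes "\<And>n. comm_group (G n)" "f \<in> homset K G p"
  shows "inv\<^bsub>homgrp K G p\<^esub> f = hneg K G p f"
proof -
  interpret G: comm_group "G n" for n by fact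
  interpret C: comm_group "homgrp K G p" by (rule comm_group_homgrp[OF assms(1)])
  show ?thesis
    by (rule C.inv_equality)
      (use assms(2) in \<open>auto simp: homgrp_def homset_def hadd_def hneg_def hzero_def fun_eq_iff PiE_iff\<close>)
qed

section \<open>Cohomology of C with coefficients in one abelian group\<close>

context based_complex
begin

lemma cobdryA_bd: "cobdryA K dC A n \<phi> = (\<lambda>x\<in>K (n + 1). bd A (n + 1) \<phi> x)"
  by (simp add: cobdryA_def pull_def)

lemma cobdryA_hom:
  assumes A: "comm_group A"
  shows "cobdryA K dC A n \<in> hom (cochgrp K A n) (cochgrp K A (n + 1))"
proof (rule homI)
  fix f assume "f \<in> carrier (cochgrp K A n)"
  then have "f \<in> K (n + 1 - 1) \<rightarrow> carrier A" by (auto simp: cochgrp_def)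
  from bd_closed[OF A this] show "cobdryA K dC A n f \<in> carrier (cochgrp K A (n + 1))"
    by (simp add: cobdryA_bd cochgrp_def)
next
  fix f g assume "f \<in> carrier (cochgrp K A n)" "g \<in> carrier (cochgrp K A n)"
  then have f: "f \<in> K (n + 1 - 1) \<rightarrow> carrier A" and g: "g \<in> K (n + 1 - 1) \<rightarrow> carrier A"
    by (auto simp: cochgrp_def)
  interpret A: comm_group A by fact
  have "bd A (n + 1) (\<lambda>x\<in>K n. f x \<otimes>\<^bsub>A\<^esub> g x) x = bd A (n + 1) (\<lambda>x. f x \<otimes>\<^bsub>A\<^esub> g x) x" for x
    by (rule bd_cong[OF A]) (use f g in \<open>auto simp: Pi_iff\<close>)
  then show "cobdryA K dC A n (f \<otimes>\<^bsub>cochgrp K A n\<^esub> g) = cobdryA K dC A n f \<otimes>\<^bsub>cochgrp K A (n + 1)\<^esub> cobdryA K dC A n g"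
    using bd_mult[OF A f g] by (auto simp: cobdryA_bd cochgrp_def fun_eq_iff)
qed

text \<open>Only values on \<open>K n\<close> matter here, so \<open>c\<close> may be an
  unrestricted lambda term; \<open>coboundary_iff\<close> returns to the extensional image.\<close>

definition coboundary where
  "coboundary A n c \<longleftrightarrow> (\<exists>a\<in>K (n - 1) \<rightarrow> carrier A. \<forall>x\<in>K n. c x = bd A n a x)"

lemma coboundary_iff:
  assumes A: "comm_group A" and c: "c \<in> extensional (K n)"
  shows "c \<in> cobdryA K dC A (n - 1) ` (K (n - 1) \<rightarrow>\<^sub>E carrier A) \<longleftrightarrow> coboundary A n c"
proof
  assume "c \<in> cobdryA K dC A (n - 1) ` (K (n - 1) \<rightarrow>\<^sub>E carrier A)"
  then show "coboundary A n c" by (auto simp: coboundary_def cobdryA_bd)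
next
  assume "coboundary A n c"
  then obtain a where a: "a \<in> K (n - 1) \<rightarrow> carrier A" "\<forall>x\<in>K n. c x = bd A n a x" by (auto simp: coboundary_def)
  have "bd A n (restrict a (K (n - 1))) x = bd A n a x" for x by (rule bd_cong[OF A a(1)]) simp
  then have "c = cobdryA K dC A (n - 1) (restrict a (K (n - 1)))"
    using a(2) c by (auto simp: cobdryA_bd fun_eq_iff extensional_def)
  then show "c \<in> cobdryA K dC A (n - 1) ` (K (n - 1) \<rightarrow>\<^sub>E carrier A)" using a(1) by (auto simp: PiE_iff Pi_iff)
qed

definition cocycles where
  "cocycles A n = {\<phi> \<in> K n \<rightarrow>\<^sub>E carrier A. cobdryA K dC A n \<phi> = (\<lambda>x\<in>K (n + 1). \<one>\<^bsub>A\<^esub>)}"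

lemma cocycles_iff: "\<phi> \<in> cocycles A n \<longleftrightarrow> \<phi> \<in> K n \<rightarrow>\<^sub>E carrier A \<and> (\<forall>x\<in>K (n + 1). bd A (n + 1) \<phi> x = \<one>\<^bsub>A\<^esub>)"
  by (auto simp: cocycles_def cobdryA_bd fun_eq_iff)

abbreviation coboundaries where
  "coboundaries A n \<equiv> cobdryA K dC A (n - 1) ` (K (n - 1) \<rightarrow>\<^sub>E carrier A)"

lemma cohom_eq: "cohom K dC A n = ((cochgrp K A n)\<lparr>carrier := cocycles A n\<rparr>) Mod coboundaries A n"
  by (simp add: cohom_def cocycles_def)

lemma subgroup_cocycles: "comm_group A \<Longrightarrow> subgroup (cocycles A n) (cochgrp K A n)"
proof -
  assume A: "comm_group A"
  have "group_hom (cochgrp K A n) (cochgrp K A (n + 1)) (cobdryA K dC A n)"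
    by (rule group_hom_of_comm_groups) (auto intro: comm_group_cochgrp cobdryA_hom A)
  from group_hom.subgroup_kernel[OF this] show ?thesis
    by (simp add: kernel_def cocycles_def cochgrp_def)
qed

lemma coboundaries_cocycles:
  assumes A: "comm_group A" shows "coboundaries A n \<subseteq> cocycles A n"
proof
  fix c assume "c \<in> coboundaries A n"
  then obtain a where a: "a \<in> K (n - 1) \<rightarrow>\<^sub>E carrier A" "c = (\<lambda>x\<in>K n. bd A n a x)" by (auto simp: cobdryA_bd)
  have cl: "bd A n a x \<in> carrier A" for x by (rule bd_closed[OF A]) (use a in auto)
  have "bd A (n + 1) c x = \<one>\<^bsub>A\<^esub>" if x: "x \<in> K (n + 1)" for x
  proof -
    have "bd A (n + 1) c x = bd A (n + 1) (bd A (n + 1 - 1) a) x"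
      by (rule bd_cong[OF A]) (use cl a(2) in auto)
    also have "\<dots> = \<one>\<^bsub>A\<^esub>" by (rule bd_bd[OF A x]) (use a(1) in auto)
    finally show ?thesis .
  qed
  then show "c \<in> cocycles A n" using cl a(2) by (simp add: cocycles_iff)
qed

lemma subgroup_coboundaries:
  assumes A: "comm_group A"
  shows "subgroup (coboundaries A n) ((cochgrp K A n)\<lparr>carrier := cocycles A n\<rparr>)"
proof -
  have "group_hom (cochgrp K A (n - 1)) (cochgrp K A n) (cobdryA K dC A (n - 1))"
    by (rule group_hom_of_comm_groups) (use cobdryA_hom[OF A, of "n - 1"] in \<open>auto intro: comm_group_cochgrp A\<close>)
  from group_hom.img_is_subgroup[OF this] have "subgroup (coboundaries A n) (cochgrp K A n)"
    by (simp add: cochgrp_def)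
  then show ?thesis
    by (rule group.subgroup_incl[OF comm_group.axioms(2)[OF comm_group_cochgrp[OF A]] _ subgroup_cocycles[OF A] coboundaries_cocycles[OF A]])
qed

lemma cohom_class_eq_iff:
  assumes A: "comm_group A" and c: "c \<in> cocycles A n" "c' \<in> cocycles A n"
  shows "coboundaries A n #>\<^bsub>(cochgrp K A n)\<lparr>carrier := cocycles A n\<rparr>\<^esub> c = coboundaries A n #>\<^bsub>(cochgrp K A n)\<lparr>carrier := cocycles A n\<rparr>\<^esub> c'
    \<longleftrightarrow> coboundary A n (\<lambda>x. c x \<otimes>\<^bsub>A\<^esub> inv\<^bsub>A\<^esub> c' x)"
proof -
  interpret C: comm_group "cochgrp K A n" by (rule comm_group_cochgrp[OF A])
  let ?Z = "(cochgrp K A n)\<lparr>carrier := cocycles A n\<rparr>"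
  have gZ: "group ?Z" by (rule subgroup.subgroup_is_group[OF subgroup_cocycles[OF A] C.group_axioms])
  have "inv\<^bsub>?Z\<^esub> c' = inv\<^bsub>cochgrp K A n\<^esub> c'"
    using C.m_inv_consistent[OF subgroup_cocycles[OF A] c(2)] by simp
  also have "\<dots> = (\<lambda>x\<in>K n. inv\<^bsub>A\<^esub> c' x)" by (rule inv_cochgrp[OF A]) (use c in \<open>simp add: cocycles_iff\<close>)
  finally have e: "c \<otimes>\<^bsub>?Z\<^esub> inv\<^bsub>?Z\<^esub> c' = (\<lambda>x\<in>K n. c x \<otimes>\<^bsub>A\<^esub> inv\<^bsub>A\<^esub> c' x)"
    by (simp add: cochgrp_def cong: restrict_cong)
  have "coboundaries A n #>\<^bsub>?Z\<^esub> c = coboundaries A n #>\<^bsub>?Z\<^esub> c' \<longleftrightarrow> c \<otimes>\<^bsub>?Z\<^esub> inv\<^bsub>?Z\<^esub> c' \<in> coboundaries A n"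
    by (rule group.rcos_eq_iff[OF gZ subgroup_coboundaries[OF A]]) (use c in simp_all)
  also have "\<dots> \<longleftrightarrow> coboundary A n (\<lambda>x\<in>K n. c x \<otimes>\<^bsub>A\<^esub> inv\<^bsub>A\<^esub> c' x)"
    unfolding e by (rule coboundary_iff[OF A]) simp
  also have "\<dots> \<longleftrightarrow> coboundary A n (\<lambda>x. c x \<otimes>\<^bsub>A\<^esub> inv\<^bsub>A\<^esub> c' x)" by (simp add: coboundary_def)
  finally show ?thesis .
qed

end

section \<open>Homology classes of G; chain maps and null homotopies\<close>

context hom_complex
begin

abbreviation Hl where "Hl n \<equiv> homology G dG n"
abbreviation Zgrp where "Zgrp n \<equiv> (G n)\<lparr>carrier := cyc n\<rparr>"
definition bnd where "bnd n = dG (n + 1) ` carrier (G (n + 1))"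
definition cls where "cls n a = bnd n #>\<^bsub>Zgrp n\<^esub> a"

lemma comm_group_Zgrp: "comm_group (Zgrp n)"
  by (rule comm_group_subgroup[OF G subgroup_cyc])

lemma subgroup_bnd: "subgroup (bnd n) (Zgrp n)"
proof -
  have "subgroup (bnd n) (G n)" unfolding bnd_def by (rule group_hom.img_is_subgroup[OF dG_hom'])
  then show ?thesis
    by (rule group.subgroup_incl[OF comm_group.axioms(2)[OF G] _ subgroup_cyc]) (auto simp: bnd_def intro: dG_cyc)
qed

lemma Hl_eq: "Hl n = Zgrp n Mod bnd n"
  by (simp add: homology_def bnd_def cyc_def)

lemma comm_group_Hl: "comm_group (Hl n)"
  unfolding Hl_eq by (rule comm_group.abelian_FactGroup[OF comm_group_Zgrp subgroup_bnd])

lemma cls_hom: "cls n \<in> hom (Zgrp n) (Hl n)"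
proof -
  have "bnd n \<lhd> Zgrp n" by (rule comm_group.subgroup_imp_normal[OF comm_group_Zgrp subgroup_bnd])
  from normal.r_coset_hom_Mod[OF this] show ?thesis
    unfolding Hl_eq by (simp add: hom_def cls_def Pi_iff)
qed

lemma carrier_Hl: "carrier (Hl n) = cls n ` cyc n"
  unfolding Hl_eq carrier_FactGroup_image by (auto simp: cls_def)

lemma cls_eq_iff:
  assumes "a \<in> cyc n" "b \<in> cyc n"
  shows "cls n a = cls n b \<longleftrightarrow> (\<exists>g\<in>carrier (G (n + 1)). a = b \<otimes>\<^bsub>G n\<^esub> dG (n + 1) g)"
proof -
  interpret G: comm_group "G n" by (rule G)
  interpret Z: comm_group "Zgrp n" by (rule comm_group_Zgrp)
  interpret dG: group_hom "G (n + 1)" "G n" "dG (n + 1)" by (rule dG_hom')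
  have inv: "inv\<^bsub>Zgrp n\<^esub> b = inv\<^bsub>G n\<^esub> b" using G.m_inv_consistent[OF subgroup_cyc assms(2)] by simp
  have c: "a \<in> carrier (G n)" "b \<in> carrier (G n)" using assms by (simp_all add: cyc_iff)
  have "cls n a = cls n b \<longleftrightarrow> a \<otimes>\<^bsub>Zgrp n\<^esub> inv\<^bsub>Zgrp n\<^esub> b \<in> bnd n"
    unfolding cls_def by (rule Z.rcos_eq_iff[OF subgroup_bnd]) (use assms in simp_all)
  also have "\<dots> \<longleftrightarrow> a \<otimes>\<^bsub>G n\<^esub> inv\<^bsub>G n\<^esub> b \<in> bnd n" by (simp add: inv)
  also have "\<dots> \<longleftrightarrow> (\<exists>g\<in>carrier (G (n + 1)). a \<otimes>\<^bsub>G n\<^esub> inv\<^bsub>G n\<^esub> b = dG (n + 1) g)" by (auto simp: bnd_def)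
  also have "\<dots> \<longleftrightarrow> (\<exists>g\<in>carrier (G (n + 1)). a = b \<otimes>\<^bsub>G n\<^esub> dG (n + 1) g)"
  proof (rule bex_cong[OF refl])
    fix g assume "g \<in> carrier (G (n + 1))"
    then have "dG (n + 1) g \<in> carrier (G n)" by simp
    then show "a \<otimes>\<^bsub>G n\<^esub> inv\<^bsub>G n\<^esub> b = dG (n + 1) g \<longleftrightarrow> a = b \<otimes>\<^bsub>G n\<^esub> dG (n + 1) g"
      using c by (metis G.inv_closed G.inv_solve_right G.inv_solve_right' G.m_comm G.m_closed)
  qed
  finally show ?thesis .
qed

lemma bd_Zgrp:
  assumes "\<phi> \<in> K (n - 1) \<rightarrow> cyc m"
  shows "bd (Zgrp m) n \<phi> x = bd (G m) n \<phi> x" "bd (G m) n \<phi> x \<in> cyc m"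
proof -
  have "(\<lambda>a. a) \<in> hom (Zgrp m) (G m)" by (auto simp: hom_def cyc_iff)
  from hom_bd[OF comm_group_Zgrp G this, of \<phi> n x] assms
  show eq: "bd (Zgrp m) n \<phi> x = bd (G m) n \<phi> x" by simp
  have "bd (Zgrp m) n \<phi> x \<in> carrier (Zgrp m)" by (rule bd_closed[OF comm_group_Zgrp]) (use assms in simp)
  then show "bd (G m) n \<phi> x \<in> cyc m" by (simp add: eq)
qed

lemma cls_bd:
  assumes "\<phi> \<in> K (n - 1) \<rightarrow> cyc m"
  shows "cls m (bd (G m) n \<phi> x) = bd (Hl m) n (\<lambda>y. cls m (\<phi> y)) x"
  using hom_bd[OF comm_group_Zgrp comm_group_Hl cls_hom, of \<phi> n m x] bd_Zgrp[OF assms] assms by simp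

text \<open>These are the chain maps from C to G: in degree 0 the coboundary is f \<partial> -
  \<partial> f.\<close>

definition total_cocycle where
  "total_cocycle f \<longleftrightarrow> (\<forall>n. \<forall>x\<in>K n. bd (G (n - 1)) n (f (n - 1)) x = dG n (f n x))"

text \<open>\<open>u\<close> is a null homotopy of the chain map \<open>f\<close>: in degree -1 the
  sign of the coboundary is plus. Nothing is asked of \<open>u\<close> outside
  \<open>K n\<close>.\<close>

definition total_coboundary where
  "total_coboundary f \<longleftrightarrow> (\<exists>u. \<forall>n. \<forall>x\<in>K n. u n x \<in> carrier (G (n + 1)) \<and>
     f n x = bd (G n) n (u (n - 1)) x \<otimes>\<^bsub>G n\<^esub> dG (n + 1) (u n x))"

end

section \<open>The connecting homomorphism on cohomology classes\<close>

context resolved_hom_complex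
begin

text \<open>Well-definedness and injectivity of the connecting homomorphism in one equivalence.
  Modulo boundaries the term \<partial> u disappears, and what remains says that pr e is the
  coboundary of a cochain of homology classes.\<close>

lemma related_coboundary_iff:
  assumes R: "related f e"
  shows "total_coboundary f \<longleftrightarrow> (\<forall>n. coboundary (Hl n) n (\<lambda>x. cls n (pr (n + 1) (e n x))))"
proof
  assume "total_coboundary f"
  then obtain u where u: "\<And>n x. x \<in> K n \<Longrightarrow> u n x \<in> carrier (G (n + 1))"
     "\<And>n x. x \<in> K n \<Longrightarrow> f n x = bd (G n) n (u (n - 1)) x \<otimes>\<^bsub>G n\<^esub> dG (n + 1) (u n x)"
    unfolding total_coboundary_def by metis
  have uc: "u n \<in> K n \<rightarrow> carrier (G (n + 1))" for n using u(1) by auto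
  from related_coboundary_imp[OF R uc u(2)] obtain y where
    "\<forall>n. \<forall>x\<in>K n. y n x \<in> cyc (n + 1) \<and>
    pr (n + 1) (e n x) = bd (G n) n (y (n - 1)) x \<otimes>\<^bsub>G n\<^esub> dG (n + 1) (u n x)" by auto
  note y = this[rule_format]
  have y1: "y (n - 1) \<in> K (n - 1) \<rightarrow> cyc n" for n using y[of _ "n - 1"] by auto
  show "\<forall>n. coboundary (Hl n) n (\<lambda>x. cls n (pr (n + 1) (e n x)))"
    unfolding coboundary_def
  proof (intro allI bexI ballI)
    fix n x assume x: "x \<in> K n"
    have "cls n (pr (n + 1) (e n x)) = cls n (bd (G n) n (y (n - 1)) x)"
      using cls_eq_iff[OF relatedD(5)[OF R x] bd_Zgrp(2)[OF y1]] y[OF x] u(1)[OF x] by auto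
    then show "cls n (pr (n + 1) (e n x)) = bd (Hl n) n (\<lambda>t. cls n (y (n - 1) t)) x"
      using cls_bd[OF y1] by simp
  qed (use y1 in \<open>auto simp: carrier_Hl Pi_iff\<close>)
next
  assume cob: "\<forall>n. coboundary (Hl n) n (\<lambda>x. cls n (pr (n + 1) (e n x)))"
  have "\<exists>y. y \<in> K (n - 1) \<rightarrow> cyc n \<and> (\<forall>x\<in>K n. cls n (pr (n + 1) (e n x)) = bd (Hl n) n (\<lambda>t. cls n (y t)) x)" for n
  proof -
    obtain a where a: "a \<in> K (n - 1) \<rightarrow> carrier (Hl n)" "\<forall>x\<in>K n. cls n (pr (n + 1) (e n x)) = bd (Hl n) n a x"
      using spec[OF cob, of n] unfolding coboundary_def by auto
    then have "\<forall>t\<in>K (n - 1). \<exists>b. b \<in> cyc n \<and> a t = cls n b" by (auto simp: carrier_Hl Pi_iff)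
    then obtain y where y: "\<forall>t\<in>K (n - 1). y t \<in> cyc n \<and> a t = cls n (y t)" by (meson bchoice)
    have "bd (Hl n) n (\<lambda>t. cls n (y t)) x = bd (Hl n) n a x" for x
      by (rule bd_cong[OF comm_group_Hl a(1)]) (use y in simp)
    then show ?thesis using y a(2) by (intro exI[of _ y]) auto
  qed
  then obtain y' where y': "\<And>n. y' n \<in> K (n - 1) \<rightarrow> cyc n"
    "\<And>n x. x \<in> K n \<Longrightarrow> cls n (pr (n + 1) (e n x)) = bd (Hl n) n (\<lambda>t. cls n (y' n t)) x"
    by metis
  \<comment> \<open>\<open>y' n\<close> is a cochain on \<open>K (n - 1)\<close>, indexed by the
    degree of its coboundary; \<open>y\<close> is indexed by its own degree.\<close>
  define y where "y n = y' (n + 1)" for n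
  have "\<exists>u. \<forall>n. \<forall>x\<in>K n. u n x \<in> carrier (G (n + 1)) \<and> f n x = bd (G n) n (u (n - 1)) x \<otimes>\<^bsub>G n\<^esub> dG (n + 1) (u n x)"
  proof (rule related_coboundary_if[OF R])
    show "y n x \<in> cyc (n + 1)" if "x \<in> K n" for n x using y'(1)[of "n + 1"] that by (auto simp: y_def)
    show "\<exists>g\<in>carrier (G (n + 1)). pr (n + 1) (e n x) = bd (G n) n (y (n - 1)) x \<otimes>\<^bsub>G n\<^esub> dG (n + 1) g" if x: "x \<in> K n" for n x
    proof -
      have "y (n - 1) = y' n" by (simp add: y_def)
      moreover have "cls n (pr (n + 1) (e n x)) = cls n (bd (G n) n (y' n) x)"
        using y'(2)[OF x] cls_bd[OF y'(1)] by simp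
      ultimately show ?thesis using cls_eq_iff[OF relatedD(5)[OF R x] bd_Zgrp(2)[OF y'(1)]] by simp
    qed
  qed
  then show "total_coboundary f" by (simp add: total_coboundary_def)
qed

text \<open>Additivity of the relation reduces comparison of two classes to the vanishing of
  one.\<close>

lemma related_diff:
  assumes R: "related f e" and R': "related f' e'"
  shows "related (\<lambda>n x. f n x \<otimes>\<^bsub>G n\<^esub> inv\<^bsub>G n\<^esub> f' n x) (\<lambda>n x. e n x \<otimes>\<^bsub>E (n + 1)\<^esub> inv\<^bsub>E (n + 1)\<^esub> e' n x)"
  unfolding related_def
proof (intro allI conjI ballI)
  fix n
  interpret En: comm_group "E n" by (rule E)
  interpret En1: comm_group "E (n + 1)" by (rule E)
  interpret Gn: comm_group "G n" by (rule G)
  interpret em: group_hom "G n" "E n" "em n" by (rule em_hom)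
  interpret pr: group_hom "E (n + 1)" "G n" "pr (n + 1)" by (rule pr_hom')
  note r = relatedD[OF R] and r' = relatedD[OF R']
  show "(\<lambda>x. f n x \<otimes>\<^bsub>G n\<^esub> inv\<^bsub>G n\<^esub> f' n x) \<in> K n \<rightarrow> carrier (G n)" using r(1)[of n] r'(1)[of n] by (auto simp: Pi_iff)
  show "(\<lambda>x. e n x \<otimes>\<^bsub>E (n + 1)\<^esub> inv\<^bsub>E (n + 1)\<^esub> e' n x) \<in> K n \<rightarrow> carrier (E (n + 1))" using r(2)[of n] r'(2)[of n] by (auto simp: Pi_iff)
  fix x assume x: "x \<in> K n"
  have c: "f n x \<in> carrier (G n)" "f' n x \<in> carrier (G n)" "e n x \<in> carrier (E (n + 1))" "e' n x \<in> carrier (E (n + 1))"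
    using r(1,2)[of n] r'(1,2)[of n] x by auto
  have b: "bd (E n) n (e (n - 1)) x \<in> carrier (E n)" "bd (E n) n (e' (n - 1)) x \<in> carrier (E n)"
    using bd_closed[OF E r(3)] bd_closed[OF E r'(3)] by auto
  have ie: "(\<lambda>t. inv\<^bsub>E n\<^esub> e' (n - 1) t) \<in> K (n - 1) \<rightarrow> carrier (E n)" using r'(3)[of n] by (auto simp: Pi_iff)
  have "bd (E n) n (\<lambda>t. e (n - 1) t \<otimes>\<^bsub>E n\<^esub> inv\<^bsub>E n\<^esub> e' (n - 1) t) x = bd (E n) n (e (n - 1)) x \<otimes>\<^bsub>E n\<^esub> inv\<^bsub>E n\<^esub> bd (E n) n (e' (n - 1)) x"
    using bd_mult[OF E r(3) ie] bd_inv[OF E r'(3)] by simp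
  then show "em n (f n x \<otimes>\<^bsub>G n\<^esub> inv\<^bsub>G n\<^esub> f' n x) = bd (E n) n (\<lambda>x. e (n - 1) x \<otimes>\<^bsub>E (n - 1 + 1)\<^esub> inv\<^bsub>E (n - 1 + 1)\<^esub> e' (n - 1) x) x
      \<otimes>\<^bsub>E n\<^esub> em n (pr (n + 1) (e n x \<otimes>\<^bsub>E (n + 1)\<^esub> inv\<^bsub>E (n + 1)\<^esub> e' n x))"
    using c b r(4)[OF x] r'(4)[OF x] by (simp add: En.inv_mult En.m_ac)
qed

text \<open>By \<open>dG_related\<close> the coboundary of pr e is dG f, and a boundary has trivial
  homology class.\<close>

lemma related_class_cocycle:
  assumes R: "related f e"
  shows "(\<lambda>x\<in>K n. cls n (pr (n + 1) (e n x))) \<in> cocycles (Hl n) n"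
  unfolding cocycles_iff
proof (intro conjI ballI)
  interpret H: comm_group "Hl n" by (rule comm_group_Hl)
  show c: "(\<lambda>x\<in>K n. cls n (pr (n + 1) (e n x))) \<in> K n \<rightarrow>\<^sub>E carrier (Hl n)"
    using relatedD(5)[OF R] by (auto simp: carrier_Hl)
  fix x assume x: "x \<in> K (n + 1)"
  have z: "(\<lambda>t. pr (n + 1) (e n t)) \<in> K (n + 1 - 1) \<rightarrow> cyc n" using relatedD(5)[OF R] by simp
  have fx: "f (n + 1) x \<in> carrier (G (n + 1))" using relatedD(1)[OF R] x by auto
  have "bd (Hl n) (n + 1) (\<lambda>x\<in>K n. cls n (pr (n + 1) (e n x))) x = bd (Hl n) (n + 1) (\<lambda>x. cls n (pr (n + 1) (e n x))) x"
    by (rule bd_cong[OF comm_group_Hl]) (use z in \<open>auto simp: carrier_Hl Pi_iff\<close>)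
  also have "\<dots> = cls n (bd (G n) (n + 1) (\<lambda>x. pr (n + 1) (e n x)) x)" by (rule cls_bd[OF z, symmetric])
  also have "bd (G n) (n + 1) (\<lambda>x. pr (n + 1) (e n x)) x = dG (n + 1) (f (n + 1) x)"
    using dG_related[OF R x] by simp
  also have "cls n \<dots> = \<one>\<^bsub>Hl n\<^esub>"
  proof -
    interpret Z: comm_group "Zgrp n" by (rule comm_group_Zgrp)
    have "dG (n + 1) (f (n + 1) x) \<in> bnd n" using fx by (auto simp: bnd_def)
    then have "cls n (dG (n + 1) (f (n + 1) x)) = bnd n"
      unfolding cls_def using dG_cyc[OF fx] by (intro Z.coset_join2[OF _ subgroup_bnd]) simp_all
    then show ?thesis unfolding Hl_eq by (simp add: FactGroup_def)
  qed
  finally show "bd (Hl n) (n + 1) (\<lambda>x\<in>K n. cls n (pr (n + 1) (e n x))) x = \<one>\<^bsub>Hl n\<^esub>" .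
qed

text \<open>Choose cycles \<open>z\<close> representing the given classes. The cocycle condition in
  homology then says that z \<partial> is a boundary, which is the hypothesis of
  \<open>related_right_total\<close>.\<close>

lemma related_class_surj:
  assumes c: "\<And>n. c n \<in> cocycles (Hl n) n"
  shows "\<exists>f e. related f e \<and> (\<forall>n. c n = (\<lambda>x\<in>K n. cls n (pr (n + 1) (e n x))))"
proof -
  have "\<exists>z. z \<in> cyc n \<and> c n x = cls n z" if "x \<in> K n" for n x
    using c[of n] that by (auto simp: cocycles_iff carrier_Hl PiE_iff)
  from fibrewise_choice[of K, OF this] obtain z where "\<forall>n. \<forall>x\<in>K n. z n x \<in> cyc n \<and> c n x = cls n (z n x)" ..
  note z = this[rule_format]
  have bz: "bd (G (n - 1)) n (z (n - 1)) x \<in> dG n ` carrier (G n)" if x: "x \<in> K n" for n x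
  proof -
    have z1: "z (n - 1) \<in> K (n - 1) \<rightarrow> cyc (n - 1)" using z by auto
    have c1: "c (n - 1) \<in> K (n - 1) \<rightarrow> carrier (Hl (n - 1))" using c[of "n - 1"] by (auto simp: cocycles_iff)
    have "cls (n - 1) (bd (G (n - 1)) n (z (n - 1)) x) = bd (Hl (n - 1)) n (\<lambda>y. cls (n - 1) (z (n - 1) y)) x"
      by (rule cls_bd[OF z1])
    also have "\<dots> = bd (Hl (n - 1)) n (c (n - 1)) x"
      by (rule bd_cong[OF comm_group_Hl c1]) (use z in simp)
    also have "\<dots> = \<one>\<^bsub>Hl (n - 1)\<^esub>" using c[of "n - 1"] x by (simp add: cocycles_iff)
    also have "\<dots> = bnd (n - 1)" unfolding Hl_eq by (simp add: FactGroup_def)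
    finally have "bd (G (n - 1)) n (z (n - 1)) x \<in> bnd (n - 1)"
      unfolding cls_def
      using group.coset_join1[OF comm_group.axioms(2)[OF comm_group_Zgrp] _ _ subgroup_bnd] bd_Zgrp(2)[OF z1] by auto
    then show ?thesis by (simp add: bnd_def)
  qed
  have zc: "z n x \<in> cyc n" if "x \<in> K n" for n x using z[OF that] by simp
  from related_right_total[OF zc bz] obtain f e where fe: "related f e" "\<forall>n. \<forall>x\<in>K n. pr (n + 1) (e n x) = z n x"
    by auto
  have "c n = (\<lambda>x\<in>K n. cls n (pr (n + 1) (e n x)))" for n
    using c[of n] z fe(2) by (auto simp: cocycles_iff fun_eq_iff PiE_iff extensional_def)
  then show ?thesis using fe(1) by auto
qed

end

section \<open>The group H^0(C, G) in terms of chain maps and homotopies\<close>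

lemma homset_0_iff: "f \<in> homset K G 0 \<longleftrightarrow> (\<forall>n. f n \<in> K n \<rightarrow>\<^sub>E carrier (G n))"
  by (simp add: homset_def)

lemma homset_neg1_iff: "f \<in> homset K G (-1) \<longleftrightarrow> (\<forall>n. f n \<in> K n \<rightarrow>\<^sub>E carrier (G (n + 1)))"
  by (simp add: homset_def)

context hom_complex
begin

lemma cobdry_bd:
  "cobdry K dC G dG p f = (\<lambda>n. \<lambda>x\<in>K n. bd (G (n - p - 1)) n (f (n - 1)) x \<otimes>\<^bsub>G (n - p - 1)\<^esub>
     dG (n - p) (f n x) [^]\<^bsub>G (n - p - 1)\<^esub> (if even p then -1 else (1::int)))"
  by (simp add: cobdry_def pull_def)

lemma cobdry_hom: "cobdry K dC G dG p \<in> hom (homgrp K G p) (homgrp K G (p + 1))"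
proof (rule homI)
  have i: "n - 1 - p = n - p - 1" "n - (p + 1) = n - p - 1" for n by simp_all
  interpret G: comm_group "G m" for m by (rule G)
  interpret dG: group_hom "G m" "G (m - 1)" "dG m" for m by (rule dG_hom)
  fix f assume "f \<in> carrier (homgrp K G p)"
  then have f: "f n \<in> K n \<rightarrow>\<^sub>E carrier (G (n - p))" for n by (auto simp: homgrp_def homset_def)
  have f1: "f (n - 1) \<in> K (n - 1) \<rightarrow> carrier (G (n - p - 1))" for n using f[of "n - 1"] by (auto simp: i)
  show "cobdry K dC G dG p f \<in> carrier (homgrp K G (p + 1))"
    using bd_closed[OF G f1] f by (auto simp: cobdry_bd homgrp_def homset_def i PiE_iff)
  fix g assume "g \<in> carrier (homgrp K G p)"
  then have g: "g n \<in> K n \<rightarrow>\<^sub>E carrier (G (n - p))" for n by (auto simp: homgrp_def homset_def)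
  have g1: "g (n - 1) \<in> K (n - 1) \<rightarrow> carrier (G (n - p - 1))" for n using g[of "n - 1"] by (auto simp: i)
  have bd: "bd (G (n - p - 1)) n (hadd K G p f g (n - 1)) x = bd (G (n - p - 1)) n (f (n - 1)) x \<otimes>\<^bsub>G (n - p - 1)\<^esub> bd (G (n - p - 1)) n (g (n - 1)) x" for n x
  proof -
    have "bd (G (n - p - 1)) n (hadd K G p f g (n - 1)) x = bd (G (n - p - 1)) n (\<lambda>y. f (n - 1) y \<otimes>\<^bsub>G (n - p - 1)\<^esub> g (n - 1) y) x"
      by (rule bd_cong[OF G]) (use f1[of n] g1[of n] in \<open>auto simp: hadd_def i Pi_iff\<close>)
    then show ?thesis using bd_mult[OF G f1 g1] by simp
  qed
  show "cobdry K dC G dG p (f \<otimes>\<^bsub>homgrp K G p\<^esub> g) = cobdry K dC G dG p f \<otimes>\<^bsub>homgrp K G (p + 1)\<^esub> cobdry K dC G dG p g"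
  proof (intro ext)
    fix n x
    show "cobdry K dC G dG p (f \<otimes>\<^bsub>homgrp K G p\<^esub> g) n x = (cobdry K dC G dG p f \<otimes>\<^bsub>homgrp K G (p + 1)\<^esub> cobdry K dC G dG p g) n x"
    proof (cases "x \<in> K n")
      case True
      have c: "f n x \<in> carrier (G (n - p))" "g n x \<in> carrier (G (n - p))" using f g True by (auto simp: PiE_iff)
      have "hadd K G p f g n x = f n x \<otimes>\<^bsub>G (n - p)\<^esub> g n x" using True by (simp add: hadd_def)
      then show ?thesis
        using True c bd_closed[OF G f1] bd_closed[OF G g1] dG.hom_closed[of _ "n - p"]
        unfolding homgrp_def monoid.simps hadd_def[of K G "p + 1"] cobdry_bd
        by (simp add: bd i G.int_pow_distrib G.m_ac)
    qed (simp add: homgrp_def cobdry_bd hadd_def)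
  qed
qed

abbreviation Z0 where "Z0 \<equiv> {f \<in> homset K G 0. cobdry K dC G dG 0 f = hzero K G 1}"
abbreviation B0 where "B0 \<equiv> cobdry K dC G dG (-1) ` homset K G (-1)"

lemma cobdry_0:
  assumes f: "f \<in> homset K G 0" and x: "x \<in> K n"
  shows "cobdry K dC G dG 0 f n x = \<one>\<^bsub>G (n - 1)\<^esub> \<longleftrightarrow> bd (G (n - 1)) n (f (n - 1)) x = dG n (f n x)"
proof -
  interpret G: comm_group "G m" for m by (rule G)
  interpret dG: group_hom "G n" "G (n - 1)" "dG n" by (rule dG_hom)
  have f1: "f (n - 1) \<in> K (n - 1) \<rightarrow> carrier (G (n - 1))" and fx: "f n x \<in> carrier (G n)"
    using f x by (auto simp: homset_0_iff PiE_iff)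
  have "cobdry K dC G dG 0 f n x = bd (G (n - 1)) n (f (n - 1)) x \<otimes>\<^bsub>G (n - 1)\<^esub> inv\<^bsub>G (n - 1)\<^esub> dG n (f n x)"
    using x fx by (simp add: cobdry_bd G.int_pow_neg)
  then show ?thesis using bd_closed[OF G f1, of x] dG.hom_closed[OF fx]
    by (metis G.inv_closed G.inv_equality G.inv_inv G.r_inv)
qed

lemma Z0_iff: "f \<in> Z0 \<longleftrightarrow> f \<in> homset K G 0 \<and> total_cocycle f"
proof -
  have "cobdry K dC G dG 0 f = hzero K G 1 \<longleftrightarrow> (\<forall>n. \<forall>x\<in>K n. cobdry K dC G dG 0 f n x = \<one>\<^bsub>G (n - 1)\<^esub>)"
    by (auto simp: fun_eq_iff hzero_def cobdry_bd)
  then show ?thesis using cobdry_0[of f] by (simp add: total_cocycle_def cong: conj_cong)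
qed

lemma B0_iff:
  assumes f: "f \<in> homset K G 0"
  shows "f \<in> B0 \<longleftrightarrow> total_coboundary f"
proof
  have one: "a [^]\<^bsub>G n\<^esub> (1::int) = a" if "a \<in> carrier (G n)" for n a
    using group.int_pow_1[OF comm_group.axioms(2)[OF G] that] .
  have dGc: "dG (n + 1) a \<in> carrier (G n)" if "a \<in> carrier (G (n + 1))" for n a
    using group_hom.hom_closed[OF dG_hom' that] .
  {
    assume "f \<in> B0"
    then obtain u where u: "u \<in> homset K G (-1)" "f = cobdry K dC G dG (-1) u" by auto
    then show "total_coboundary f" unfolding total_coboundary_def
      by (intro exI[of _ u]) (auto simp: homset_neg1_iff cobdry_bd PiE_iff one dGc)
  }
  assume "total_coboundary f"
  then obtain u where "\<forall>n. \<forall>x\<in>K n. u n x \<in> carrier (G (n + 1)) \<and>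
     f n x = bd (G n) n (u (n - 1)) x \<otimes>\<^bsub>G n\<^esub> dG (n + 1) (u n x)" unfolding total_coboundary_def by auto
  note u = this[rule_format]
  \<comment> \<open>Restriction makes the homotopy extensional, as membership in
    \<open>homset\<close> requires; the values entering the coboundary stay the same.\<close>
  define v where "v n = restrict (u n) (K n)" for n
  have v: "v \<in> homset K G (-1)" using u by (auto simp: homset_neg1_iff v_def)
  have bv: "bd (G n) n (v (n - 1)) x = bd (G n) n (u (n - 1)) x" for n x
    by (rule bd_cong[OF G]) (use u[of _ "n - 1"] in \<open>auto simp: v_def\<close>)
  have "f = cobdry K dC G dG (-1) v"
  proof (intro ext)
    fix n x show "f n x = cobdry K dC G dG (-1) v n x"
    proof (cases "x \<in> K n")
      case True
      then have "v n x = u n x" by (simp add: v_def)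
      then show ?thesis using True u[OF True] by (simp add: cobdry_bd bv one dGc)
    next
      case False
      then show ?thesis using f by (auto simp: cobdry_bd homset_0_iff PiE_iff extensional_def)
    qed
  qed
  then show "f \<in> B0" using v by auto
qed

text \<open>Of the terms of f \<partial> and \<partial> f, those with a squared boundary vanish and
  the mixed term \<partial> u \<partial> is common to both.\<close>

lemma coboundary_is_cocycle:
  assumes "total_coboundary f" shows "total_cocycle f"
  unfolding total_cocycle_def
proof (intro allI ballI)
  obtain u where "\<forall>n. \<forall>x\<in>K n. u n x \<in> carrier (G (n + 1)) \<and>
     f n x = bd (G n) n (u (n - 1)) x \<otimes>\<^bsub>G n\<^esub> dG (n + 1) (u n x)"
    using assms unfolding total_coboundary_def by auto
  note u = this[rule_format]
  fix n x assume x: "x \<in> K n"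
  interpret G: comm_group "G m" for m by (rule G)
  interpret dG: group_hom "G n" "G (n - 1)" "dG n" by (rule dG_hom)
  interpret dG1: group_hom "G (n + 1)" "G n" "dG (n + 1)" by (rule dG_hom')
  have u1: "u (n - 1) \<in> K (n - 1) \<rightarrow> carrier (G n)" using u[of _ "n - 1"] by auto
  have u2: "u (n - 2) \<in> K (n - 2) \<rightarrow> carrier (G (n - 1))" using u[of _ "n - 2"] by auto
  have du: "(\<lambda>y. dG n (u (n - 1) y)) \<in> K (n - 1) \<rightarrow> carrier (G (n - 1))" using u1 by (auto simp: Pi_iff)
  have b2: "bd (G (n - 1)) (n - 1) (u (n - 2)) y \<in> carrier (G (n - 1))" for y
    by (rule bd_closed[OF G]) (use u2 in simp)
  have "bd (G (n - 1)) n (f (n - 1)) x = bd (G (n - 1)) n (\<lambda>y. bd (G (n - 1)) (n - 1) (u (n - 2)) y \<otimes>\<^bsub>G (n - 1)\<^esub> dG n (u (n - 1) y)) x"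
    by (rule bd_cong[OF G]) (use u[of _ "n - 1"] b2 du in \<open>auto simp: Pi_iff\<close>)
  also have "\<dots> = bd (G (n - 1)) n (bd (G (n - 1)) (n - 1) (u (n - 2))) x \<otimes>\<^bsub>G (n - 1)\<^esub> bd (G (n - 1)) n (\<lambda>y. dG n (u (n - 1) y)) x"
    by (rule bd_mult[OF G]) (use b2 du in auto)
  also have "\<dots> = dG n (bd (G n) n (u (n - 1)) x)"
    using bd_bd[OF G x u2] bd_closed[OF G du] hom_bd[OF G G dG u1] by simp
  also have "\<dots> = dG n (f n x)"
    using u[OF x] bd_closed[OF G u1] dG_dG[of "u n x" "n + 1"] by simp
  finally show "bd (G (n - 1)) n (f (n - 1)) x = dG n (f n x)" .
qed

abbreviation Z0grp where "Z0grp \<equiv> (homgrp K G 0)\<lparr>carrier := Z0\<rparr>"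

lemma subgroup_Z0: "subgroup Z0 (homgrp K G 0)"
proof -
  have "group_hom (homgrp K G 0) (homgrp K G 1) (cobdry K dC G dG 0)"
    by (rule group_hom_of_comm_groups) (use cobdry_hom[of 0] in \<open>auto intro: comm_group_homgrp G\<close>)
  from group_hom.subgroup_kernel[OF this] show ?thesis by (simp add: kernel_def homgrp_def)
qed

lemma subgroup_B0': "subgroup B0 (homgrp K G 0)"
proof -
  have "group_hom (homgrp K G (-1)) (homgrp K G 0) (cobdry K dC G dG (-1))"
    by (rule group_hom_of_comm_groups) (use cobdry_hom[of "-1"] in \<open>auto intro: comm_group_homgrp G\<close>)
  from group_hom.img_is_subgroup[OF this] show ?thesis by (simp add: homgrp_def)
qed

lemma B0_subset_Z0: "B0 \<subseteq> Z0"
proof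
  fix f assume f: "f \<in> B0"
  then have "f \<in> homset K G 0" using subgroup.subset[OF subgroup_B0'] by (auto simp: homgrp_def)
  then show "f \<in> Z0" using f B0_iff Z0_iff coboundary_is_cocycle by blast
qed

lemma group_Z0grp: "group Z0grp"
  by (rule subgroup.subgroup_is_group[OF subgroup_Z0 comm_group.axioms(2)[OF comm_group_homgrp[OF G]]])

lemma subgroup_B0: "subgroup B0 Z0grp"
  by (rule group.subgroup_incl[OF comm_group.axioms(2)[OF comm_group_homgrp[OF G]] subgroup_B0' subgroup_Z0 B0_subset_Z0])

lemma Z0grp_diff:
  assumes "f \<in> Z0" "g \<in> Z0"
  shows "f \<otimes>\<^bsub>Z0grp\<^esub> inv\<^bsub>Z0grp\<^esub> g = (\<lambda>n. \<lambda>x\<in>K n. f n x \<otimes>\<^bsub>G n\<^esub> inv\<^bsub>G n\<^esub> g n x)"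
proof -
  have "inv\<^bsub>Z0grp\<^esub> g = inv\<^bsub>homgrp K G 0\<^esub> g"
    using group.m_inv_consistent[OF comm_group.axioms(2)[OF comm_group_homgrp[OF G]] subgroup_Z0 assms(2)] by simp
  also have "\<dots> = hneg K G 0 g" by (rule inv_homgrp[OF G]) (use assms in simp)
  finally show ?thesis by (simp add: homgrp_def hadd_def hneg_def cong: restrict_cong)
qed

lemma H0_hom_eq: "H0_hom K dC G dG = Z0grp Mod B0"
  by (simp add: H0_hom_def)

end

text \<open>The tuple of classes of pr e is an invariant of a cocycle \<open>f\<close> whose fibres
  are the cosets of \<open>B0\<close> and whose range is the full product.\<close>

lemma (in resolved_hom_complex) card_H0_hom_resolved:
  "card (carrier (H0_hom K dC G dG)) = (\<Prod>n\<in>{n. K n \<noteq> {}}. card (carrier (cohom K dC (Hl n) n)))"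
proof -
  let ?S = "{n. K n \<noteq> {}}"
  \<comment> \<open>An arbitrary bounding cochain; \<open>same\<close> shows that the resulting
    classes do not depend on it.\<close>
  define ef where "ef f = (SOME e. related f e)" for f
  have ef: "related f (ef f)" if "f \<in> Z0" for f
  proof -
    have "f n \<in> K n \<rightarrow> carrier (G n)" for n using that by (auto simp: homset_0_iff)
    moreover have "bd (G (n - 1)) n (f (n - 1)) x = dG n (f n x)" if "x \<in> K n" for n x
      using \<open>f \<in> Z0\<close> that unfolding Z0_iff total_cocycle_def by auto
    ultimately have "\<exists>e. related f e" by (rule related_left_total)
    then show ?thesis unfolding ef_def by (rule someI_ex)
  qed
  define c where "c e n = (\<lambda>x\<in>K n. cls n (pr (n + 1) (e n x)))" for e n
  define k where "k n d = coboundaries (Hl n) n #>\<^bsub>(cochgrp K (Hl n) n)\<lparr>carrier := cocycles (Hl n) n\<rparr>\<^esub> d" for n d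
  have cc: "c e n \<in> cocycles (Hl n) n" if "related f e" for f e n
    unfolding c_def by (rule related_class_cocycle[OF that])
  have cohom: "carrier (cohom K dC (Hl n) n) = k n ` cocycles (Hl n) n" for n
    unfolding cohom_eq carrier_FactGroup_image k_def by simp
  \<comment> \<open>The case of equal \<open>f\<close> and \<open>f'\<close> is included on purpose:
    it gives independence of the choice of \<open>e\<close>.\<close>
  have same: "(\<forall>n\<in>?S. k n (c e n) = k n (c e' n)) \<longleftrightarrow> total_coboundary (\<lambda>n x. f n x \<otimes>\<^bsub>G n\<^esub> inv\<^bsub>G n\<^esub> f' n x)"
    if R: "related f e" and R': "related f' e'" for f e f' e'
  proof -
    have eq: "k n (c e n) = k n (c e' n) \<longleftrightarrow>
        coboundary (Hl n) n (\<lambda>x. cls n (pr (n + 1) (e n x \<otimes>\<^bsub>E (n + 1)\<^esub> inv\<^bsub>E (n + 1)\<^esub> e' n x)))" for n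
    proof -
      interpret Z: comm_group "Zgrp n" by (rule comm_group_Zgrp)
      interpret cl: group_hom "Zgrp n" "Hl n" "cls n" by (rule group_hom_of_comm_groups[OF comm_group_Zgrp comm_group_Hl cls_hom])
      interpret pr: group_hom "E (n + 1)" "G n" "pr (n + 1)" by (rule pr_hom')
      have "c e n x \<otimes>\<^bsub>Hl n\<^esub> inv\<^bsub>Hl n\<^esub> c e' n x = cls n (pr (n + 1) (e n x \<otimes>\<^bsub>E (n + 1)\<^esub> inv\<^bsub>E (n + 1)\<^esub> e' n x))"
        if x: "x \<in> K n" for x
      proof -
        have ee: "e n x \<in> carrier (E (n + 1))" "e' n x \<in> carrier (E (n + 1))" using relatedD(2)[OF R] relatedD(2)[OF R'] x by auto
        have z: "pr (n + 1) (e n x) \<in> cyc n" "pr (n + 1) (e' n x) \<in> cyc n" using pr_cyc ee by auto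
        have "inv\<^bsub>Zgrp n\<^esub> pr (n + 1) (e' n x) = inv\<^bsub>G n\<^esub> pr (n + 1) (e' n x)"
          using group.m_inv_consistent[OF comm_group.axioms(2)[OF G] subgroup_cyc z(2)] by simp
        then have "cls n (pr (n + 1) (e n x)) \<otimes>\<^bsub>Hl n\<^esub> inv\<^bsub>Hl n\<^esub> cls n (pr (n + 1) (e' n x)) = cls n (pr (n + 1) (e n x) \<otimes>\<^bsub>G n\<^esub> inv\<^bsub>G n\<^esub> pr (n + 1) (e' n x))"
          using cl.hom_mult[of "pr (n + 1) (e n x)" "inv\<^bsub>Zgrp n\<^esub> pr (n + 1) (e' n x)"] cl.hom_inv[of "pr (n + 1) (e' n x)"] z Z.inv_closed[of "pr (n + 1) (e' n x)"] by simp
        then show ?thesis using x ee by (simp add: c_def)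
      qed
      then have "coboundary (Hl n) n (\<lambda>x. c e n x \<otimes>\<^bsub>Hl n\<^esub> inv\<^bsub>Hl n\<^esub> c e' n x) \<longleftrightarrow>
        coboundary (Hl n) n (\<lambda>x. cls n (pr (n + 1) (e n x \<otimes>\<^bsub>E (n + 1)\<^esub> inv\<^bsub>E (n + 1)\<^esub> e' n x)))"
        by (simp add: coboundary_def)
      then show ?thesis unfolding k_def using cohom_class_eq_iff[OF comm_group_Hl cc[OF R] cc[OF R']] by simp
    qed
    \<comment> \<open>Over an empty \<open>K n\<close> every cochain is a coboundary, so the
      condition in all degrees reduces to the degrees in the support.\<close>
    have triv: "coboundary (Hl n) n d" if "K n = {}" for n d
    proof -
      have "\<one>\<^bsub>Hl n\<^esub> \<in> carrier (Hl n)"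
        by (rule monoid.one_closed[OF group.is_monoid[OF comm_group.axioms(2)[OF comm_group_Hl]]])
      then show ?thesis unfolding coboundary_def by (intro bexI[of _ "\<lambda>_. \<one>\<^bsub>Hl n\<^esub>"]) (auto simp: that)
    qed
    show ?thesis unfolding related_coboundary_iff[OF related_diff[OF R R']] eq using triv by fast
  qed
  define \<Phi> where "\<Phi> f = (\<lambda>n\<in>?S. k n (c (ef f) n))" for f
  have "card (carrier (H0_hom K dC G dG)) = card (\<Phi> ` carrier Z0grp)"
    unfolding H0_hom_eq
  proof (rule card_FactGroup_fibres[OF group_Z0grp subgroup_B0])
    fix f f' assume "f \<in> carrier Z0grp" "f' \<in> carrier Z0grp"
    then have f: "f \<in> Z0" "f' \<in> Z0" by simp_all
    let ?d = "\<lambda>n. \<lambda>x\<in>K n. f n x \<otimes>\<^bsub>G n\<^esub> inv\<^bsub>G n\<^esub> f' n x"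
    have "\<Phi> f = \<Phi> f' \<longleftrightarrow> (\<forall>n\<in>?S. k n (c (ef f) n) = k n (c (ef f') n))"
      unfolding \<Phi>_def by (auto simp: fun_eq_iff)
    also have "\<dots> \<longleftrightarrow> total_coboundary (\<lambda>n x. f n x \<otimes>\<^bsub>G n\<^esub> inv\<^bsub>G n\<^esub> f' n x)" by (rule same[OF ef[OF f(1)] ef[OF f(2)]])
    also have "\<dots> \<longleftrightarrow> total_coboundary ?d" by (simp add: total_coboundary_def)
    also have "\<dots> \<longleftrightarrow> ?d \<in> B0"
    proof (rule B0_iff[symmetric])
      interpret G: comm_group "G m" for m by (rule G)
      show "?d \<in> homset K G 0" using f by (auto simp: homset_0_iff PiE_iff)
    qed
    finally show "\<Phi> f = \<Phi> f' \<longleftrightarrow> f \<otimes>\<^bsub>Z0grp\<^esub> inv\<^bsub>Z0grp\<^esub> f' \<in> B0" unfolding Z0grp_diff[OF f] .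
  qed
  also have "\<Phi> ` carrier Z0grp = (\<Pi>\<^sub>E n\<in>?S. carrier (cohom K dC (Hl n) n))"
  proof (rule equalityI; rule subsetI)
    fix t assume "t \<in> \<Phi> ` carrier Z0grp"
    then obtain f where "f \<in> Z0" "t = \<Phi> f" by auto
    then show "t \<in> (\<Pi>\<^sub>E n\<in>?S. carrier (cohom K dC (Hl n) n))"
      using cc[OF ef] by (auto simp: \<Phi>_def cohom)
  next
    fix t assume t: "t \<in> (\<Pi>\<^sub>E n\<in>?S. carrier (cohom K dC (Hl n) n))"
    have "\<exists>d. d \<in> cocycles (Hl n) n \<and> (n \<in> ?S \<longrightarrow> t n = k n d)" for n
    proof (cases "n \<in> ?S")
      case True
      then have "t n \<in> k n ` cocycles (Hl n) n" using t by (auto simp: cohom PiE_iff)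
      then show ?thesis by auto
    next
      case False
      then show ?thesis using subgroup.one_closed[OF subgroup_cocycles[OF comm_group_Hl]] by auto
    qed
    then obtain d where d: "\<And>n. d n \<in> cocycles (Hl n) n" "\<And>n. n \<in> ?S \<Longrightarrow> t n = k n (d n)" by metis
    from related_class_surj[OF d(1)] obtain f e where fe: "related f e" "\<And>n. d n = c e n" unfolding c_def by auto
    define f' where "f' n = restrict (f n) (K n)" for n
    have R: "related f' e" using fe(1) by (auto simp: related_def f'_def Pi_iff)
    have f'h: "f' \<in> homset K G 0" using relatedD(1)[OF fe(1)] by (auto simp: homset_0_iff f'_def)
    have f': "f' \<in> Z0" unfolding Z0_iff total_cocycle_def using related_cocycle[OF R] f'h by auto
    \<comment> \<open>The zero cochain bounds. By \<open>same\<close>, the cochain chosen by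
      \<open>ef\<close> therefore yields the same classes as the \<open>e\<close> that realizes the
      prescribed tuple.\<close>
    have "total_coboundary (\<lambda>n x. f' n x \<otimes>\<^bsub>G n\<^esub> inv\<^bsub>G n\<^esub> f' n x)"
      using same[OF R R] by simp
    then have "\<forall>n\<in>?S. k n (c (ef f') n) = k n (c e n)" using same[OF ef[OF f'] R] by simp
    then have "t = \<Phi> f'" using d(2) fe(2) t by (auto simp: \<Phi>_def fun_eq_iff PiE_iff extensional_def)
    then show "t \<in> \<Phi> ` carrier Z0grp" using f' by auto
  qed
  also have "card \<dots> = (\<Prod>n\<in>?S. card (carrier (cohom K dC (Hl n) n)))"
    by (rule card_PiE[OF finite_support])
  finally show ?thesis .
qed

text \<open>The extension is taken over the cycles of degree \<open>n - 1\<close> and not over the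
  whole of \<open>G (n - 1)\<close>. The composite of \<open>pr\<close> with \<open>em\<close> is
  dG, so em pr squares to zero because \<open>pr\<close> takes cycles as values.\<close>

lemma (in hom_complex) card_H0_hom:
  "card (carrier (H0_hom K dC G dG)) = (\<Prod>n\<in>{n. K n \<noteq> {}}. card (carrier (cohom K dC (Hl n) n)))"
proof -
  have "\<exists>(E :: ((('g \<Rightarrow> complex) \<Rightarrow> complex) \<times> 'g) monoid) em pr.
    comm_group E \<and> em \<in> hom (G n) E \<and> inj_on em (carrier (G n)) \<and> pr \<in> hom E (Zgrp (n - 1)) \<and> pr ` carrier E = carrier (Zgrp (n - 1)) \<and>
    (\<forall>x\<in>carrier (G n). pr (em x) = dG n x) \<and>
    (\<forall>e\<in>carrier E. pr e = \<one>\<^bsub>Zgrp (n - 1)\<^esub> \<longrightarrow> (\<exists>x\<in>carrier (G n). dG n x = \<one>\<^bsub>Zgrp (n - 1)\<^esub> \<and> e = em x))" for n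
  proof (rule acyclic_extension[OF G finite_G comm_group_Zgrp])
    show "finite (carrier (Zgrp (n - 1)))"
      by (rule finite_subset[OF _ finite_G[of "n - 1"]]) (auto simp: cyc_iff)
    show "dG n \<in> hom (G n) (Zgrp (n - 1))" using dG[of n] dG_cyc[of _ "n - 1"] by (auto simp: hom_def)
  qed
  then obtain E :: "int \<Rightarrow> ((('g \<Rightarrow> complex) \<Rightarrow> complex) \<times> 'g) monoid" and em pr where res:
    "\<And>n. comm_group (E n) \<and> em n \<in> hom (G n) (E n) \<and> inj_on (em n) (carrier (G n)) \<and> pr n \<in> hom (E n) (Zgrp (n - 1)) \<and> pr n ` carrier (E n) = carrier (Zgrp (n - 1)) \<and>
    (\<forall>x\<in>carrier (G n). pr n (em n x) = dG n x) \<and>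
    (\<forall>e\<in>carrier (E n). pr n e = \<one>\<^bsub>Zgrp (n - 1)\<^esub> \<longrightarrow> (\<exists>x\<in>carrier (G n). dG n x = \<one>\<^bsub>Zgrp (n - 1)\<^esub> \<and> e = em n x))"
    by metis
  interpret resolved_hom_complex K dC G dG E em pr
  proof (rule resolved_hom_complex.intro[OF hom_complex_axioms], rule resolved_hom_complex_axioms.intro)
    show "pr n \<in> hom (E n) (G (n - 1))" for n using res[of n] by (auto simp: hom_def cyc_iff)
    show "\<exists>a\<in>cyc n. e = em n a" if "e \<in> carrier (E n)" "pr n e = \<one>\<^bsub>G (n - 1)\<^esub>" for e n
    proof -
      from res[of n] that obtain a where "a \<in> carrier (G n)" "dG n a = \<one>\<^bsub>G (n - 1)\<^esub>" "e = em n a" by auto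
      then show ?thesis by (intro bexI[of _ a]) (simp_all add: cyc_iff)
    qed
  qed (use res in auto)
  show ?thesis by (rule card_H0_hom_resolved)
qed

subsection \<open>Ground states\<close>

lemma sum_fun_apply: "(\<Sum>c\<in>C. F c) f = (\<Sum>c\<in>C. F c f :: complex)"
  by (induction C rule: infinite_finite_induct) auto

lemma vector_space_functions: "vector_space (\<lambda>(c::complex) \<Psi> f. c * \<Psi> f)"
  by unfold_locales (auto simp: fun_eq_iff algebra_simps)

text \<open>The indicator functions of the fibres of \<open>cl\<close> form a basis; the coefficient
  of a fibre is the value at any of its points.\<close>

lemma dim_fibrewise_constant:
  fixes Z :: "'a set" and cl :: "'a \<Rightarrow> 'c"
  assumes fin: "finite Z"
  shows "vector_space.dim (\<lambda>(c::complex) \<Psi> f. c * \<Psi> f)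
      {\<Psi>. (\<forall>f. f \<notin> Z \<longrightarrow> \<Psi> f = 0) \<and> (\<forall>f\<in>Z. \<forall>f'\<in>Z. cl f = cl f' \<longrightarrow> \<Psi> f = \<Psi> f')} = card (cl ` Z)"
    (is "vector_space.dim ?s ?V = _")
proof -
  interpret vs: vector_space ?s by (rule vector_space_functions)
  define ind :: "'c \<Rightarrow> 'a \<Rightarrow> complex" where "ind c f = (if f \<in> Z \<and> cl f = c then 1 else 0)" for c f
  have finC: "finite (cl ` Z)" using fin by simp
  have inj: "inj_on ind (cl ` Z)"
  proof (rule inj_onI)
    fix c c' assume "c \<in> cl ` Z" and eq: "ind c = ind c'"
    then obtain f where f: "f \<in> Z" "cl f = c" by auto
    from fun_cong[OF eq, of f] f show "c = c'" by (simp add: ind_def split: if_splits)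
  qed
  \<comment> \<open>At \<open>f\<close> only the indicator of its own fibre contributes. Spanning
    and independence are both read off from this evaluation.\<close>
  have ev: "(\<Sum>c\<in>cl ` Z. ?s (a c) (ind c)) f = (if f \<in> Z then a (cl f) else 0)" for a f
  proof -
    have "(\<Sum>c\<in>cl ` Z. ?s (a c) (ind c)) f = (\<Sum>c\<in>cl ` Z. a c * ind c f)" by (rule sum_fun_apply)
    also have "\<dots> = (\<Sum>c\<in>cl ` Z. if c = cl f then (if f \<in> Z then a c else 0) else 0)"
      by (intro sum.cong) (auto simp: ind_def)
    also have "\<dots> = (if f \<in> Z then a (cl f) else 0)" using finC by (simp add: sum.delta')
    finally show ?thesis .
  qed
  have "vs.dim ?V = card (ind ` cl ` Z)"
  proof (rule vs.dim_unique[OF _ _ _ refl])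
    show "ind ` cl ` Z \<subseteq> ?V" by (auto simp: ind_def)
    show "?V \<subseteq> vs.span (ind ` cl ` Z)"
    proof
      fix \<Psi> assume \<Psi>: "\<Psi> \<in> ?V"
      have "\<Psi> = (\<Sum>c\<in>cl ` Z. ?s (\<Psi> (inv_into Z cl c)) (ind c))"
      proof
        fix f
        show "\<Psi> f = (\<Sum>c\<in>cl ` Z. ?s (\<Psi> (inv_into Z cl c)) (ind c)) f"
        proof (cases "f \<in> Z")
          case True
          then have "inv_into Z cl (cl f) \<in> Z" "cl (inv_into Z cl (cl f)) = cl f"
            by (auto intro: inv_into_into f_inv_into_f)
          then have "\<Psi> (inv_into Z cl (cl f)) = \<Psi> f" using \<Psi> True by blast
          then show ?thesis unfolding ev using True by simp
        next
          case False
          then show ?thesis unfolding ev using \<Psi> by simp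
        qed
      qed
      also have "\<dots> \<in> vs.span (ind ` cl ` Z)"
        by (intro vs.span_sum vs.span_scale vs.span_base) auto
      finally show "\<Psi> \<in> vs.span (ind ` cl ` Z)" .
    qed
    show "vs.independent (ind ` cl ` Z)"
    proof (rule vs.independent_if_scalars_zero)
      show "finite (ind ` cl ` Z)" using finC by simp
      fix a v assume 0: "(\<Sum>v\<in>ind ` cl ` Z. ?s (a v) v) = 0" and "v \<in> ind ` cl ` Z"
      then obtain f where f: "f \<in> Z" "v = ind (cl f)" by auto
      have "(\<Sum>c\<in>cl ` Z. ?s (a (ind c)) (ind c)) = 0" using 0 by (simp add: sum.reindex[OF inj] comp_def)
      from fun_cong[OF this, of f] show "a v = 0" unfolding ev using f by simp
    qed
  qed
  then show ?thesis using card_image[OF inj] by simp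
qed

section \<open>The vertex operators and their common fixed vectors\<close>

context hom_complex
begin

text \<open>Restriction to the support of \<open>K\<close> loses nothing: in the remaining degrees a
  cochain is the unique extensional function on the empty set.\<close>

lemma finite_homset: "finite (homset K G p)"
proof (rule finite_imageD)
  let ?S = "{n. K n \<noteq> {}}"
  show "finite ((\<lambda>f. restrict f ?S) ` homset K G p)"
  proof (rule finite_subset)
    show "(\<lambda>f. restrict f ?S) ` homset K G p \<subseteq> (\<Pi>\<^sub>E n\<in>?S. K n \<rightarrow>\<^sub>E carrier (G (n - p)))"
      unfolding homset_def by (rule image_subsetI) (simp add: restrict_PiE_iff)
    show "finite (\<Pi>\<^sub>E n\<in>?S. K n \<rightarrow>\<^sub>E carrier (G (n - p)))"
      by (intro finite_PiE finite_support finite_K finite_G)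
  qed
  show "inj_on (\<lambda>f. restrict f ?S) (homset K G p)"
  proof (rule inj_onI)
    fix f g assume f: "f \<in> homset K G p" and g: "g \<in> homset K G p" and eq: "restrict f ?S = restrict g ?S"
    show "f = g"
    proof
      fix n show "f n = g n"
      proof (cases "K n = {}")
        case True
        have "f n \<in> extensional (K n)" "g n \<in> extensional (K n)" using f g by (auto simp: homset_def PiE_iff)
        then show ?thesis using True by simp
      next
        case False
        then show ?thesis using fun_cong[OF eq, of n] by simp
      qed
    qed
  qed
qed

abbreviation M0 where "M0 \<equiv> homgrp K G 0"

lemma homgrp_simps: "carrier (homgrp K G p) = homset K G p" "f \<otimes>\<^bsub>homgrp K G p\<^esub> g = hadd K G p f g" "\<one>\<^bsub>homgrp K G p\<^esub> = hzero K G p"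
  by (simp_all add: homgrp_def)

text \<open>The average of r(a) over all characters is 1 if \<open>a\<close> is the identity and 0
  otherwise. So the operator projects onto the configurations satisfying the cocycle condition at
  \<open>x\<close>.\<close>

lemma Bvert_eq:
  assumes x: "x \<in> K n"
  shows "Bvert K dC G dG n x \<one>\<^bsub>G (n - 1)\<^esub> \<Psi> f = (if f \<in> homset K G 0 \<and> cobdry K dC G dG 0 f n x = \<one>\<^bsub>G (n - 1)\<^esub> then \<Psi> f else 0)"
proof (cases "f \<in> homset K G 0")
  case True
  interpret G1: comm_group "G (n - 1)" by (rule G)
  let ?a = "cobdry K dC G dG 0 f n x"
  have "cobdry K dC G dG 0 f \<in> homset K G 1"
    using hom_in_carrier[OF cobdry_hom[of 0], of f] True by (simp add: homgrp_simps)
  then have a: "?a \<in> carrier (G (n - 1))" using x by (auto simp: homset_def PiE_iff)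
  have pos: "of_nat (card (carrier (G (n - 1)))) \<noteq> (0::complex)"
    using finite_G[of "n - 1"] G1.one_closed by auto
  have "Bvert K dC G dG n x \<one>\<^bsub>G (n - 1)\<^esub> \<Psi> f = (1 / of_nat (card (carrier (G (n - 1))))) * (\<Sum>r\<in>chars (G (n - 1)). r ?a * \<Psi> f)"
    unfolding Bvert_def Bop_def Qop_def using True
    by (intro arg_cong[where f = "\<lambda>s. _ * s"] sum.cong[OF refl]) (simp add: G1.chars_one)
  also have "\<dots> = (1 / of_nat (card (carrier (G (n - 1))))) * ((\<Sum>r\<in>chars (G (n - 1)). r ?a) * \<Psi> f)"
    by (simp add: sum_distrib_right)
  also have "\<dots> = (if ?a = \<one>\<^bsub>G (n - 1)\<^esub> then \<Psi> f else 0)"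
    using pos by (simp add: G1.sum_chars[OF finite_G a])
  finally show ?thesis using True by simp
next
  case False
  then show ?thesis by (simp add: Bvert_def Bop_def Qop_def)
qed

definition gauge where "gauge n x h = cobdry K dC G dG (-1) (dualbasis K G (-1) n x h)"

lemma dualbasis_hom: "x \<in> K n \<Longrightarrow> dualbasis K G p n x \<in> hom (G (n - p)) (homgrp K G p)"
proof (rule homI)
  interpret G: comm_group "G m" for m by (rule G)
  assume x: "x \<in> K n"
  fix h assume h: "h \<in> carrier (G (n - p))"
  then show "dualbasis K G p n x h \<in> carrier (homgrp K G p)" by (auto simp: homgrp_def homset_def dualbasis_def)
  fix g assume g: "g \<in> carrier (G (n - p))"
  show "dualbasis K G p n x (h \<otimes>\<^bsub>G (n - p)\<^esub> g) = dualbasis K G p n x h \<otimes>\<^bsub>homgrp K G p\<^esub> dualbasis K G p n x g"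
    using g h by (auto simp: homgrp_def hadd_def dualbasis_def fun_eq_iff)
qed

lemma gauge_hom: "x \<in> K n \<Longrightarrow> gauge n x \<in> hom (G (n + 1)) M0"
  using Group.hom_compose[OF dualbasis_hom[of x n "-1"] cobdry_hom[of "-1"]]
  by (simp add: gauge_def[abs_def] comp_def)

lemma Avert_eq:
  assumes x: "x \<in> K n" and f: "f \<in> homset K G 0"
  shows "Avert K dC G dG n x (\<lambda>_. 1) \<Psi> f = (1 / of_nat (card (carrier (G (n + 1))))) *
      (\<Sum>h\<in>carrier (G (n + 1)). \<Psi> (f \<otimes>\<^bsub>M0\<^esub> inv\<^bsub>M0\<^esub> gauge n x h))"
proof -
  have "inv\<^bsub>M0\<^esub> gauge n x h = hneg K G 0 (gauge n x h)" if "h \<in> carrier (G (n + 1))" for h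
    by (rule inv_homgrp[OF G]) (use hom_in_carrier[OF gauge_hom[OF x] that] in \<open>simp add: homgrp_simps\<close>)
  then show ?thesis unfolding Avert_def Aop_def Pop_def gauge_def[symmetric]
    using f by (simp add: homgrp_simps cong: sum.cong)
qed

text \<open>The average of a finite group of translations is a projector onto the invariants, so
  being fixed by it is the same as being fixed by every single translation.\<close>

lemma Avert_fixed_iff:
  assumes x: "x \<in> K n" and \<Psi>: "\<Psi> \<in> hilbert K G"
  shows "Avert K dC G dG n x (\<lambda>_. 1) \<Psi> = \<Psi> \<longleftrightarrow>
    (\<forall>f\<in>homset K G 0. \<forall>h\<in>carrier (G (n + 1)). \<Psi> (f \<otimes>\<^bsub>M0\<^esub> inv\<^bsub>M0\<^esub> gauge n x h) = \<Psi> f)"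
proof
  interpret M: comm_group M0 by (rule comm_group_homgrp[OF G])
  interpret G1: comm_group "G (n + 1)" by (rule G)
  interpret t: group_hom "G (n + 1)" M0 "gauge n x"
    by (rule group_hom_of_comm_groups[OF G comm_group_homgrp[OF G] gauge_hom[OF x]])
  let ?c = "of_nat (card (carrier (G (n + 1)))) :: complex"
  have pos: "?c \<noteq> 0" using finite_G[of "n + 1"] G1.one_closed by auto
  {
    assume A: "Avert K dC G dG n x (\<lambda>_. 1) \<Psi> = \<Psi>"
    show "\<forall>f\<in>homset K G 0. \<forall>h\<in>carrier (G (n + 1)). \<Psi> (f \<otimes>\<^bsub>M0\<^esub> inv\<^bsub>M0\<^esub> gauge n x h) = \<Psi> f"
    proof (intro ballI)
      fix f g assume f: "f \<in> homset K G 0" and g: "g \<in> carrier (G (n + 1))"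
      have fM: "f \<in> carrier M0" using f by (simp add: homgrp_simps)
      let ?f' = "f \<otimes>\<^bsub>M0\<^esub> inv\<^bsub>M0\<^esub> gauge n x g"
      have f': "?f' \<in> homset K G 0" using M.m_closed[OF fM M.inv_closed[OF t.hom_closed[OF g]]] by (simp add: homgrp_simps)
      \<comment> \<open>Averaging over the group of gauge transformations at \<open>x\<close> yields a function invariant under it.\<close>
      have bij: "bij_betw (\<lambda>h. g \<otimes>\<^bsub>G (n + 1)\<^esub> h) (carrier (G (n + 1))) (carrier (G (n + 1)))"
        by (rule bij_betw_byWitness[where f' = "\<lambda>a. inv\<^bsub>G (n + 1)\<^esub> g \<otimes>\<^bsub>G (n + 1)\<^esub> a"])
           (use g in \<open>auto simp: G1.m_assoc[symmetric]\<close>)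
      have "\<Psi> ?f' = (1 / ?c) * (\<Sum>h\<in>carrier (G (n + 1)). \<Psi> (?f' \<otimes>\<^bsub>M0\<^esub> inv\<^bsub>M0\<^esub> gauge n x h))"
        using fun_cong[OF A, of ?f'] Avert_eq[OF x f', of \<Psi>] by simp
      also have "(\<Sum>h\<in>carrier (G (n + 1)). \<Psi> (?f' \<otimes>\<^bsub>M0\<^esub> inv\<^bsub>M0\<^esub> gauge n x h))
          = (\<Sum>h\<in>carrier (G (n + 1)). \<Psi> (f \<otimes>\<^bsub>M0\<^esub> inv\<^bsub>M0\<^esub> gauge n x (g \<otimes>\<^bsub>G (n + 1)\<^esub> h)))"
      proof (rule sum.cong[OF refl])
        fix h assume h: "h \<in> carrier (G (n + 1))"
        have "?f' \<otimes>\<^bsub>M0\<^esub> inv\<^bsub>M0\<^esub> gauge n x h = f \<otimes>\<^bsub>M0\<^esub> inv\<^bsub>M0\<^esub> gauge n x (g \<otimes>\<^bsub>G (n + 1)\<^esub> h)"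
          unfolding t.hom_mult[OF g h] M.inv_mult[OF t.hom_closed[OF g] t.hom_closed[OF h]]
          by (rule M.m_assoc[OF fM M.inv_closed[OF t.hom_closed[OF g]] M.inv_closed[OF t.hom_closed[OF h]]])
        then show "\<Psi> (?f' \<otimes>\<^bsub>M0\<^esub> inv\<^bsub>M0\<^esub> gauge n x h) = \<Psi> (f \<otimes>\<^bsub>M0\<^esub> inv\<^bsub>M0\<^esub> gauge n x (g \<otimes>\<^bsub>G (n + 1)\<^esub> h))" by simp
      qed
      also have "\<dots> = (\<Sum>h\<in>carrier (G (n + 1)). \<Psi> (f \<otimes>\<^bsub>M0\<^esub> inv\<^bsub>M0\<^esub> gauge n x h))"
        by (rule sum.reindex_bij_betw[OF bij])
      also have "(1 / ?c) * \<dots> = \<Psi> f" using fun_cong[OF A, of f] Avert_eq[OF x f, of \<Psi>] by simp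
      finally show "\<Psi> ?f' = \<Psi> f" .
    qed
  }
  assume inv: "\<forall>f\<in>homset K G 0. \<forall>h\<in>carrier (G (n + 1)). \<Psi> (f \<otimes>\<^bsub>M0\<^esub> inv\<^bsub>M0\<^esub> gauge n x h) = \<Psi> f"
  show "Avert K dC G dG n x (\<lambda>_. 1) \<Psi> = \<Psi>"
  proof
    fix f show "Avert K dC G dG n x (\<lambda>_. 1) \<Psi> f = \<Psi> f"
    proof (cases "f \<in> homset K G 0")
      case True
      then show ?thesis unfolding Avert_eq[OF x True] using inv pos by simp
    next
      case False
      then show ?thesis using \<Psi> by (simp add: Avert_def Aop_def Pop_def hilbert_def)
    qed
  qed
qed

text \<open>Being a subgroup is what allows invariance to spread from the local translations to
  everything they generate.\<close>

lemma subgroup_stabilizer: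
  fixes \<Psi> :: "_ \<Rightarrow> complex"
  shows "subgroup {s \<in> carrier M0. \<forall>f\<in>carrier M0. \<Psi> (f \<otimes>\<^bsub>M0\<^esub> inv\<^bsub>M0\<^esub> s) = \<Psi> f} M0"
    (is "subgroup ?S M0")
proof -
  interpret M: comm_group M0 by (rule comm_group_homgrp[OF G])
  show ?thesis
  proof (rule M.subgroupI)
    show "?S \<subseteq> carrier M0" by auto
    show "?S \<noteq> {}" using M.one_closed by (auto intro!: exI[of _ "\<one>\<^bsub>M0\<^esub>"])
  next
    fix s assume s: "s \<in> ?S"
    have "\<Psi> (f \<otimes>\<^bsub>M0\<^esub> s) = \<Psi> f" if f: "f \<in> carrier M0" for f
    proof -
      have fs: "f \<otimes>\<^bsub>M0\<^esub> s \<in> carrier M0" using s f by simp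
      have "\<Psi> (f \<otimes>\<^bsub>M0\<^esub> s \<otimes>\<^bsub>M0\<^esub> inv\<^bsub>M0\<^esub> s) = \<Psi> (f \<otimes>\<^bsub>M0\<^esub> s)" using s fs by auto
      then show ?thesis using s f by (simp add: M.m_assoc)
    qed
    then show "inv\<^bsub>M0\<^esub> s \<in> ?S" using s by auto
  next
    fix s t assume s: "s \<in> ?S" and t: "t \<in> ?S"
    have c: "s \<in> carrier M0" "t \<in> carrier M0" using s t by auto
    have "\<Psi> (f \<otimes>\<^bsub>M0\<^esub> inv\<^bsub>M0\<^esub> (s \<otimes>\<^bsub>M0\<^esub> t)) = \<Psi> f" if f: "f \<in> carrier M0" for f
    proof -
      have "f \<otimes>\<^bsub>M0\<^esub> inv\<^bsub>M0\<^esub> (s \<otimes>\<^bsub>M0\<^esub> t) = f \<otimes>\<^bsub>M0\<^esub> inv\<^bsub>M0\<^esub> s \<otimes>\<^bsub>M0\<^esub> inv\<^bsub>M0\<^esub> t"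
        using c f by (simp add: M.inv_mult M.m_assoc)
      moreover have "f \<otimes>\<^bsub>M0\<^esub> inv\<^bsub>M0\<^esub> s \<in> carrier M0" using c f by simp
      ultimately show ?thesis using s t f by auto
    qed
    then show "s \<otimes>\<^bsub>M0\<^esub> t \<in> ?S" using c by auto
  qed
qed

text \<open>A cochain has only finitely many coordinates, indexed by pairs of a degree and a basis
  element; it is built up by multiplying in one coordinate at a time.\<close>

lemma homgrp_generated_by_dualbasis:
  assumes H: "subgroup H (homgrp K G p)"
    and gen: "\<And>n x h. x \<in> K n \<Longrightarrow> h \<in> carrier (G (n - p)) \<Longrightarrow> dualbasis K G p n x h \<in> H"
  shows "homset K G p \<subseteq> H"
proof
  interpret G: comm_group "G m" for m by (rule G)
  fix u assume u: "u \<in> homset K G p"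
  have uc: "u n x \<in> carrier (G (n - p))" if "x \<in> K n" for n x using u that by (auto simp: homset_def PiE_iff)
  define cut where "cut T = (\<lambda>n. \<lambda>x\<in>K n. if (n, x) \<in> T then u n x else \<one>\<^bsub>G (n - p)\<^esub>)" for T
  have cutH: "cut T \<in> H" if "finite T" "T \<subseteq> Sigma {n. K n \<noteq> {}} K" for T
    using that
  proof (induction T rule: finite_induct)
    case empty
    have "cut {} = \<one>\<^bsub>homgrp K G p\<^esub>" by (simp add: cut_def homgrp_def hzero_def)
    then show ?case using subgroup.one_closed[OF H] by simp
  next
    case (insert nx T)
    obtain n x where nx: "nx = (n, x)" "x \<in> K n" using insert.prems by (cases nx) auto
    have "cut (insert nx T) = dualbasis K G p n x (u n x) \<otimes>\<^bsub>homgrp K G p\<^esub> cut T"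
      using insert.hyps nx uc by (auto simp: cut_def homgrp_def hadd_def dualbasis_def fun_eq_iff)
    then show ?case using subgroup.m_closed[OF H gen[OF nx(2) uc[OF nx(2)]]] insert by simp
  qed
  have "finite (Sigma {n. K n \<noteq> {}} K)" by (intro finite_SigmaI finite_support finite_K)
  from cutH[OF this] have "cut (Sigma {n. K n \<noteq> {}} K) \<in> H" by simp
  moreover have "cut (Sigma {n. K n \<noteq> {}} K) = u"
    using u by (auto simp: cut_def homset_def fun_eq_iff PiE_iff extensional_def)
  ultimately show "u \<in> H" by simp
qed

lemma ground_eq:
  "ground K dC G dG = {\<Psi>. (\<forall>f. f \<notin> Z0 \<longrightarrow> \<Psi> f = 0) \<and>
     (\<forall>f\<in>Z0. \<forall>f'\<in>Z0. B0 #>\<^bsub>Z0grp\<^esub> f = B0 #>\<^bsub>Z0grp\<^esub> f' \<longrightarrow> \<Psi> f = \<Psi> f')}" (is "_ = ?V")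
proof (rule equalityI; rule subsetI)
  interpret M: comm_group M0 by (rule comm_group_homgrp[OF G])
  interpret Z: group Z0grp by (rule group_Z0grp)
  interpret \<delta>: group_hom "homgrp K G (-1)" M0 "cobdry K dC G dG (-1)"
    by (rule group_hom_of_comm_groups) (use cobdry_hom[of "-1"] in \<open>auto intro: comm_group_homgrp G\<close>)
  have Zinv: "inv\<^bsub>Z0grp\<^esub> f = inv\<^bsub>M0\<^esub> f" if "f \<in> Z0" for f
    using M.m_inv_consistent[OF subgroup_Z0 that] by simp
  have coset: "B0 #>\<^bsub>Z0grp\<^esub> f = B0 #>\<^bsub>Z0grp\<^esub> f' \<longleftrightarrow> f \<otimes>\<^bsub>M0\<^esub> inv\<^bsub>M0\<^esub> f' \<in> B0" if "f \<in> Z0" "f' \<in> Z0" for f f'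
    using Z.rcos_eq_iff[OF subgroup_B0, of f f'] that Zinv[OF that(2)] by simp
  have Zc: "f \<in> carrier M0" if "f \<in> Z0" for f using that by (simp add: homgrp_simps)
  {
    fix \<Psi> assume g: "\<Psi> \<in> ground K dC G dG"
    then have h: "\<Psi> \<in> hilbert K G" by (simp add: ground_def)
    have supp: "\<Psi> f = 0" if f: "f \<notin> Z0" for f
    proof (cases "f \<in> homset K G 0")
      case True
      then obtain n x where x: "x \<in> K n" "cobdry K dC G dG 0 f n x \<noteq> \<one>\<^bsub>G (n - 1)\<^esub>"
        using f cobdry_0[OF True] unfolding Z0_iff total_cocycle_def by auto
      have "Bvert K dC G dG n x \<one>\<^bsub>G (n - 1)\<^esub> \<Psi> f = \<Psi> f" using g x(1) by (simp add: ground_def)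
      then show ?thesis unfolding Bvert_eq[OF x(1)] using x(2) by simp
    next
      case False
      then show ?thesis using h by (simp add: hilbert_def)
    qed
    let ?S = "{s \<in> carrier M0. \<forall>f\<in>carrier M0. \<Psi> (f \<otimes>\<^bsub>M0\<^esub> inv\<^bsub>M0\<^esub> s) = \<Psi> f}"
    \<comment> \<open>The preimage of the stabilizer under the coboundary is a subgroup of hom^{-1}.
      It contains the elements of the dual basis, hence everything, so all of \<open>B0\<close>
      stabilizes the state.\<close>
    let ?P = "{u \<in> carrier (homgrp K G (-1)). cobdry K dC G dG (-1) u \<in> ?S}"
    have P: "subgroup ?P (homgrp K G (-1))"
    proof (rule \<delta>.G.subgroupI)
      note S = subgroup_stabilizer[of \<Psi>]
      show "?P \<noteq> {}" using subgroup.one_closed[OF S] \<delta>.hom_one \<delta>.G.one_closed by (metis (mono_tags, lifting) empty_iff mem_Collect_eq)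
      show "inv\<^bsub>homgrp K G (-1)\<^esub> a \<in> ?P" if "a \<in> ?P" for a
        using subgroup.m_inv_closed[OF S, of "cobdry K dC G dG (-1) a"] that \<delta>.hom_inv[of a] by simp
      show "a \<otimes>\<^bsub>homgrp K G (-1)\<^esub> b \<in> ?P" if "a \<in> ?P" "b \<in> ?P" for a b
        using subgroup.m_closed[OF S, of "cobdry K dC G dG (-1) a" "cobdry K dC G dG (-1) b"] that \<delta>.hom_mult[of a b] by simp
    qed auto
    have "homset K G (-1) \<subseteq> ?P"
    proof (rule homgrp_generated_by_dualbasis[OF P])
      fix n x h' assume x: "x \<in> K n" and "h' \<in> carrier (G (n - (-1)))"
      then have h': "h' \<in> carrier (G (n + 1))" by simp
      have "Avert K dC G dG n x (\<lambda>_. 1) \<Psi> = \<Psi>" using g x by (simp add: ground_def)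
      then have "gauge n x h' \<in> ?S"
        using Avert_fixed_iff[OF x h] h' hom_in_carrier[OF gauge_hom[OF x] h'] by (simp add: homgrp_simps(1))
      moreover have "dualbasis K G (-1) n x h' \<in> carrier (homgrp K G (-1))"
        using hom_in_carrier[OF dualbasis_hom[OF x, of "-1"]] h' by simp
      ultimately show "dualbasis K G (-1) n x h' \<in> ?P" by (simp add: gauge_def)
    qed
    then have BS: "B0 \<subseteq> ?S" by auto
    have "\<Psi> f = \<Psi> f'" if f: "f \<in> Z0" "f' \<in> Z0" "B0 #>\<^bsub>Z0grp\<^esub> f = B0 #>\<^bsub>Z0grp\<^esub> f'" for f f'
    proof -
      let ?b = "f \<otimes>\<^bsub>M0\<^esub> inv\<^bsub>M0\<^esub> f'"
      have "?b \<in> ?S" using BS f(3) unfolding coset[OF f(1,2)] by auto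
      then have "\<Psi> (f \<otimes>\<^bsub>M0\<^esub> inv\<^bsub>M0\<^esub> ?b) = \<Psi> f" using Zc[OF f(1)] by auto
      moreover have "f \<otimes>\<^bsub>M0\<^esub> inv\<^bsub>M0\<^esub> ?b = f'"
        using Zc[OF f(1)] Zc[OF f(2)] by (simp add: M.inv_mult M.m_assoc[symmetric])
      ultimately show ?thesis by simp
    qed
    then show "\<Psi> \<in> ?V" using supp by blast
  }
  fix \<Psi> assume V: "\<Psi> \<in> ?V"
  have V1: "\<Psi> f = 0" if "f \<notin> Z0" for f using V that by fast
  have V2: "\<Psi> f = \<Psi> f'" if "f \<in> Z0" "f' \<in> Z0" "B0 #>\<^bsub>Z0grp\<^esub> f = B0 #>\<^bsub>Z0grp\<^esub> f'" for f f'
    by (rule conjunct2[OF CollectD[OF V], THEN bspec, THEN bspec, THEN mp]) (fact that)+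
  have h: "\<Psi> \<in> hilbert K G" using V1 by (simp add: hilbert_def)
  \<comment> \<open>Translation by \<open>b\<close> preserves both \<open>Z0\<close> and its
    complement. Inside \<open>Z0\<close> it moves \<open>f\<close> within its coset; outside, both
    values are zero.\<close>
  have inv: "\<Psi> (f \<otimes>\<^bsub>M0\<^esub> inv\<^bsub>M0\<^esub> b) = \<Psi> f" if f: "f \<in> homset K G 0" and b: "b \<in> B0" for f b
  proof -
    have bZ: "b \<in> Z0" using b B0_subset_Z0 by auto
    have c: "f \<in> carrier M0" "b \<in> carrier M0" using f Zc[OF bZ] by (simp_all add: homgrp_simps)
    let ?f' = "f \<otimes>\<^bsub>M0\<^esub> inv\<^bsub>M0\<^esub> b"
    have ff': "f = ?f' \<otimes>\<^bsub>M0\<^esub> b" using c by (simp add: M.m_assoc)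
    show ?thesis
    proof (cases "f \<in> Z0")
      case True
      have f': "?f' \<in> Z0" by (intro subgroup.m_closed[OF subgroup_Z0] subgroup.m_inv_closed[OF subgroup_Z0] True bZ)
      have e: "f \<otimes>\<^bsub>M0\<^esub> inv\<^bsub>M0\<^esub> ?f' = b"
        using c by (simp add: M.inv_mult M.m_assoc[symmetric])
      have "B0 #>\<^bsub>Z0grp\<^esub> f = B0 #>\<^bsub>Z0grp\<^esub> ?f'" unfolding coset[OF True f'] e by (rule b)
      from V2[OF True f' this] show ?thesis by (rule sym)
    next
      case False
      have "?f' \<notin> Z0"
      proof
        assume "?f' \<in> Z0"
        from subgroup.m_closed[OF subgroup_Z0 this bZ] have "f \<in> Z0" unfolding ff'[symmetric] .
        then show False using False by contradiction
      qed
      from V1[OF this] V1[OF False] show ?thesis by (rule trans[OF _ sym])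
    qed
  qed
  show "\<Psi> \<in> ground K dC G dG"
    unfolding ground_def
  proof (intro CollectI conjI h allI ballI)
    fix n x assume x: "x \<in> K n"
    show "Avert K dC G dG n x (\<lambda>_. 1) \<Psi> = \<Psi>"
      unfolding Avert_fixed_iff[OF x h]
    proof (intro ballI inv)
      fix h assume "h \<in> carrier (G (n + 1))"
      then have "dualbasis K G (-1) n x h \<in> homset K G (-1)"
        using hom_in_carrier[OF dualbasis_hom[OF x, of "-1"], of h] by (simp add: homgrp_simps)
      then show "gauge n x h \<in> B0" by (simp add: gauge_def)
    qed
    show "Bvert K dC G dG n x \<one>\<^bsub>G (n - 1)\<^esub> \<Psi> = \<Psi>"
    proof
      fix f show "Bvert K dC G dG n x \<one>\<^bsub>G (n - 1)\<^esub> \<Psi> f = \<Psi> f"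
      proof (cases "f \<in> Z0")
        case True
        then show ?thesis unfolding Bvert_eq[OF x] using x by (simp add: hzero_def)
      next
        case False
        then show ?thesis unfolding Bvert_eq[OF x] using V1[OF False] by simp
      qed
    qed
  qed
qed

lemma dim_ground:
  "vector_space.dim (\<lambda>(c::complex) \<Psi> f. c * \<Psi> f) (ground K dC G dG) = card (carrier (H0_hom K dC G dG))"
proof -
  have fin: "finite Z0" by (rule finite_subset[OF _ finite_homset[of 0]]) auto
  have "carrier (H0_hom K dC G dG) = (\<lambda>f. B0 #>\<^bsub>Z0grp\<^esub> f) ` Z0"
    unfolding H0_hom_eq carrier_FactGroup_image by simp
  then show ?thesis
    unfolding ground_eq using dim_fibrewise_constant[OF fin, of "\<lambda>f. B0 #>\<^bsub>Z0grp\<^esub> f"] by simp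
qed

end

text \<open>The product over all degrees is finite: when \<open>K n\<close> is empty there is a
  single \<open>n\<close>-cochain, so the factor of that degree is 1, and the product runs over the
  support of \<open>K\<close>.\<close>

theorem theorem2:
  fixes K :: "int \<Rightarrow> 'k set" and dC :: "int \<Rightarrow> 'k \<Rightarrow> 'k \<Rightarrow> int"
    and G :: "int \<Rightarrow> 'g monoid" and dG :: "int \<Rightarrow> 'g \<Rightarrow> 'g"
  assumes "\<forall>n. finite (K n)"
    and "finite {n. K n \<noteq> {}}"
    and "\<forall>n. \<forall>x\<in>K n. \<forall>z\<in>K (n - 2). (\<Sum>y\<in>K (n - 1). dC n x y * dC (n - 1) y z) = 0"
    and "\<forall>n. comm_group (G n)"
    and "\<forall>n. finite (carrier (G n))"
    and "\<forall>n. dG n \<in> hom (G n) (G (n - 1))"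
    and "\<forall>n. \<forall>a\<in>carrier (G n). dG (n - 1) (dG n a) = \<one>\<^bsub>G (n - 2)\<^esub>"
  shows "vector_space.dim (\<lambda>(c::complex) \<Psi> f. c * \<Psi> f) (ground K dC G dG)
           = card (carrier (H0_hom K dC G dG))
       \<and> card (carrier (H0_hom K dC G dG))
           = (\<Prod>n\<in>{n. K n \<noteq> {}}. card (carrier (cohom K dC (homology G dG n) n)))"
proof -
  have "based_complex K dC" by (rule based_complex.intro) (use assms in simp_all)
  then interpret hom_complex K dC G dG
    by (rule hom_complex.intro, intro hom_complex_axioms.intro) (use assms in simp_all)
  show ?thesis using dim_ground card_H0_hom by simp
qed

end
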